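(* Assume that $A_1$ has compact resolvent, is semibounded from below, that $\bigl(\bigcup_{k=1}^m\Delta_k^0\bigr)\cap\sigma(A_1)$ is infinite, and $\Delta_m^0=(\mu_m^{(1)},+\infty)$. Let $\lambda_1^{(A_1)}<\lambda_2^{(A_1)}<\dots$ be the eigenvalues of $A_1$ and assume $$\sum_{i=1}^\infty(\lambda_{i+1}^{(A_1)}-\lambda_i^{(A_1)})^{-2}<\infty .$$ Let $r$ and $i_0$ be such that $\lambda_i^{(A_1)}-\lambda_{i-1}^{(A_1)}>2r>4r_0(B)$ for all $i\ge i_0$. Suppose there is a $K_B$-bounded contour $\Gamma_l\subset D_l$ with $\mathcal V_0(B,\Gamma_l)<\frac14d_0^2(\Gamma_l)$ such that: (i) a part of its component $\Gamma_m^{l_m}$ coincides with the ray $\tilde\Delta_m^0=[\mu_0,\mathrm ib_0+\infty)=\{x+\mathrm ib_0:x\ge a_0\}$, where $\mu_0=a_0+\mathrm ib_0\in D_m^{l_m}$, $a_0,b_0\in\mathbb R$; (ii) the remaining part $\Gamma_l\setminus\tilde\Delta_m^0$ lies in the half-plane $\operatorname{Re}\mu<a_0$; (iii) $\|K_B'(\mu)\|\le\tilde C(1+|\operatorname{Re}\mu|)^{-\theta}$ for $\mu\in\tilde\Delta_m^0$, with some $\tilde C>0$ and $\theta>1$. Then the sequence of subspaces $\mathcal N_i^{(l)}=\mathsf Q_i^{(l)}\mathcal H_1$, $i=0,i_0,i_0+1,\dots$, forms a basis (of subspaces) of $\mathcal H_1$, quadratically close to an orthogonal one. If, additionally, there is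 $n\in\mathbb N$ with $\dim\mathsf P_i^{(A_1)}\mathcal H_1\le n$ for all $i=0,i_0,i_0+1,\dots$, then the union of orthonormal vector bases of the subspaces $\mathcal N_i^{(l)}$, $i=0,i_0,i_0+1,\dots$, forms a Bari basis of $\mathcal H_1$.
   Context: Setting. $\mathcal H_0,\mathcal H_1$ are separable Hilbert spaces; $A_0$, $A_1$ are (possibly unbounded) self-adjoint operators in $\mathcal H_0$, $\mathcal H_1$; $B_{01}:\mathcal H_1\to\mathcal H_0$ is bounded and $B_{10}=B_{01}^*$. $E_0$ is the spectral measure of $A_0$, $E^0(\mu)=E_0((-\infty,\mu))$, and $K_B(\mu)=B_{10}E^0(\mu)B_{01}$. Spectral assumptions. There are finitely many pairwise disjoint open intervals $\Delta_k^0=(\mu_k^{(1)},\mu_k^{(2)})$, $k=1,\dots,m$ ($1\le m<\infty$, $-\infty\le\mu_1^{(1)}$, $\mu_m^{(2)}\le+\infty$), contained in the continuous spectrum $\sigma_c(A_0)$ (no eigenvalues of $A_0$ lie in them), with $\Delta_k^0\cap\sigma(A_1)\ne\emptyset$ for all $k$ and $\sigma(A_1)\cap\sigma'(A_0)=\emptyset$, where $\sigma'(A_0)=\sigma(A_0)\setminus\bigcup_{k=1}^m\Delta_k^0$. Analyticity assumptions. On each $\Delta_k^0$ the function $K_B(\mu)$ is differentiable in operator norm; $K_B'$ is continuous on $\overline{\Delta_k^0}$ and has an analytic continuation from $\Delta_k^0$ to a simply connected domain $D_k^-\subset\mathbb C^-$ whose boundary contains $\Delta_k^0$ (the $D_k^-$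 are mutually disjoint for different $k$), hence also to $D_k^+=\{z:\bar z\in D_k^-\}$; the continuations are still denoted $K_B'$. At finite end points $\mu_k^{(i)}$, $\|K'_B(\mu)-K'_B(\mu_k^{(i)})\|\le C|\mu-\mu_k^{(i)}|^\gamma$ for $\mu\in D_k^\pm$, with some $C,\gamma>0$. Contours. For $l=(l_1,\dots,l_m)$, $l_k=\pm1$, put $D_l=\bigcup_kD_k^{l_k}$, where $D_k^{\pm1}=D_k^\pm$. A contour $\Gamma_l=\bigcup_k\Gamma_k^{l_k}$ consists of rectifiable Jordan curves $\Gamma_k^{l_k}$ in $D_k^{l_k}$ obtained by continuous deformation of $\Delta_k^0$ with the (finite) end points kept fixed, whose closures have no points in common with $\sigma_c(A_0)$ other than end points. The modified variation is $$\mathcal V_0(B,\Gamma_l)=\sup_{\{\delta_k\}}\sum_k\|B_{10}E_0(\delta_k\cap\sigma'(A_0))B_{01}\|+\int_{\Gamma_l}|d\mu|\,\|K_B'(\mu)\|,$$ the supremum over finite or countable partitions of $\sigma(A_0)$ into disjoint Borel sets. $\Gamma_l$ is $K_B$-bounded if $\mathcal V_0(B,\Gamma_l)<\infty$. $d_0(\Gamma_l)=\operatorname{dist}\{\sigma(A_1),\sigma'(A_0)\cup\Gamma_l\}$. The operators $X^{(l)},H_1^{(l)}$. For $Y$ in $\mathcal H_1$ with spectrum separated from $\sigma'(A_0)\cup\Gamma_l$, put $V_1(Y,\Gamma_l)=\int_{\sigma'(A_0)}B_{10}E_0(d\mu)B_{01}(Y-\mu)^{-1}+\int_{\Gamma_l}d\mu\,K_B'(\mu)(Y-\mu)^{-1}$.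 If $\Gamma_l\subset D_l$ is $K_B$-bounded with $\mathcal V_0(B,\Gamma_l)<\frac14d_0^2(\Gamma_l)$, then $X=V_1(A_1+X,\Gamma_l)$ has a unique bounded solution $X^{(l)}$ with $\|X^{(l)}\|\le r_{\min}(\Gamma_l):=\frac{d_0(\Gamma_l)}2-\sqrt{\frac{d_0^2(\Gamma_l)}4-\mathcal V_0(B,\Gamma_l)}$; for fixed $l$ it is the same for all such contours, and $\|X^{(l)}\|\le r_0(B):=\inf r_{\min}(\Gamma_l)$, the infimum over all such contours in $D_l$ (its value does not depend on $l$). $H_1^{(l)}=A_1+X^{(l)}$. Circles and projections. $\gamma_0$ is the circle centered at $(\lambda_1^{(A_1)}+\lambda_{i_0-1}^{(A_1)})/2$ with radius $(\lambda_{i_0-1}^{(A_1)}-\lambda_1^{(A_1)})/2+r$; for $i\ge i_0$, $\gamma_i$ is the circle centered at $\lambda_i^{(A_1)}$ with radius $r$. For $i=0,i_0,i_0+1,\dots$, $\mathsf Q_i^{(l)}=-\frac1{2\pi\mathrm i}\int_{\gamma_i}dz\,(H_1^{(l)}-z)^{-1}$ and $\mathsf P_i^{(A_1)}=-\frac1{2\pi\mathrm i}\int_{\gamma_i}dz\,(A_1-z)^{-1}$. Bases. A sequence of closed subspaces $\mathcal N_i$ is a basis (of subspaces) of $\mathcal H_1$ if every $x\in\mathcal H_1$ has a unique expansion into a norm-convergent series $x=\sum_ix_i$ with $x_i\in\mathcal N_i$. It is quadratically close to an orthogonal one if there is an orthogonal basis of subspaces $\{\mathcal M_i\}$ of $\mathcal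 H_1$ with $\sum_i\|P_{\mathcal N_i}-P_{\mathcal M_i}\|^2<\infty$, $P_{\mathcal L}$ being the orthogonal projection onto $\mathcal L$. A Bari basis is a (vector) basis $\{\psi_j\}$ for which there is an orthonormal basis $\{\varphi_j\}$ with $\sum_j\|\psi_j-\varphi_j\|^2<\infty$. *)

theory Defs
  imports "HOL-Complex_Analysis.Complex_Analysis"
begin

section \<open>Complex Hilbert spaces\<close>

text \<open>The complex inner product is conjugate-linear in the first argument. The real Hilbert
  space structure (norm, topology, bounded operators) is the one of the library.\<close>

class chilbert_space = real_inner + complete_space +
  fixes scaleC :: "complex \<Rightarrow> 'a \<Rightarrow> 'a" (infixr "*\<^sub>C" 75)
    and cinner :: "'a \<Rightarrow> 'a \<Rightarrow> complex"
  assumes scaleC_add_right: "c *\<^sub>C (x + y) = c *\<^sub>C x + c *\<^sub>C y"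
    and scaleC_add_left: "(c + d) *\<^sub>C x = c *\<^sub>C x + d *\<^sub>C x"
    and scaleC_scaleC: "c *\<^sub>C (d *\<^sub>C x) = (c * d) *\<^sub>C x"
    and scaleC_of_real: "complex_of_real r *\<^sub>C x = scaleR r x"
    and cinner_commute: "cinner x y = cnj (cinner y x)"
    and cinner_add_left: "cinner (x + y) z = cinner x z + cinner y z"
    and cinner_scaleC_left: "cinner (c *\<^sub>C x) y = cnj c * cinner x y"
    and inner_eq_Re_cinner: "inner x y = Re (cinner x y)"

subclass (in chilbert_space) banach ..

instantiation complex :: chilbert_space
begin

definition scaleC_complex :: "complex \<Rightarrow> complex \<Rightarrow> complex"
  where "scaleC_complex c x = c * x"

definition cinner_complex :: "complex \<Rightarrow> complex \<Rightarrow> complex"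
  where "cinner_complex x y = cnj x * y"

instance
  by standard
    (auto simp: scaleC_complex_def cinner_complex_def inner_complex_def algebra_simps scaleR_conv_of_real)

end

global_interpretation complex_vector: vector_space "scaleC :: complex \<Rightarrow> 'a \<Rightarrow> 'a::chilbert_space"
  defines csubspace = complex_vector.subspace
    and cspan = complex_vector.span
    and cdim = complex_vector.dim
proof unfold_locales
  show "1 *\<^sub>C x = x" for x :: 'a
    using scaleC_of_real[of 1 x] by simp
qed (simp_all add: scaleC_add_right scaleC_add_left scaleC_scaleC)

lemma norm_scaleC: "norm (c *\<^sub>C x) = cmod c * norm x" for x :: "'a::chilbert_space"
proof -
  have "cinner x (c *\<^sub>C x) = cnj (cnj c * cinner x x)"
    by (subst cinner_commute) (simp only: cinner_scaleC_left)
  also have "\<dots> = c * cinner x x"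
    using cinner_commute[of x x] by simp
  finally have "cinner (c *\<^sub>C x) (c *\<^sub>C x) = (cnj c * c) * cinner x x"
    by (simp add: cinner_scaleC_left)
  also have "cnj c * c = of_real ((cmod c)\<^sup>2)"
    by (metis complex_norm_square mult.commute)
  finally have "(norm (c *\<^sub>C x))\<^sup>2 = (cmod c)\<^sup>2 * (norm x)\<^sup>2"
    by (simp add: power2_norm_eq_inner inner_eq_Re_cinner)
  then show ?thesis
    by (metis norm_ge_zero power2_eq_iff_nonneg power_mult_distrib mult_nonneg_nonneg)
qed

lemma bounded_linear_scaleC: "bounded_linear (\<lambda>x::'a::chilbert_space. c *\<^sub>C x)"
proof (rule bounded_linear_intro[where K = "cmod c"])
  show "c *\<^sub>C (r *\<^sub>R x) = r *\<^sub>R (c *\<^sub>C x)" for r and x :: 'a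
    by (simp add: scaleC_of_real[symmetric] scaleC_scaleC mult.commute)
qed (simp_all add: scaleC_add_right norm_scaleC)


section \<open>Bounded operators\<close>

definition clinear_op :: "('a::chilbert_space \<Rightarrow>\<^sub>L 'b::chilbert_space) \<Rightarrow> bool"
  where "clinear_op T \<longleftrightarrow> (\<forall>c x. blinfun_apply T (c *\<^sub>C x) = c *\<^sub>C blinfun_apply T x)"

definition scaleC_op :: "complex \<Rightarrow> ('a::chilbert_space \<Rightarrow>\<^sub>L 'b::chilbert_space) \<Rightarrow> ('a \<Rightarrow>\<^sub>L 'b)"
  where "scaleC_op c T = Blinfun (\<lambda>x. c *\<^sub>C blinfun_apply T x)"

lemma scaleC_op_apply [simp]: "blinfun_apply (scaleC_op c T) x = c *\<^sub>C blinfun_apply T x"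
  unfolding scaleC_op_def
  by (simp add: bounded_linear_Blinfun_apply
      bounded_linear_compose[OF bounded_linear_scaleC blinfun.bounded_linear_right])

definition adjoint_pair :: "('a::chilbert_space \<Rightarrow>\<^sub>L 'b::chilbert_space) \<Rightarrow> ('b \<Rightarrow>\<^sub>L 'a) \<Rightarrow> bool"
  where "adjoint_pair T T' \<longleftrightarrow> (\<forall>x y. cinner (blinfun_apply T x) y = cinner x (blinfun_apply T' y))"

definition compact_op :: "('a::chilbert_space \<Rightarrow>\<^sub>L 'b::chilbert_space) \<Rightarrow> bool"
  where "compact_op T \<longleftrightarrow> compact (closure (blinfun_apply T ` cball 0 1))"

definition orth_projection :: "('a::chilbert_space \<Rightarrow>\<^sub>L 'a) \<Rightarrow> bool"
  where "orth_projection P \<longleftrightarrow> P o\<^sub>L P = P \<and> adjoint_pair P P"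

text \<open>The orthogonal projection onto a closed complex subspace.\<close>

definition proj :: "'a::chilbert_space set \<Rightarrow> ('a \<Rightarrow>\<^sub>L 'a)"
  where "proj L = (THE P. orth_projection P \<and> range (blinfun_apply P) = L)"

definition op_holomorphic_on ::
    "(complex \<Rightarrow> ('a::chilbert_space \<Rightarrow>\<^sub>L 'b::chilbert_space)) \<Rightarrow> complex set \<Rightarrow> bool"
  where "op_holomorphic_on f U \<longleftrightarrow>
    (\<forall>z\<in>U. \<exists>d. (f has_derivative (\<lambda>h. scaleC_op h d)) (at z within U))"

text \<open>The integrand of the line integral of \<open>f\<close> along the curve \<open>g\<close>, pulled back to the parameter.\<close>

definition line_integrand ::
    "(complex \<Rightarrow> ('a::chilbert_space \<Rightarrow>\<^sub>L 'b::chilbert_space)) \<Rightarrow> (real \<Rightarrow> complex) \<Rightarrow> real \<Rightarrow> ('a \<Rightarrow>\<^sub>L 'b)"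
  where "line_integrand f g = (\<lambda>t. scaleC_op (vector_derivative g (at t)) (f (g t)))"


section \<open>Unbounded operators and their spectra\<close>

text \<open>An operator is given by its graph.\<close>

type_synonym 'a graph = "('a \<times> 'a) set"

definition adjoint_graph :: "'a::chilbert_space graph \<Rightarrow> 'a graph"
  where "adjoint_graph A = {(y, z). \<forall>(x, u) \<in> A. cinner u y = cinner x z}"

text \<open>An adjoint graph is always a closed linear subspace, and it is single-valued when the domain
  is dense. Hence the two conditions below already make \<open>A\<close> the graph of a linear operator.\<close>

definition self_adjoint :: "'a::chilbert_space graph \<Rightarrow> bool"
  where "self_adjoint A \<longleftrightarrow> closure (Domain A) = UNIV \<and> adjoint_graph A = A"

definition graph_plus :: "'a::chilbert_space graph \<Rightarrow> ('a \<Rightarrow>\<^sub>L 'a) \<Rightarrow> 'a graph"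
  where "graph_plus A X = {(x, y + blinfun_apply X x) | x y. (x, y) \<in> A}"

text \<open>\<open>R\<close> is a bounded everywhere defined two-sided inverse of \<open>A - z\<close>.\<close>

definition is_resolvent :: "'a::chilbert_space graph \<Rightarrow> complex \<Rightarrow> ('a \<Rightarrow>\<^sub>L 'a) \<Rightarrow> bool"
  where "is_resolvent A z R \<longleftrightarrow>
    (\<forall>x. (blinfun_apply R x, x + z *\<^sub>C blinfun_apply R x) \<in> A) \<and>
    (\<forall>(x, y) \<in> A. blinfun_apply R (y - z *\<^sub>C x) = x)"

definition resolvent :: "'a::chilbert_space graph \<Rightarrow> complex \<Rightarrow> ('a \<Rightarrow>\<^sub>L 'a)"
  where "resolvent A z = (THE R. is_resolvent A z R)"

definition spectrum :: "'a::chilbert_space graph \<Rightarrow> complex set"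
  where "spectrum A = {z. \<nexists>R. is_resolvent A z R}"

definition real_spectrum :: "'a::chilbert_space graph \<Rightarrow> real set"
  where "real_spectrum A = {x. complex_of_real x \<in> spectrum A}"

definition eigenvalue :: "'a::chilbert_space graph \<Rightarrow> complex \<Rightarrow> bool"
  where "eigenvalue A z \<longleftrightarrow> (\<exists>x. x \<noteq> 0 \<and> (x, z *\<^sub>C x) \<in> A)"

definition continuous_spectrum :: "'a::chilbert_space graph \<Rightarrow> complex set"
  where "continuous_spectrum A =
    {z \<in> spectrum A. \<not> eigenvalue A z \<and> closure {y - z *\<^sub>C x | x y. (x, y) \<in> A} = UNIV}"

definition compact_resolvent :: "'a::chilbert_space graph \<Rightarrow> bool"
  where "compact_resolvent A \<longleftrightarrow> (\<exists>z. z \<notin> spectrum A \<and> compact_op (resolvent A z))"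

definition semibounded_below :: "'a::chilbert_space graph \<Rightarrow> bool"
  where "semibounded_below A \<longleftrightarrow> (\<exists>c. \<forall>(x, y) \<in> A. c * (norm x)\<^sup>2 \<le> Re (cinner x y))"

text \<open>The Riesz integral \<open>-1/(2\<pi>i) \<integral> (A - z)\<inverse> dz\<close> over the positively oriented circle.\<close>

definition riesz_op :: "'a::chilbert_space graph \<Rightarrow> complex \<Rightarrow> real \<Rightarrow> ('a \<Rightarrow>\<^sub>L 'a)"
  where "riesz_op A c \<rho> = scaleC_op (- 1 / (2 * complex_of_real pi * \<i>))
    (integral {0..1} (line_integrand (resolvent A) (circlepath c \<rho>)))"


section \<open>Spectral measures and operator Stieltjes integrals\<close>

definition projection_valued_measure :: "(real set \<Rightarrow> ('a::chilbert_space \<Rightarrow>\<^sub>L 'a)) \<Rightarrow> bool"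
  where "projection_valued_measure E \<longleftrightarrow>
    (\<forall>\<delta> \<in> sets borel. orth_projection (E \<delta>)) \<and>
    E UNIV = id_blinfun \<and>
    (\<forall>\<delta>::nat \<Rightarrow> real set. range \<delta> \<subseteq> sets borel \<longrightarrow> disjoint_family \<delta> \<longrightarrow>
      (\<forall>x. (\<lambda>n. blinfun_apply (E (\<delta> n)) x) sums blinfun_apply (E (\<Union>n. \<delta> n)) x))"

definition scalar_spectral_measure ::
    "(real set \<Rightarrow> ('a::chilbert_space \<Rightarrow>\<^sub>L 'a)) \<Rightarrow> 'a \<Rightarrow> real measure"
  where "scalar_spectral_measure E x =
    measure_of UNIV (sets borel) (\<lambda>\<delta>. ennreal ((norm (blinfun_apply (E \<delta>) x))\<^sup>2))"

text \<open>\<open>A = \<integral> t dE(t)\<close>: the domains agree, and so do the quadratic forms on the domain. By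
  polarization the latter determines the operator.\<close>

definition spectral_measure_of ::
    "(real set \<Rightarrow> ('a::chilbert_space \<Rightarrow>\<^sub>L 'a)) \<Rightarrow> 'a graph \<Rightarrow> bool"
  where "spectral_measure_of E A \<longleftrightarrow>
    projection_valued_measure E \<and>
    Domain A = {x. integrable (scalar_spectral_measure E x) (\<lambda>t. t\<^sup>2)} \<and>
    (\<forall>(x, y) \<in> A. cinner x y = complex_of_real (\<integral>t. t \<partial>scalar_spectral_measure E x))"

text \<open>Countable Borel partitions; the finite ones are those padded with empty sets.\<close>

definition borel_partition :: "(nat \<Rightarrow> real set) \<Rightarrow> real set \<Rightarrow> bool"
  where "borel_partition \<delta> S \<longleftrightarrow> range \<delta> \<subseteq> sets borel \<and> disjoint_family \<delta> \<and> (\<Union>n. \<delta> n) = S"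

text \<open>\<open>\<integral>\<^bsub>S\<^esub> M(d\<mu>) F(\<mu>) = I\<close> as the operator-norm limit of the sums \<open>\<Sum>\<^sub>n M(\<delta>\<^sub>n) F(\<tau>\<^sub>n)\<close>,
  where \<open>\<tau>\<^sub>n \<in> \<delta>\<^sub>n\<close> and the mesh of the partition \<open>\<delta>\<close> tends to zero.\<close>

definition has_stieltjes_integral ::
    "(real set \<Rightarrow> ('a::chilbert_space \<Rightarrow>\<^sub>L 'a)) \<Rightarrow> (real \<Rightarrow> ('a \<Rightarrow>\<^sub>L 'a)) \<Rightarrow> real set \<Rightarrow> ('a \<Rightarrow>\<^sub>L 'a) \<Rightarrow> bool"
  where "has_stieltjes_integral M F S I \<longleftrightarrow>
    (\<forall>\<epsilon>>0. \<exists>\<eta>>0. \<forall>\<delta> \<tau>.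
      borel_partition \<delta> S \<longrightarrow>
      (\<forall>n. \<forall>s\<in>\<delta> n. \<forall>t\<in>\<delta> n. \<bar>s - t\<bar> < \<eta>) \<longrightarrow>
      (\<forall>n. \<delta> n \<noteq> {} \<longrightarrow> \<tau> n \<in> \<delta> n) \<longrightarrow>
      summable (\<lambda>n. M (\<delta> n) o\<^sub>L F (\<tau> n)) \<and>
      norm ((\<Sum>n. M (\<delta> n) o\<^sub>L F (\<tau> n)) - I) < \<epsilon>)"


section \<open>The coupled operators and the intervals of continuous spectrum\<close>

text \<open>The intervals are indexed by \<open>k \<in> {1..nint}\<close>; \<open>lo k\<close>, \<open>hi k\<close> are the end points of the
  \<open>k\<close>-th one, \<open>domD k\<close> is the domain in the lower half-plane attached to it and \<open>dK k\<close> is the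
  derivative of \<open>K\<^sub>B\<close> on the closure of the interval together with its continuations. The
  continuations carry the index \<open>k\<close> because two intervals may share an end point.\<close>

record (overloaded) ('a, 'b) coupling =
  opA0 :: "'a::chilbert_space graph"
  opA1 :: "'b::chilbert_space graph"
  opB01 :: "'b::chilbert_space \<Rightarrow>\<^sub>L 'a::chilbert_space"
  opB10 :: "'a::chilbert_space \<Rightarrow>\<^sub>L 'b::chilbert_space"
  specE0 :: "real set \<Rightarrow> ('a::chilbert_space \<Rightarrow>\<^sub>L 'a)"
  nint :: nat
  lo :: "nat \<Rightarrow> ereal"
  hi :: "nat \<Rightarrow> ereal"
  domD :: "nat \<Rightarrow> complex set"
  dK :: "nat \<Rightarrow> complex \<Rightarrow> ('b::chilbert_space \<Rightarrow>\<^sub>L 'b)"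

definition Delta :: "('a::chilbert_space, 'b::chilbert_space) coupling \<Rightarrow> nat \<Rightarrow> real set"
  where "Delta S k = einterval (lo S k) (hi S k)"

definition coupled_measure ::
    "('a::chilbert_space, 'b::chilbert_space) coupling \<Rightarrow> real set \<Rightarrow> ('b \<Rightarrow>\<^sub>L 'b)"
  where "coupled_measure S \<delta> = opB10 S o\<^sub>L specE0 S \<delta> o\<^sub>L opB01 S"

definition K_B :: "('a::chilbert_space, 'b::chilbert_space) coupling \<Rightarrow> real \<Rightarrow> ('b \<Rightarrow>\<^sub>L 'b)"
  where "K_B S \<mu> = coupled_measure S {..<\<mu>}"

definition sigma' :: "('a::chilbert_space, 'b::chilbert_space) coupling \<Rightarrow> real set"
  where "sigma' S = real_spectrum (opA0 S) - (\<Union>k\<in>{1..nint S}. Delta S k)"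

definition operator_setting :: "('a::chilbert_space, 'b::chilbert_space) coupling \<Rightarrow> bool"
  where "operator_setting S \<longleftrightarrow>
    separable_space (euclidean :: 'a topology) \<and>
    separable_space (euclidean :: 'b topology) \<and>
    self_adjoint (opA0 S) \<and> self_adjoint (opA1 S) \<and>
    clinear_op (opB01 S) \<and> adjoint_pair (opB01 S) (opB10 S) \<and>
    spectral_measure_of (specE0 S) (opA0 S)"

definition spectral_assumptions :: "('a::chilbert_space, 'b::chilbert_space) coupling \<Rightarrow> bool"
  where "spectral_assumptions S \<longleftrightarrow>
    1 \<le> nint S \<and>
    (\<forall>k\<in>{1..nint S}. lo S k < hi S k) \<and>
    disjoint_family_on (Delta S) {1..nint S} \<and>
    (\<forall>k\<in>{1..nint S}. complex_of_real ` Delta S k \<subseteq> continuous_spectrum (opA0 S)) \<and>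
    (\<forall>k\<in>{1..nint S}. Delta S k \<inter> real_spectrum (opA1 S) \<noteq> {}) \<and>
    real_spectrum (opA1 S) \<inter> sigma' S = {}"

text \<open>\<open>K\<^sub>B'\<close> is continued from \<open>\<Delta>\<^sub>k\<close> into \<open>D\<^sub>k\<close> and into the reflected domain: it is holomorphic
  there, and continuous up to \<open>\<Delta>\<^sub>k\<close>.\<close>

definition analyticity_assumptions :: "('a::chilbert_space, 'b::chilbert_space) coupling \<Rightarrow> bool"
  where "analyticity_assumptions S \<longleftrightarrow>
    disjoint_family_on (domD S) {1..nint S} \<and>
    (\<forall>k\<in>{1..nint S}.
      (\<forall>\<mu>\<in>Delta S k. (K_B S has_vector_derivative dK S k (complex_of_real \<mu>)) (at \<mu>)) \<and>
      continuous_on (closure (Delta S k)) (\<lambda>\<mu>. dK S k (complex_of_real \<mu>)) \<and>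
      open (domD S k) \<and> connected (domD S k) \<and> simply_connected (domD S k) \<and>
      domD S k \<subseteq> {z. Im z < 0} \<and>
      complex_of_real ` Delta S k \<subseteq> frontier (domD S k) \<and>
      op_holomorphic_on (dK S k) (domD S k) \<and>
      op_holomorphic_on (dK S k) (cnj ` domD S k) \<and>
      continuous_on (domD S k \<union> complex_of_real ` Delta S k \<union> cnj ` domD S k) (dK S k) \<and>
      (\<forall>e::real. ereal e \<in> {lo S k, hi S k} \<longrightarrow>
        (\<exists>C>0. \<exists>\<gamma>>0. \<forall>z \<in> domD S k \<union> cnj ` domD S k.
          norm (dK S k z - dK S k (complex_of_real e)) \<le> C * cmod (z - complex_of_real e) powr \<gamma>)))"

definition sign_choice :: "('a::chilbert_space, 'b::chilbert_space) coupling \<Rightarrow> (nat \<Rightarrow> int) \<Rightarrow> bool"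
  where "sign_choice S l \<longleftrightarrow> (\<forall>k\<in>{1..nint S}. l k = 1 \<or> l k = -1)"

definition signed_domain ::
    "('a::chilbert_space, 'b::chilbert_space) coupling \<Rightarrow> (nat \<Rightarrow> int) \<Rightarrow> nat \<Rightarrow> complex set"
  where "signed_domain S l k = (if l k = -1 then domD S k else cnj ` domD S k)"


section \<open>Contours\<close>

text \<open>The \<open>k\<close>-th component \<open>\<Gamma>\<^sub>k\<close> of a contour is \<open>g k ` Delta S k\<close>, for a parametrization \<open>g k\<close> by the
  closure of \<open>\<Delta>\<^sub>k\<close> in \<open>\<real>\<close>, which sends finite end points to themselves.

  A Jordan arc is rectifiable iff it has a Lipschitz parametrization (the constant speed one), and
  by arc length an unbounded arc with rectifiable bounded pieces has one that is Lipschitz on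
  compact intervals; then \<open>d\<mu> = g'(t) dt\<close> with \<open>g'\<close> existing almost everywhere. The deformation is
  a homotopy within \<open>D\<^sub>k \<union> \<Delta>\<^sub>k\<close> that keeps the end points fixed, including those at infinity.\<close>

definition rectifiable_jordan :: "real set \<Rightarrow> (real \<Rightarrow> complex) \<Rightarrow> bool"
  where "rectifiable_jordan J g \<longleftrightarrow>
    inj_on g J \<and> (\<forall>c d. {c..d} \<subseteq> J \<longrightarrow> (\<exists>L. L-lipschitz_on {c..d} g))"

definition deformation_of :: "ereal \<Rightarrow> ereal \<Rightarrow> complex set \<Rightarrow> (real \<Rightarrow> complex) \<Rightarrow> bool"
  where "deformation_of a b D g \<longleftrightarrow>
    (\<exists>h :: real \<times> real \<Rightarrow> complex.
      continuous_on ({0..1} \<times> closure (einterval a b)) h \<and>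
      (\<forall>t\<in>closure (einterval a b). h (0, t) = complex_of_real t \<and> h (1, t) = g t) \<and>
      (\<forall>s\<in>{0..1}. \<forall>t\<in>einterval a b. h (s, t) \<in> D \<union> complex_of_real ` einterval a b) \<and>
      (\<forall>s\<in>{0..1}. \<forall>e::real. ereal e \<in> {a, b} \<longrightarrow> h (s, e) = complex_of_real e) \<and>
      (a = -\<infinity> \<longrightarrow> filterlim h at_infinity (principal {0..1} \<times>\<^sub>F at_bot)) \<and>
      (b = \<infinity> \<longrightarrow> filterlim h at_infinity (principal {0..1} \<times>\<^sub>F at_top)))"

definition contour ::
    "('a::chilbert_space, 'b::chilbert_space) coupling \<Rightarrow> (nat \<Rightarrow> int) \<Rightarrow> (nat \<Rightarrow> real \<Rightarrow> complex) \<Rightarrow> bool"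
  where "contour S l g \<longleftrightarrow>
    (\<forall>k\<in>{1..nint S}.
      rectifiable_jordan (closure (Delta S k)) (g k) \<and>
      g k ` Delta S k \<subseteq> signed_domain S l k \<and>
      deformation_of (lo S k) (hi S k) (signed_domain S l k) (g k) \<and>
      closure (g k ` Delta S k) \<inter> continuous_spectrum (opA0 S)
        \<subseteq> {complex_of_real e | e. ereal e \<in> {lo S k, hi S k}})"

definition contour_set ::
    "('a::chilbert_space, 'b::chilbert_space) coupling \<Rightarrow> (nat \<Rightarrow> real \<Rightarrow> complex) \<Rightarrow> complex set"
  where "contour_set S g = (\<Union>k\<in>{1..nint S}. g k ` Delta S k)"

definition V0 ::
    "('a::chilbert_space, 'b::chilbert_space) coupling \<Rightarrow> (nat \<Rightarrow> real \<Rightarrow> complex) \<Rightarrow> ennreal"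
  where "V0 S g =
    (SUP \<delta> \<in> {\<delta>. borel_partition \<delta> (real_spectrum (opA0 S))}.
      \<Sum>n. ennreal (norm (coupled_measure S (\<delta> n \<inter> sigma' S)))) +
    (\<Sum>k\<in>{1..nint S}. \<integral>\<^sup>+t\<in>Delta S k.
      ennreal (norm (dK S k (g k t)) * cmod (vector_derivative (g k) (at t))) \<partial>lebesgue)"

definition K_bounded ::
    "('a::chilbert_space, 'b::chilbert_space) coupling \<Rightarrow> (nat \<Rightarrow> real \<Rightarrow> complex) \<Rightarrow> bool"
  where "K_bounded S g \<longleftrightarrow> V0 S g < \<infinity>"

definition d0 ::
    "('a::chilbert_space, 'b::chilbert_space) coupling \<Rightarrow> (nat \<Rightarrow> real \<Rightarrow> complex) \<Rightarrow> real"
  where "d0 S g = setdist (spectrum (opA1 S)) (complex_of_real ` sigma' S \<union> contour_set S g)"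

definition admissible ::
    "('a::chilbert_space, 'b::chilbert_space) coupling \<Rightarrow> (nat \<Rightarrow> int) \<Rightarrow> (nat \<Rightarrow> real \<Rightarrow> complex) \<Rightarrow> bool"
  where "admissible S l g \<longleftrightarrow>
    contour S l g \<and> K_bounded S g \<and> V0 S g < ennreal ((d0 S g)\<^sup>2 / 4)"

definition r_min ::
    "('a::chilbert_space, 'b::chilbert_space) coupling \<Rightarrow> (nat \<Rightarrow> real \<Rightarrow> complex) \<Rightarrow> real"
  where "r_min S g = d0 S g / 2 - sqrt ((d0 S g)\<^sup>2 / 4 - enn2real (V0 S g))"

definition r0 :: "('a::chilbert_space, 'b::chilbert_space) coupling \<Rightarrow> (nat \<Rightarrow> int) \<Rightarrow> real"
  where "r0 S l = Inf {r_min S g | g. admissible S l g}"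


section \<open>The basic equation\<close>

text \<open>\<open>V\<^sub>1(Y, \<Gamma>) = V\<close>, including the convergence of the integrals.\<close>

definition has_V1 ::
    "('a::chilbert_space, 'b::chilbert_space) coupling \<Rightarrow> (nat \<Rightarrow> real \<Rightarrow> complex) \<Rightarrow> 'b graph \<Rightarrow>
      ('b \<Rightarrow>\<^sub>L 'b) \<Rightarrow> bool"
  where "has_V1 S g Y V \<longleftrightarrow>
    (\<exists>I J. has_stieltjes_integral (coupled_measure S) (\<lambda>\<mu>. resolvent Y (complex_of_real \<mu>)) (sigma' S) I \<and>
      (\<forall>k\<in>{1..nint S}.
        (line_integrand (\<lambda>\<mu>. dK S k \<mu> o\<^sub>L resolvent Y \<mu>) (g k) has_integral J k) (Delta S k)) \<and>
      V = I + (\<Sum>k\<in>{1..nint S}. J k))"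

text \<open>\<open>X = X\<^sup>(\<^sup>l\<^sup>)\<close>: for each admissible contour in \<open>D\<^sub>l\<close>, \<open>X\<close> is the solution of \<open>X = V\<^sub>1(A\<^sub>1 + X, \<Gamma>)\<close> of
  norm at most \<open>r_min\<close>. For fixed \<open>l\<close> this solution is the same for all these contours.\<close>

definition is_solution ::
    "('a::chilbert_space, 'b::chilbert_space) coupling \<Rightarrow> (nat \<Rightarrow> int) \<Rightarrow> ('b \<Rightarrow>\<^sub>L 'b) \<Rightarrow> bool"
  where "is_solution S l X \<longleftrightarrow>
    clinear_op X \<and>
    (\<forall>g. admissible S l g \<longrightarrow> has_V1 S g (graph_plus (opA1 S) X) X \<and> norm X \<le> r_min S g)"


section \<open>Circles around the eigenvalues\<close>

definition circle_center :: "(nat \<Rightarrow> real) \<Rightarrow> nat \<Rightarrow> nat \<Rightarrow> real"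
  where "circle_center lam i0 i = (if i = 0 then (lam 1 + lam (i0 - 1)) / 2 else lam i)"

definition circle_radius :: "(nat \<Rightarrow> real) \<Rightarrow> nat \<Rightarrow> real \<Rightarrow> nat \<Rightarrow> real"
  where "circle_radius lam i0 r i = (if i = 0 then (lam (i0 - 1) - lam 1) / 2 + r else r)"

definition circle_projection ::
    "'a::chilbert_space graph \<Rightarrow> (nat \<Rightarrow> real) \<Rightarrow> nat \<Rightarrow> real \<Rightarrow> nat \<Rightarrow> ('a \<Rightarrow>\<^sub>L 'a)"
  where "circle_projection H lam i0 r i =
    riesz_op H (complex_of_real (circle_center lam i0 i)) (circle_radius lam i0 r i)"

text \<open>The enumeration \<open>0, i0, i0 + 1, \<dots>\<close> of the indices.\<close>

definition block_index :: "nat \<Rightarrow> nat \<Rightarrow> nat"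
  where "block_index i0 j = (if j = 0 then 0 else i0 + (j - 1))"


section \<open>Bases\<close>

definition subspace_basis :: "(nat \<Rightarrow> 'a::chilbert_space set) \<Rightarrow> bool"
  where "subspace_basis N \<longleftrightarrow>
    (\<forall>i. csubspace (N i) \<and> closed (N i)) \<and>
    (\<forall>x. \<exists>!u. (\<forall>i. u i \<in> N i) \<and> u sums x)"

definition orthogonal_subspaces :: "(nat \<Rightarrow> 'a::chilbert_space set) \<Rightarrow> bool"
  where "orthogonal_subspaces M \<longleftrightarrow> (\<forall>i j. i \<noteq> j \<longrightarrow> (\<forall>x\<in>M i. \<forall>y\<in>M j. cinner x y = 0))"

definition quadratically_close_to_orthogonal :: "(nat \<Rightarrow> 'a::chilbert_space set) \<Rightarrow> bool"
  where "quadratically_close_to_orthogonal N \<longleftrightarrow>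
    (\<exists>M. subspace_basis M \<and> orthogonal_subspaces M \<and>
      summable (\<lambda>i. (norm (proj (N i) - proj (M i)))\<^sup>2))"

definition vector_basis :: "(nat \<Rightarrow> 'a::chilbert_space) \<Rightarrow> bool"
  where "vector_basis \<psi> \<longleftrightarrow> (\<forall>x. \<exists>!c. (\<lambda>j. c j *\<^sub>C \<psi> j) sums x)"

definition orthonormal_basis :: "(nat \<Rightarrow> 'a::chilbert_space) \<Rightarrow> bool"
  where "orthonormal_basis \<phi> \<longleftrightarrow>
    vector_basis \<phi> \<and> (\<forall>i j. cinner (\<phi> i) (\<phi> j) = (if i = j then 1 else 0))"

definition bari_basis :: "(nat \<Rightarrow> 'a::chilbert_space) \<Rightarrow> bool"
  where "bari_basis \<psi> \<longleftrightarrow>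
    vector_basis \<psi> \<and> (\<exists>\<phi>. orthonormal_basis \<phi> \<and> summable (\<lambda>j. (norm (\<psi> j - \<phi> j))\<^sup>2))"

text \<open>A union of bases comes without an order: it is a Bari basis if it is countably infinite and
  each of its enumerations is one.\<close>

definition bari_basis_set :: "'a::chilbert_space set \<Rightarrow> bool"
  where "bari_basis_set U \<longleftrightarrow>
    (\<exists>\<psi>::nat \<Rightarrow> 'a. bij_betw \<psi> UNIV U) \<and>
    (\<forall>\<psi>::nat \<Rightarrow> 'a. bij_betw \<psi> UNIV U \<longrightarrow> bari_basis \<psi>)"

definition orthonormal_basis_of :: "'a::chilbert_space set \<Rightarrow> 'a set \<Rightarrow> bool"
  where "orthonormal_basis_of B N \<longleftrightarrow>
    B \<subseteq> N \<and> (\<forall>x\<in>B. \<forall>y\<in>B. cinner x y = (if x = y then 1 else 0)) \<and> closure (cspan B) = N"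

text \<open>The library dimension of an infinite-dimensional space is 0, whence the first conjunct.\<close>

definition cdim_le :: "'a::chilbert_space set \<Rightarrow> nat \<Rightarrow> bool"
  where "cdim_le V n \<longleftrightarrow> (\<exists>F. finite F \<and> V \<subseteq> cspan F) \<and> cdim V \<le> n"

end

(* The solution X is a bounded perturbation with norm X <= r0 < r / 2. If s n is half of the gap
   between the eigenvalues n and n + 1 of A1, let Qbig n and Pbig n be the Riesz projections of
   H = A1 + X and A1 for the circle through the middle of this gap that encloses the first n
   eigenvalues. Integrating norm ((H - z)^-1 X (A1 - z)^-1) over this circle gives
   norm (Qbig n - Pbig n) <= 3 pi (norm X) / s n, although the circle is long. By Cauchy's theorem
   Qbig n is the sum of the projections Q_i inside the circle. Hence the sums of the Q_i converge
   strongly to the identity, since the Pbig n do, and the Q_i - P_i, as differences of consecutive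
   Qbig n - Pbig n, are square summable in norm. This yields the basis of subspaces.

   For the vectors, biorthogonal functionals give uniqueness and square summable coefficients. The
   orthonormal basis close to them is obtained in almost all blocks by applying the Gram-Schmidt
   process to the vectors P_i b; in the remaining ones, which are compared by means of one big
   projection, only the dimension matters. *)

theory Submission
  imports Defs
begin

text \<open>Two obstacles shape the estimates. On a circle of radius \<open>r\<close> around one
  eigenvalue the resolvents are only known to be of order \<open>1 / r\<close>, so nothing becomes
  small there, whereas the circle through the middle of a gap keeps the distance \<open>s n\<close>
  from the eigenvalues. That circle is long, but the distance \<open>d z\<close> to the eigenvalues
  also dominates the imaginary part \<open>y\<close> of \<open>z\<close>, and the difference of the
  resolvents, a product with two resolvent factors, is of order \<open>1 / (d z)^2\<close>. Its
  integral is therefore comparable to that of \<open>1 / ((s n)^2 + y^2)\<close> over the whole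
  line, which is \<open>pi / s n\<close>, whatever the length of the circle. The spectral theorem is
  not invoked. The resolvent bound \<open>1 / d z\<close> is derived from compactness, and the
  strong convergence of \<open>Pbig n\<close> from the same circle estimate, in which the Cauchy
  kernel \<open>1 / (z - w)\<close> takes the place of one resolvent. The algebra of the Riesz
  projections is reduced to Cauchy's theorem for the scalar functions
  \<open>cinner y (R z x)\<close>.\<close>

subsection \<open>Hilbert space geometry\<close>

lemma cinner_scaleC_right [simp]: "cinner x (c *\<^sub>C y) = c * cinner x y"
  by (metis cinner_commute cinner_scaleC_left complex_cnj_cnj complex_cnj_mult)

declare cinner_scaleC_left [simp]

lemma cmod_cinner_le: "cmod (cinner x y) \<le> norm x * norm y"
proof (cases "cinner x y = 0")
  case False
  \<comment> \<open>The unimodular factor \<open>c\<close> turns the inner product into its modulus,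
    so that the real Cauchy-Schwarz inequality applies.\<close>
  define c where "c = cnj (cinner x y) / cmod (cinner x y)"
  have "c * cinner x y = of_real (cmod (cinner x y))"
    using False complex_norm_square[of "cinner x y"]
    by (simp add: c_def field_simps power2_eq_square)
  then have "inner x (c *\<^sub>C y) = cmod (cinner x y)"
    by (simp add: inner_eq_Re_cinner)
  moreover have "cmod c = 1" using False by (simp add: c_def norm_divide)
  ultimately show ?thesis
    using norm_cauchy_schwarz[of x "c *\<^sub>C y"] by (simp add: norm_scaleC)
qed simp

interpretation cinner: bounded_bilinear "cinner :: 'a::chilbert_space \<Rightarrow> 'a \<Rightarrow> complex"
proof
  show "cinner (x + y) z = cinner x z + cinner y z" for x y z :: 'a by (rule cinner_add_left)
  show "cinner x (y + z) = cinner x y + cinner x z" for x y z :: 'a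
    by (metis cinner_add_left cinner_commute complex_cnj_add)
  show "cinner (r *\<^sub>R x) y = r *\<^sub>R cinner x y" for r and x y :: 'a
    using cinner_scaleC_left[of "of_real r" x y] by (simp add: scaleC_of_real scaleR_conv_of_real)
  show "cinner x (r *\<^sub>R y) = r *\<^sub>R cinner x y" for r and x y :: 'a
    using cinner_scaleC_right[of x "of_real r" y] by (simp add: scaleC_of_real scaleR_conv_of_real)
  show "\<exists>K. \<forall>x y::'a. norm (cinner x y) \<le> norm x * norm y * K"
    by (rule exI[of _ 1]) (simp add: cmod_cinner_le)
qed

declare cinner.zero_left [simp] cinner.zero_right [simp]

lemma cinner_self: "cinner x x = of_real ((norm x)\<^sup>2)"
proof -
  have "Im (cinner x x) = 0" using cinner_commute[of x x] by (simp add: complex_eq_iff)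
  then show ?thesis by (simp add: complex_eq_iff power2_norm_eq_inner inner_eq_Re_cinner)
qed

lemma norm_sq_cinner: "(norm x)\<^sup>2 = cmod (cinner x x)"
  by (simp add: cinner_self norm_power)

text \<open>The hypothesis says that \<open>x - y\<close> is orthogonal to \<open>y\<close>. It
  yields the contraction bounds for projections, partial sums and finite Fourier sums.\<close>

lemma norm_le_if_cinner_eq:
  assumes "cinner y y = cinner y x"
  shows "norm y \<le> norm x"
proof -
  have "norm y * norm y \<le> norm x * norm y"
    using cmod_cinner_le[of y x] norm_sq_cinner[of y] assms by (simp add: power2_eq_square mult.commute)
  then show ?thesis by (cases "y = 0") simp_all
qed

lemma cinner_eqI:
  assumes "\<And>y. cinner y x = cinner y x'"
  shows "x = x'"
proof -
  have "cinner (x - x') (x - x') = 0" by (simp add: cinner.diff_right assms)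
  then show ?thesis by (simp add: cinner_self)
qed

lemma cinner_sym_zero: "cinner x y = 0 \<longleftrightarrow> cinner y x = 0"
  by (metis cinner_commute complex_cnj_zero_iff)

declare norm_scaleC [simp]

lemma scaleC_minus1 [simp]: "(- 1) *\<^sub>C x = - x"
  using scaleC_of_real[of "-1" x] by simp

interpretation scaleC: bounded_bilinear "scaleC :: complex \<Rightarrow> 'a::chilbert_space \<Rightarrow> 'a"
proof
  show "(r *\<^sub>R c) *\<^sub>C x = r *\<^sub>R c *\<^sub>C x" for r c and x :: 'a
    using scaleC_scaleC[of "of_real r" c x] unfolding scaleC_of_real scaleR_conv_of_real by simp
  show "c *\<^sub>C (r *\<^sub>R x) = r *\<^sub>R c *\<^sub>C x" for r c and x :: 'a
    using scaleC_scaleC[of "of_real r" c x] scaleC_scaleC[of c "of_real r" x]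
    unfolding scaleC_of_real by (simp only: mult.commute)
  show "\<exists>K. \<forall>c (x::'a). norm (c *\<^sub>C x) \<le> norm c * norm x * K"
    by (rule exI[of _ 1]) simp
qed (simp_all add: scaleC_add_left scaleC_add_right)

lemma norm_scaleC_op: "norm (scaleC_op c T) = cmod c * norm T"
proof (rule antisym)
  have le: "norm (scaleC_op c T) \<le> cmod c * norm T" for c and T :: "'a \<Rightarrow>\<^sub>L 'b::chilbert_space"
    by (rule norm_blinfun_bound)
      (auto simp: mult.assoc intro!: mult_left_mono norm_blinfun)
  show "norm (scaleC_op c T) \<le> cmod c * norm T" by (rule le)
  show "cmod c * norm T \<le> norm (scaleC_op c T)"
  proof (cases "c = 0")
    case False
    have "T = scaleC_op (inverse c) (scaleC_op c T)"
      using False by (intro blinfun_eqI) (simp add: scaleC_scaleC)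
    then have "norm T \<le> cmod (inverse c) * norm (scaleC_op c T)" by (metis le)
    then show ?thesis using False by (simp add: norm_divide field_simps)
  qed simp
qed

interpretation scaleC_op: bounded_bilinear
  "scaleC_op :: complex \<Rightarrow> ('a::chilbert_space \<Rightarrow>\<^sub>L 'b::chilbert_space) \<Rightarrow> _"
proof
  show "\<exists>K. \<forall>c (T::'a \<Rightarrow>\<^sub>L 'b). norm (scaleC_op c T) \<le> norm c * norm T * K"
    by (rule exI[of _ 1]) (simp add: norm_scaleC_op)
qed (auto intro!: blinfun_eqI
      simp: blinfun.add_left blinfun.scaleR_left scaleC.add_left scaleC.add_right
        scaleC.scaleR_left scaleC.scaleR_right)

section \<open>The projection theorem and orthogonal projections\<close>

lemma parallelogram: "(norm (x + y))\<^sup>2 + (norm (x - y))\<^sup>2 = 2 * (norm x)\<^sup>2 + 2 * (norm y)\<^sup>2"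
  for x y :: "'a::real_inner"
  by (simp add: power2_norm_eq_inner inner_add_left inner_add_right inner_diff_left inner_diff_right)

lemma csubspace_scaleR: "csubspace L \<Longrightarrow> x \<in> L \<Longrightarrow> r *\<^sub>R x \<in> L"
  by (metis complex_vector.subspace_scale scaleC_of_real)

text \<open>A minimizing sequence is Cauchy by the parallelogram law, because the midpoint of two of
  its members lies in \<open>L\<close> again.\<close>

lemma closest_point_exists:
  fixes L :: "'a::chilbert_space set"
  assumes L: "csubspace L" "closed L"
  obtains p where "p \<in> L" "\<And>y. y \<in> L \<Longrightarrow> norm (x - p) \<le> norm (x - y)"
proof -
  define d where "d = Inf ((\<lambda>y. norm (x - y)) ` L)"
  have ne: "(\<lambda>y. norm (x - y)) ` L \<noteq> {}" using complex_vector.subspace_0[OF L(1)] by auto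
  have bdd: "bdd_below ((\<lambda>y. norm (x - y)) ` L)" by (rule bdd_belowI[of _ 0]) auto
  have dle: "d \<le> norm (x - y)" if "y \<in> L" for y
    unfolding d_def using that by (intro cInf_lower bdd) auto
  have d0: "d \<ge> 0" unfolding d_def using ne by (intro cInf_greatest) auto
  have "\<exists>y\<in>L. norm (x - y) < d + 1 / real (Suc n)" for n
  proof -
    have "d < d + 1 / real (Suc n)" by simp
    then show ?thesis using cInf_lessD[OF ne] unfolding d_def by (metis (no_types, lifting) imageE)
  qed
  then obtain u where u: "\<And>n. u n \<in> L" "\<And>n. norm (x - u n) < d + 1 / real (Suc n)" by metis
  have diff: "(norm (u m - u n))\<^sup>2 \<le> 4 * ((d + e)\<^sup>2 - d\<^sup>2)"
    if "1 / real (Suc m) \<le> e" "1 / real (Suc n) \<le> e" for m n e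
  proof -
    have "d \<le> norm (x - (1/2) *\<^sub>R (u m + u n))"
      by (intro dle csubspace_scaleR[OF L(1)] complex_vector.subspace_add[OF L(1)] u)
    also have "x - (1/2) *\<^sub>R (u m + u n) = (1/2) *\<^sub>R ((x - u m) + (x - u n))"
      by (simp add: algebra_simps flip: scaleR_2)
    finally have "(2 * d)\<^sup>2 \<le> (norm ((x - u m) + (x - u n)))\<^sup>2"
      using d0 by (intro power_mono) auto
    moreover have "(norm (x - u m))\<^sup>2 \<le> (d + e)\<^sup>2" "(norm (x - u n))\<^sup>2 \<le> (d + e)\<^sup>2"
      using u(2)[of m] u(2)[of n] that by (auto intro!: power_mono)
    ultimately show ?thesis
      using parallelogram[of "x - u m" "x - u n"] by (simp add: power_mult_distrib norm_minus_commute)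
  qed
  have "Cauchy u"
  proof (rule metric_CauchyI)
    fix \<epsilon> :: real assume "\<epsilon> > 0"
    have "((\<lambda>e. 4 * ((d + e)\<^sup>2 - d\<^sup>2)) \<longlongrightarrow> 4 * ((d + 0)\<^sup>2 - d\<^sup>2)) (at_right 0)"
      by (intro tendsto_intros)
    then have "eventually (\<lambda>e. 4 * ((d + e)\<^sup>2 - d\<^sup>2) < \<epsilon>\<^sup>2) (at_right 0)"
      using \<open>\<epsilon> > 0\<close> by (intro order_tendstoD) auto
    then obtain e where e: "e > 0" "4 * ((d + e)\<^sup>2 - d\<^sup>2) < \<epsilon>\<^sup>2"
      unfolding eventually_at_right_field using dense by blast
    obtain M where M: "1 / real (Suc M) < e" using e(1) by (rule nat_approx_posE)
    have *: "1 / real (Suc m) \<le> e" if "m \<ge> M" for m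
    proof -
      have "1 / real (Suc m) \<le> 1 / real (Suc M)" using that by (intro divide_left_mono) auto
      then show ?thesis using M by linarith
    qed
    have "dist (u m) (u n) < \<epsilon>" if "m \<ge> M" "n \<ge> M" for m n
    proof -
      have "(norm (u m - u n))\<^sup>2 < \<epsilon>\<^sup>2" using diff[OF * *, OF that] e(2) by linarith
      then show ?thesis unfolding dist_norm by (rule power2_less_imp_less) (use \<open>\<epsilon> > 0\<close> in simp)
    qed
    then show "\<exists>M. \<forall>m\<ge>M. \<forall>n\<ge>M. dist (u m) (u n) < \<epsilon>" by blast
  qed
  then obtain p where p: "u \<longlonglongrightarrow> p" by (meson Cauchy_convergent convergent_def)
  have "p \<in> L" using closed_sequentially[OF L(2)] u(1) p by blast
  moreover have "norm (x - p) \<le> norm (x - y)" if "y \<in> L" for y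
  proof -
    have "(\<lambda>n. norm (x - u n)) \<longlonglongrightarrow> norm (x - p)" by (intro tendsto_intros p)
    moreover have "(\<lambda>n. d + 1 / real (Suc n)) \<longlonglongrightarrow> d + 0"
      using LIMSEQ_inverse_real_of_nat by (intro tendsto_intros) (simp add: inverse_eq_divide)
    ultimately have "norm (x - p) \<le> d + 0"
      using u(2) by (intro LIMSEQ_le) (auto intro!: exI[of _ 0] less_imp_le)
    then show ?thesis using dle[OF that] by simp
  qed
  ultimately show thesis using that by blast
qed

text \<open>If some \<open>y\<close> in \<open>L\<close> were not orthogonal to
  \<open>x - p\<close>, adding to \<open>p\<close> the component of \<open>x - p\<close> along
  \<open>y\<close> would give a closer point.\<close>

lemma orthogonal_decomposition:
  fixes L :: "'a::chilbert_space set"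
  assumes L: "csubspace L" "closed L"
  obtains p where "p \<in> L" "\<And>y. y \<in> L \<Longrightarrow> cinner y (x - p) = 0"
proof -
  obtain p where p: "p \<in> L" "\<And>y. y \<in> L \<Longrightarrow> norm (x - p) \<le> norm (x - y)"
    using closest_point_exists[OF L] by metis
  have "cinner y (x - p) = 0" if y: "y \<in> L" for y
  proof (cases "y = 0")
    case False
    define c where "c = cinner y (x - p) / of_real ((norm y)\<^sup>2)"
    define w where "w = x - p - c *\<^sub>C y"
    have "cinner y w = 0"
      using False by (simp add: w_def c_def cinner.diff_right cinner_self)
    then have o: "cinner w (c *\<^sub>C y) = 0" using cinner_sym_zero[of w y] by simp
    have "norm (x - p) \<le> norm (x - (p + c *\<^sub>C y))"
      by (intro p complex_vector.subspace_add[OF L(1)] complex_vector.subspace_scale[OF L(1)] y)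
    then have "norm (w + c *\<^sub>C y) \<le> norm w" by (simp add: w_def algebra_simps)
    then have le: "(norm (w + c *\<^sub>C y))\<^sup>2 \<le> (norm w)\<^sup>2" by (intro power_mono) auto
    have "inner w (c *\<^sub>C y) = 0" using o by (simp only: inner_eq_Re_cinner zero_complex.sel)
    then have s: "(norm (w + c *\<^sub>C y))\<^sup>2 = (norm w)\<^sup>2 + (norm (c *\<^sub>C y))\<^sup>2"
      by (simp only: power2_norm_eq_inner inner_add_left inner_add_right inner_commute[of "c *\<^sub>C y" w])
    from le s have "norm (c *\<^sub>C y) = 0" by simp
    then show ?thesis using False by (simp add: c_def)
  qed simp
  with p(1) show thesis using that by blast
qed

text \<open>Applied below to the range of \<open>A - z\<close>, where it turns a trivial orthogonal
  complement into surjectivity.\<close>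

lemma closed_subspace_eq_UNIV:
  fixes L :: "'a::chilbert_space set"
  assumes "csubspace L" "closed L" "\<And>y. (\<And>x. x \<in> L \<Longrightarrow> cinner x y = 0) \<Longrightarrow> y = 0"
  shows "L = UNIV"
proof -
  have "x \<in> L" for x
  proof -
    obtain p where p: "p \<in> L" "\<And>y. y \<in> L \<Longrightarrow> cinner y (x - p) = 0"
      using orthogonal_decomposition[OF assms(1,2)] by metis
    then have "x - p = 0" using assms(3)[of "x - p"] by blast
    then show ?thesis using p(1) by simp
  qed
  then show ?thesis by blast
qed

lemma orth_projection_idem: "orth_projection P \<Longrightarrow> P (P x) = P x"
  unfolding orth_projection_def by (metis blinfun_apply_blinfun_compose)

lemma orth_projection_cinner: "orth_projection P \<Longrightarrow> cinner (P x) y = cinner x (P y)"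
  unfolding orth_projection_def adjoint_pair_def by blast

lemma orth_projection_norm_le:
  assumes "orth_projection P"
  shows "norm (P x) \<le> norm x"
  by (rule norm_le_if_cinner_eq) (simp add: orth_projection_cinner[OF assms] orth_projection_idem[OF assms])

lemma orth_projection_unique:
  fixes P P' :: "'a::chilbert_space \<Rightarrow>\<^sub>L 'a"
  assumes P: "orth_projection P" and P': "orth_projection P'" and r: "range P = range P'"
  shows "P = P'"
proof (rule blinfun_eqI, rule cinner_eqI)
  fix x y
  have 1: "P (P' z) = P' z" for z using r orth_projection_idem[OF P] by (metis rangeE rangeI)
  have 2: "P' (P z) = P z" for z using r orth_projection_idem[OF P'] by (metis rangeE rangeI)
  have "cinner y (P x) = cinner y (P' (P x))" by (simp add: 2)
  also have "\<dots> = cinner (P (P' y)) x"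
    by (metis orth_projection_cinner[OF P] orth_projection_cinner[OF P'])
  also have "\<dots> = cinner y (P' x)"
    by (metis 1 orth_projection_cinner[OF P'])
  finally show "cinner y (P x) = cinner y (P' x)" .
qed

lemma clinear_opD: "clinear_op T \<Longrightarrow> T (c *\<^sub>C x) = c *\<^sub>C T x"
  unfolding clinear_op_def by blast

lemma orth_projection_exists:
  fixes L :: "'a::chilbert_space set"
  assumes L: "csubspace L" "closed L"
  obtains P :: "'a \<Rightarrow>\<^sub>L 'a" where "orth_projection P" "range P = L"
proof -
  have "\<forall>x. \<exists>p. p \<in> L \<and> (\<forall>y\<in>L. cinner y (x - p) = 0)"
    using orthogonal_decomposition[OF L] by metis
  then obtain f where f: "\<And>x. f x \<in> L" "\<And>x y. y \<in> L \<Longrightarrow> cinner y (x - f x) = 0" by metis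
  have uniq: "p = f x" if "p \<in> L" "\<And>y. y \<in> L \<Longrightarrow> cinner y (x - p) = 0" for x p
  proof -
    have "p - f x \<in> L" using that f L by (simp add: complex_vector.subspace_diff)
    then have "cinner (p - f x) ((x - f x) - (x - p)) = 0"
      using that(2) f(2) by (subst cinner.diff_right) simp
    then show ?thesis by (simp add: cinner_self)
  qed
  have add: "f (x + y) = f x + f y" for x y
  proof (rule uniq[symmetric])
    show "f x + f y \<in> L" by (intro complex_vector.subspace_add[OF L(1)] f)
    show "cinner z (x + y - (f x + f y)) = 0" if "z \<in> L" for z
      using f(2)[OF that, of x] f(2)[OF that, of y] by (simp add: cinner.diff_right cinner.add_right)
  qed
  have scale: "f (r *\<^sub>R x) = r *\<^sub>R f x" for r x
  proof (rule uniq[symmetric])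
    show "r *\<^sub>R f x \<in> L" by (intro csubspace_scaleR[OF L(1)] f)
    show "cinner y (r *\<^sub>R x - r *\<^sub>R f x) = 0" if "y \<in> L" for y
      using f(2)[OF that, of x] by (simp only: cinner.scaleR_right flip: scaleR_diff_right) simp
  qed
  have orth: "cinner (f x) (x - f x) = 0" for x using f by blast
  have le: "norm (f x) \<le> norm x" for x
    by (rule norm_le_if_cinner_eq) (use orth[of x] in \<open>simp add: cinner.diff_right\<close>)
  have bl: "bounded_linear f"
    by (rule bounded_linear_intro[where K = 1]) (auto simp: add scale le)
  define P where "P = Blinfun f"
  have P: "P x = f x" for x unfolding P_def using bl by (simp add: bounded_linear_Blinfun_apply)
  have idem: "f x = x" if "x \<in> L" for x by (rule uniq[symmetric]) (auto simp: that)
  have "orth_projection P"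
    unfolding orth_projection_def adjoint_pair_def
  proof safe
    show "P o\<^sub>L P = P" by (intro blinfun_eqI) (simp add: P idem f(1))
    show "cinner (P x) y = cinner x (P y)" for x y
    proof -
      have "cinner (f x) y = cinner (f x) (f y)" using f(2)[of "f x" y] f(1) by (simp add: cinner.diff_right)
      moreover have "cinner x (f y) = cinner (f x) (f y)"
        using f(2)[of "f y" x] f(1) cinner_sym_zero[of "f y" "x - f x"] by (simp add: cinner.diff_left)
      ultimately show ?thesis by (simp add: P)
    qed
  qed
  moreover have "range P = L"
  proof (intro equalityI subsetI)
    show "x \<in> L" if "x \<in> range P" for x using that f(1) P by auto
    show "x \<in> range P" if "x \<in> L" for x using idem[OF that] P[of x] by (metis rangeI)
  qed
  ultimately show thesis using that by blast
qed

text \<open>Existence and uniqueness justify the definite description in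
  \<open>proj\<close>.\<close>

lemma proj_properties:
  fixes L :: "'a::chilbert_space set"
  assumes "csubspace L" "closed L"
  shows "orth_projection (proj L)" "range (proj L) = L"
proof -
  obtain P :: "'a \<Rightarrow>\<^sub>L 'a" where P: "orth_projection P" "range P = L"
    using orth_projection_exists[OF assms] .
  have "orth_projection (proj L) \<and> range (proj L) = L"
    unfolding proj_def
  proof (rule theI[of _ P])
    fix P' :: "'a \<Rightarrow>\<^sub>L 'a" assume "orth_projection P' \<and> range P' = L"
    then show "P' = P" using orth_projection_unique[of P' P] P by simp
  qed (use P in simp)
  then show "orth_projection (proj L)" "range (proj L) = L" by auto
qed

lemma orth_projection_clinear:
  assumes "orth_projection P"
  shows "clinear_op P"
  unfolding clinear_op_def
proof safe
  show "P (c *\<^sub>C x) = c *\<^sub>C P x" for c x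
    by (rule cinner_eqI) (simp flip: orth_projection_cinner[OF assms])
qed

text \<open>With \<open>R\<close> the orthogonal projection onto the range of \<open>Q\<close>, both \<open>(1 - R) P = (1 - R) (P - Q) P\<close>
  and \<open>(1 - P) R = (1 - P) (Q - P) R\<close> are small, and \<open>R - P\<close> is a difference of the first and the
  adjoint of the second.\<close>

lemma orth_projection_onto_range_close:
  fixes P Q R :: "'a::chilbert_space \<Rightarrow>\<^sub>L 'a"
  assumes P: "orth_projection P" and R: "orth_projection R" and rng: "range R = range Q"
    and Q: "\<And>x. Q (Q x) = Q x"
  shows "norm (R - P) \<le> 2 * norm (Q - P)"
proof (rule norm_blinfun_bound)
  fix x
  have RQ: "R (Q z) = Q z" for z using rng orth_projection_idem[OF R] by (metis rangeE rangeI)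
  have QR: "Q (R z) = R z" for z using rng Q by (metis rangeE rangeI)
  have bound: "norm (Q z - P z) \<le> norm (Q - P) * norm z" for z
    using norm_blinfun[of "Q - P" z] by (simp add: blinfun.diff_left)
  \<comment> \<open>\<open>R (1 - P)\<close> is the adjoint of \<open>(1 - P) R\<close>. Pairing
    \<open>y\<close> with itself moves both factors to the other side, so that no adjoint of
    \<open>Q\<close> has to be formed.\<close>
  define y where "y = R (x - P x)"
  have Ry: "R y = y" by (simp add: y_def orth_projection_idem[OF R])
  have PRx: "norm y \<le> norm (Q - P) * norm x"
  proof -
    have "cinner y y = cinner (R (x - P x)) y" by (simp add: y_def)
    also have "\<dots> = cinner (x - P x) y" by (simp add: orth_projection_cinner[OF R] Ry)
    also have "\<dots> = cinner x (y - P y)"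
      by (simp add: cinner.diff_left cinner.diff_right orth_projection_cinner[OF P])
    finally have "cinner y y = cinner x (Q y - P y)" using QR[of y] Ry by simp
    then have "(norm y)\<^sup>2 \<le> norm x * norm (Q y - P y)"
      using cmod_cinner_le[of x "Q y - P y"]
      using norm_sq_cinner[of y] by simp
    also have "\<dots> \<le> norm x * (norm (Q - P) * norm y)" by (intro mult_left_mono bound) auto
    finally have "norm y * norm y \<le> (norm (Q - P) * norm x) * norm y" by (simp add: power2_eq_square ac_simps)
    then show ?thesis by (cases "y = 0") simp_all
  qed
  define w where "w = P x - Q (P x)"
  have "P x - R (P x) = w - R w" by (simp add: w_def blinfun.diff_right RQ)
  moreover have "norm (w - R w) \<le> norm w"
  proof -
    have "cinner (R w) (w - R w) = 0"
      by (simp add: orth_projection_cinner[OF R] blinfun.diff_right orth_projection_idem[OF R])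
    then have i: "inner (R w) (w - R w) = 0" by (simp add: inner_eq_Re_cinner)
    have "(norm w)\<^sup>2 = (norm (w - R w))\<^sup>2 + (norm (R w))\<^sup>2"
      using i by (simp add: power2_norm_eq_inner inner_diff_left inner_diff_right inner_commute)
    then have "(norm (w - R w))\<^sup>2 \<le> (norm w)\<^sup>2" by simp
    then show ?thesis by (rule power2_le_imp_le) simp
  qed
  moreover have "norm w \<le> norm (Q - P) * norm x"
  proof -
    have "norm w = norm (Q (P x) - P (P x))"
      by (simp add: w_def orth_projection_idem[OF P] norm_minus_commute)
    also have "\<dots> \<le> norm (Q - P) * norm (P x)" by (rule bound)
    also have "\<dots> \<le> norm (Q - P) * norm x" by (intro mult_left_mono orth_projection_norm_le[OF P]) auto
    finally show ?thesis .
  qed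
  moreover have "(R - P) x = y - (P x - R (P x))"
    by (simp add: y_def blinfun.diff_left blinfun.diff_right)
  ultimately show "norm ((R - P) x) \<le> 2 * norm (Q - P) * norm x"
    using PRx norm_triangle_ineq4[of y "P x - R (P x)"] by simp
qed simp

subsection \<open>Resolvents of self-adjoint operators and of bounded perturbations\<close>

definition linear_graph :: "'a::chilbert_space graph \<Rightarrow> bool"
  where "linear_graph H \<longleftrightarrow>
    (\<forall>(x, u) \<in> H. \<forall>(y, v) \<in> H. (x + y, u + v) \<in> H) \<and>
    (\<forall>c. \<forall>(x, u) \<in> H. (c *\<^sub>C x, c *\<^sub>C u) \<in> H)"

lemma linear_graph_add: "linear_graph H \<Longrightarrow> (x, u) \<in> H \<Longrightarrow> (y, v) \<in> H \<Longrightarrow> (x + y, u + v) \<in> H"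
  unfolding linear_graph_def by blast

lemma linear_graph_scale: "linear_graph H \<Longrightarrow> (x, u) \<in> H \<Longrightarrow> (c *\<^sub>C x, c *\<^sub>C u) \<in> H"
  unfolding linear_graph_def by blast

lemma linear_graph_diff:
  assumes "linear_graph H" "(x, u) \<in> H" "(y, v) \<in> H"
  shows "(x - y, u - v) \<in> H"
  using linear_graph_add[OF assms(1,2) linear_graph_scale[OF assms(1,3), of "-1"]] by simp

lemma resolvent_eqI:
  assumes R: "is_resolvent H z R"
  shows "resolvent H z = R"
  unfolding resolvent_def
proof (rule the_equality)
  show "is_resolvent H z R" by (rule R)
  fix R' assume R': "is_resolvent H z R'"
  show "R' = R"
  proof (rule blinfun_eqI)
    fix x
    have "(R' x, x + z *\<^sub>C R' x) \<in> H" using R' unfolding is_resolvent_def by blast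
    then have "R (x + z *\<^sub>C R' x - z *\<^sub>C R' x) = R' x" using R unfolding is_resolvent_def by blast
    then show "R' x = R x" by simp
  qed
qed

lemma is_resolvent_clinear:
  assumes H: "linear_graph H" and R: "is_resolvent H z R"
  shows "clinear_op R"
  unfolding clinear_op_def
proof safe
  fix c x
  have "(R x, x + z *\<^sub>C R x) \<in> H" using R unfolding is_resolvent_def by blast
  from linear_graph_scale[OF H this, of c]
  have "R (c *\<^sub>C (x + z *\<^sub>C R x) - z *\<^sub>C c *\<^sub>C R x) = c *\<^sub>C R x"
    using R unfolding is_resolvent_def by blast
  then show "R (c *\<^sub>C x) = c *\<^sub>C R x" by (simp add: scaleC_add_right scaleC_scaleC mult.commute)
qed

lemma is_resolvent_bound:
  assumes R: "is_resolvent H z R" and k: "k > 0" "\<And>x y. (x, y) \<in> H \<Longrightarrow> k * norm x \<le> norm (y - z *\<^sub>C x)"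
  shows "norm R \<le> 1 / k"
proof (rule norm_blinfun_bound)
  fix x
  have "(R x, x + z *\<^sub>C R x) \<in> H" using R unfolding is_resolvent_def by blast
  from k(2)[OF this] show "norm (R x) \<le> 1 / k * norm x" using k(1) by (simp add: field_simps)
qed (use k in simp)

text \<open>The lower bound makes the solution unique. Hence the pointwise chosen solutions depend
  linearly on \<open>w\<close>, and the same bound makes them bounded.\<close>

lemma is_resolventI:
  assumes H: "linear_graph H" and k: "k > 0" "\<And>x y. (x, y) \<in> H \<Longrightarrow> k * norm x \<le> norm (y - z *\<^sub>C x)"
    and surj: "\<And>w. \<exists>x. (x, w + z *\<^sub>C x) \<in> H"
  shows "\<exists>R. is_resolvent H z R"
proof -
  from surj obtain f where f: "\<And>w. (f w, w + z *\<^sub>C f w) \<in> H" by metis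
  have uniq: "f (y - z *\<^sub>C x) = x" if "(x, y) \<in> H" for x y
  proof -
    define w where "w = y - z *\<^sub>C x"
    have "k * norm (x - f w) \<le> norm ((y - (w + z *\<^sub>C f w)) - z *\<^sub>C (x - f w))"
      by (intro k linear_graph_diff[OF H] that f)
    also have "(y - (w + z *\<^sub>C f w)) - z *\<^sub>C (x - f w) = 0"
      by (simp add: w_def scaleC.diff_right)
    finally show ?thesis using k(1) by (simp add: w_def mult_le_0_iff)
  qed
  have add: "f (v + w) = f v + f w" for v w
    using uniq[OF linear_graph_add[OF H f[of v] f[of w]]] by (simp add: scaleC_add_right algebra_simps)
  have scale: "f (c *\<^sub>C v) = c *\<^sub>C f v" for c v
    using uniq[OF linear_graph_scale[OF H f[of v], of c]]
    by (simp add: scaleC_add_right scaleC_scaleC mult.commute)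
  have bound: "norm (f w) \<le> norm w * (1 / k)" for w
    using k(2)[OF f[of w]] k(1) by (simp add: field_simps)
  have "bounded_linear f"
  proof (rule bounded_linear_intro[where K = "1 / k"])
    show "f (r *\<^sub>R x) = r *\<^sub>R f x" for r x using scale[of "of_real r" x] by (simp add: scaleC_of_real)
  qed (use add bound in auto)
  then have "blinfun_apply (Blinfun f) = f" by (rule bounded_linear_Blinfun_apply)
  then have "is_resolvent H z (Blinfun f)" unfolding is_resolvent_def using f uniq by auto
  then show ?thesis by blast
qed

lemma is_resolvent_identity:
  assumes H: "linear_graph H" and R: "is_resolvent H z R" and R': "is_resolvent H w R'"
  shows "R' x - R x = (w - z) *\<^sub>C R' (R x)"
proof -
  have "(R x, x + z *\<^sub>C R x) \<in> H" using R unfolding is_resolvent_def by blast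
  then have "R' (x + z *\<^sub>C R x - w *\<^sub>C R x) = R x" using R' unfolding is_resolvent_def by blast
  then have "R' x + z *\<^sub>C R' (R x) - w *\<^sub>C R' (R x) = R x"
    using is_resolvent_clinear[OF H R']
    by (simp add: blinfun.add_right blinfun.diff_right clinear_opD)
  then show ?thesis by (simp add: scaleC.diff_left algebra_simps)
qed

section \<open>Self-adjoint graphs\<close>

lemma self_adjoint_iff:
  assumes "self_adjoint A"
  shows "(y, z) \<in> A \<longleftrightarrow> (\<forall>x u. (x, u) \<in> A \<longrightarrow> cinner u y = cinner x z)"
proof -
  have "A = {(y, z). \<forall>(x, u) \<in> A. cinner u y = cinner x z}"
    using assms unfolding self_adjoint_def adjoint_graph_def by simp
  then have "(y, z) \<in> A \<longleftrightarrow> (y, z) \<in> {(y, z). \<forall>(x, u) \<in> A. cinner u y = cinner x z}" by (rule arg_cong)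
  then show ?thesis by auto
qed

lemma self_adjoint_symmetric:
  "self_adjoint A \<Longrightarrow> (x, u) \<in> A \<Longrightarrow> (y, v) \<in> A \<Longrightarrow> cinner u y = cinner x v"
  using self_adjoint_iff by blast

lemma self_adjoint_linear_graph:
  assumes "self_adjoint A"
  shows "linear_graph A"
proof -
  have "(x + y, u + v) \<in> A" if "(x, u) \<in> A" "(y, v) \<in> A" for x y u v
    unfolding self_adjoint_iff[OF assms, of "x + y"]
    using self_adjoint_symmetric[OF assms _ that(1)] self_adjoint_symmetric[OF assms _ that(2)]
    by (simp add: cinner.add_right)
  moreover have "(c *\<^sub>C x, c *\<^sub>C u) \<in> A" if "(x, u) \<in> A" for c x u
    unfolding self_adjoint_iff[OF assms, of "c *\<^sub>C x"]
    using self_adjoint_symmetric[OF assms _ that] by simp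
  ultimately show ?thesis unfolding linear_graph_def by blast
qed

lemma self_adjoint_closed:
  assumes A: "self_adjoint A" and "\<And>n. (f n, g n) \<in> A" "f \<longlonglongrightarrow> x" "g \<longlonglongrightarrow> y"
  shows "(x, y) \<in> A"
  unfolding self_adjoint_iff[OF A, of x]
proof safe
  fix v w assume vw: "(v, w) \<in> A"
  have "(\<lambda>n. cinner w (f n)) \<longlonglongrightarrow> cinner w x" "(\<lambda>n. cinner v (g n)) \<longlonglongrightarrow> cinner v y"
    by (intro cinner.tendsto assms tendsto_const)+
  moreover have "cinner w (f n) = cinner v (g n)" for n
    by (rule self_adjoint_symmetric[OF A vw assms(2)])
  ultimately show "cinner w x = cinner v y" using LIMSEQ_unique by simp
qed

text \<open>By symmetry \<open>cinner v x\<close> is real for \<open>v = u - a x\<close>, so the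
  cross term with the imaginary shift has real part zero. This reduces bounds at a complex point to
  bounds at its real part.\<close>

lemma self_adjoint_norm_shift:
  assumes A: "self_adjoint A" and "(x, u) \<in> A"
  shows "(norm (u - Complex a b *\<^sub>C x))\<^sup>2 = (norm (u - complex_of_real a *\<^sub>C x))\<^sup>2 + b\<^sup>2 * (norm x)\<^sup>2"
proof -
  define v where "v = u - complex_of_real a *\<^sub>C x"
  have "cinner u x = cinner x u" using self_adjoint_symmetric[OF A assms(2) assms(2)] .
  then have "cinner v x = cinner x v"
    by (simp add: v_def cinner.diff_left cinner.diff_right)
  then have "Im (cinner v x) = 0" using cinner_commute[of v x] by (metis complex_cnj_cancel_iff
        add_diff_cancel_left' cnj.simps(2) double_eq_0_iff eq_neg_iff_add_eq_0)
  then have o: "inner v ((\<i> * of_real b) *\<^sub>C x) = 0" by (simp add: inner_eq_Re_cinner)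
  have "u - Complex a b *\<^sub>C x = v - (\<i> * of_real b) *\<^sub>C x"
    by (simp add: v_def Complex_eq scaleC.add_left)
  moreover have "(norm (v - (\<i> * of_real b) *\<^sub>C x))\<^sup>2 = (norm v)\<^sup>2 + (norm ((\<i> * of_real b) *\<^sub>C x))\<^sup>2"
    using o unfolding power2_norm_eq_inner inner_diff_left inner_diff_right
      inner_commute[of "(\<i> * of_real b) *\<^sub>C x" v] by simp
  ultimately have "(norm (u - Complex a b *\<^sub>C x))\<^sup>2 = (norm v)\<^sup>2 + (norm ((\<i> * of_real b) *\<^sub>C x))\<^sup>2"
    by simp
  then show ?thesis by (simp add: v_def norm_mult power_mult_distrib)
qed

text \<open>The bound at \<open>z\<close> makes the range of \<open>A - z\<close> closed. The bound
  at \<open>cnj z\<close> makes it dense, since a vector orthogonal to the range lies in the kernel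
  of \<open>A - cnj z\<close>.\<close>

lemma self_adjoint_resolvent:
  assumes A: "self_adjoint A" and k: "k > 0"
    and lower: "\<And>x u. (x, u) \<in> A \<Longrightarrow> k * norm x \<le> norm (u - z *\<^sub>C x)"
      "\<And>x u. (x, u) \<in> A \<Longrightarrow> k * norm x \<le> norm (u - cnj z *\<^sub>C x)"
  shows "\<exists>R. is_resolvent A z R"
proof (rule is_resolventI[OF self_adjoint_linear_graph[OF A] k lower(1)])
  note lin = self_adjoint_linear_graph[OF A]
  define L where "L = {u - z *\<^sub>C x | x u. (x, u) \<in> A}"
  have zero: "(0, 0) \<in> A" unfolding self_adjoint_iff[OF A, of 0] by simp
  have "csubspace L"
  proof (rule complex_vector.subspaceI)
    show "0 \<in> L" unfolding L_def using zero by (intro CollectI exI[of _ 0]) simp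
    show "v + w \<in> L" if "v \<in> L" "w \<in> L" for v w
    proof -
      from that obtain x u y t where "v = u - z *\<^sub>C x" "w = t - z *\<^sub>C y" "(x, u) \<in> A" "(y, t) \<in> A"
        unfolding L_def by blast
      then have "v + w = (u + t) - z *\<^sub>C (x + y)" "(x + y, u + t) \<in> A"
        using linear_graph_add[OF lin] by (auto simp: scaleC_add_right)
      then show ?thesis unfolding L_def by blast
    qed
    show "c *\<^sub>C v \<in> L" if "v \<in> L" for c v
    proof -
      from that obtain x u where "v = u - z *\<^sub>C x" "(x, u) \<in> A" unfolding L_def by blast
      then have "c *\<^sub>C v = c *\<^sub>C u - z *\<^sub>C (c *\<^sub>C x)" "(c *\<^sub>C x, c *\<^sub>C u) \<in> A"
        using linear_graph_scale[OF lin] by (auto simp: scaleC.diff_right scaleC_scaleC mult.commute)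
      then show ?thesis unfolding L_def by blast
    qed
  qed
  moreover have "closed L"
  proof (rule closed_sequential_limits[THEN iffD2], safe)
    fix v l assume v: "\<forall>n. v n \<in> L" and l: "v \<longlonglongrightarrow> l"
    then have "\<forall>n. \<exists>x u. v n = u - z *\<^sub>C x \<and> (x, u) \<in> A" unfolding L_def by blast
    then obtain x u where xu: "\<And>n. v n = u n - z *\<^sub>C x n" "\<And>n. (x n, u n) \<in> A" by metis
    have "Cauchy x"
    proof (rule metric_CauchyI)
      fix e :: real assume "e > 0"
      moreover have "Cauchy v" using l by (rule LIMSEQ_imp_Cauchy)
      ultimately obtain M where M: "\<And>m n. m \<ge> M \<Longrightarrow> n \<ge> M \<Longrightarrow> dist (v m) (v n) < k * e"
        using k by (metis metric_CauchyD mult_pos_pos)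
      have "dist (x m) (x n) < e" if "m \<ge> M" "n \<ge> M" for m n
      proof -
        have "k * norm (x m - x n) \<le> norm ((u m - u n) - z *\<^sub>C (x m - x n))"
          by (intro lower linear_graph_diff[OF lin] xu)
        also have "\<dots> = dist (v m) (v n)" by (simp add: xu dist_norm scaleC.diff_right algebra_simps)
        also have "\<dots> < k * e" by (rule M[OF that])
        finally show ?thesis using k by (simp add: dist_norm)
      qed
      then show "\<exists>M. \<forall>m\<ge>M. \<forall>n\<ge>M. dist (x m) (x n) < e" by blast
    qed
    then obtain a where a: "x \<longlonglongrightarrow> a" by (meson Cauchy_convergent convergent_def)
    have "(\<lambda>n. v n + z *\<^sub>C x n) \<longlonglongrightarrow> l + z *\<^sub>C a" by (intro tendsto_intros l scaleC.tendsto a)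
    then have "u \<longlonglongrightarrow> l + z *\<^sub>C a" by (simp add: xu)
    then have "(a, l + z *\<^sub>C a) \<in> A" using self_adjoint_closed[OF A xu(2) a] by blast
    then show "l \<in> L" unfolding L_def by force
  qed
  moreover have "y = 0" if y: "\<And>v. v \<in> L \<Longrightarrow> cinner v y = 0" for y
  proof -
    have "cinner u y = cinner x (cnj z *\<^sub>C y)" if "(x, u) \<in> A" for x u
    proof -
      have "cinner (u - z *\<^sub>C x) y = 0" using that by (intro y) (auto simp: L_def)
      then show ?thesis by (simp add: cinner.diff_left)
    qed
    then have "(y, cnj z *\<^sub>C y) \<in> A" unfolding self_adjoint_iff[OF A, of y] by blast
    from lower(2)[OF this] show ?thesis using k by (simp add: mult_le_0_iff)
  qed
  ultimately have L: "L = UNIV" by (rule closed_subspace_eq_UNIV)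
  show "\<exists>x. (x, w + z *\<^sub>C x) \<in> A" for w
  proof -
    have "w \<in> L" by (simp add: L)
    then obtain x u where "w = u - z *\<^sub>C x" "(x, u) \<in> A" unfolding L_def by blast
    then show ?thesis by (intro exI[of _ x]) simp
  qed
qed auto

lemma resolvent_adjoint:
  assumes A: "self_adjoint A" and R: "is_resolvent A z R" and R': "is_resolvent A (cnj z) R'"
  shows "cinner (R x) y = cinner x (R' y)"
proof -
  have "(R x, x + z *\<^sub>C R x) \<in> A" "(R' y, y + cnj z *\<^sub>C R' y) \<in> A"
    using R R' unfolding is_resolvent_def by blast+
  from self_adjoint_symmetric[OF A this] show ?thesis
    by (simp add: cinner.add_left cinner.add_right)
qed

section \<open>Compact resolvents and the distance to the eigenvalues\<close>

lemma compact_op_convergent_subseq: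
  fixes K :: "'a::chilbert_space \<Rightarrow>\<^sub>L 'b::chilbert_space"
  assumes K: "compact_op K" and v: "\<And>n::nat. norm (v n) \<le> M"
  obtains s y where "strict_mono s" "(\<lambda>n. K (v (s n))) \<longlonglongrightarrow> y"
proof -
  define M' where "M' = max M 1"
  have M': "M' > 0" "\<And>n. norm (v n) \<le> M'" using v by (auto simp: M'_def le_max_iff_disj)
  have "seq_compact (closure (K ` cball 0 1))"
    using K unfolding compact_op_def by (simp add: compact_imp_seq_compact)
  moreover have "K ((1 / M') *\<^sub>R v n) \<in> closure (K ` cball 0 1)" for n
    by (rule subsetD[OF closure_subset], rule imageI) (use M' in \<open>simp add: field_simps\<close>)
  ultimately obtain y s where s: "strict_mono s" "((\<lambda>n. K ((1 / M') *\<^sub>R v n)) \<circ> s) \<longlonglongrightarrow> y"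
    by (meson seq_compactE)
  have "(\<lambda>n. M' *\<^sub>R K ((1 / M') *\<^sub>R v (s n))) \<longlonglongrightarrow> M' *\<^sub>R y"
    using s(2) by (intro tendsto_scaleR tendsto_const) (simp add: o_def)
  then have "(\<lambda>n. K (v (s n))) \<longlonglongrightarrow> M' *\<^sub>R y" using M' by (simp add: blinfun.scaleR_right)
  with s(1) show thesis using that by blast
qed

text \<open>A sequence that is bounded in the graph norm is the image under the compact resolvent of
  the bounded sequence \<open>u n - z x n\<close>.\<close>

lemma compact_resolvent_subseq:
  assumes A: "self_adjoint A" "compact_resolvent A"
    and xu: "\<And>n::nat. (x n, u n) \<in> A" "\<And>n. norm (x n) \<le> M" "\<And>n. norm (u n) \<le> M"
  obtains s y where "strict_mono s" "(\<lambda>n. x (s n)) \<longlonglongrightarrow> y"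
proof -
  from A(2) obtain z R where R: "is_resolvent A z R" "compact_op (resolvent A z)"
    unfolding compact_resolvent_def spectrum_def by auto
  then have R': "compact_op R" using resolvent_eqI by metis
  have "norm (u n - z *\<^sub>C x n) \<le> M + cmod z * M" for n
    by (rule order_trans[OF norm_triangle_ineq4])
      (use xu in \<open>auto intro!: add_mono mult_left_mono\<close>)
  then obtain s y where "strict_mono s" "(\<lambda>n. R (u (s n) - z *\<^sub>C x (s n))) \<longlonglongrightarrow> y"
    using compact_op_convergent_subseq[OF R', of "\<lambda>n. u n - z *\<^sub>C x n"] by metis
  moreover have "R (u n - z *\<^sub>C x n) = x n" for n using R(1) xu(1)[of n] unfolding is_resolvent_def by blast
  ultimately show thesis using that by simp
qed

text \<open>Otherwise there are normalized approximate eigenvectors at \<open>a\<close>. Compactness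
  gives a convergent subsequence, and since the graph is closed its limit is a true
  eigenvector.\<close>

lemma not_eigenvalue_lower_bound:
  assumes A: "self_adjoint A" "compact_resolvent A" and e: "\<not> eigenvalue A (complex_of_real a)"
  shows "\<exists>m>0. \<forall>(x, u) \<in> A. m * norm x \<le> norm (u - complex_of_real a *\<^sub>C x)"
proof (rule ccontr)
  note lin = self_adjoint_linear_graph[OF A(1)]
  assume *: "\<not> ?thesis"
  have "\<exists>x u. (x, u) \<in> A \<and> norm x = 1 \<and> norm (u - complex_of_real a *\<^sub>C x) < 1 / real (Suc n)" for n
  proof -
    have "1 / real (Suc n) > 0" by simp
    with * have "\<not> (\<forall>(x, u) \<in> A. 1 / real (Suc n) * norm x \<le> norm (u - complex_of_real a *\<^sub>C x))" by blast
    then obtain x u where xu: "(x, u) \<in> A"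
      "norm (u - complex_of_real a *\<^sub>C x) < 1 / real (Suc n) * norm x" by (auto simp: not_le)
    have x: "norm x > 0"
      using le_less_trans[OF norm_ge_zero xu(2)] by (cases "x = 0") simp_all
    define c where "c = complex_of_real (1 / norm x)"
    have "(c *\<^sub>C x, c *\<^sub>C u) \<in> A" by (rule linear_graph_scale[OF lin xu(1)])
    moreover have "norm (c *\<^sub>C x) = 1" using x by (simp add: c_def norm_divide)
    moreover have "norm (c *\<^sub>C u - complex_of_real a *\<^sub>C c *\<^sub>C x) < 1 / real (Suc n)"
    proof -
      have "c *\<^sub>C u - complex_of_real a *\<^sub>C c *\<^sub>C x = c *\<^sub>C (u - complex_of_real a *\<^sub>C x)"
        by (simp add: scaleC.diff_right scaleC_scaleC mult.commute)
      also have "norm \<dots> = norm (u - complex_of_real a *\<^sub>C x) / norm x"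
        using x by (simp add: c_def norm_divide)
      also have "\<dots> < 1 / real (Suc n)" using xu(2) x by (simp only: pos_divide_less_eq)
      finally show ?thesis .
    qed
    ultimately show ?thesis by blast
  qed
  then obtain x u where xu: "\<And>n. (x n, u n) \<in> A" "\<And>n. norm (x n) = 1"
    "\<And>n. norm (u n - complex_of_real a *\<^sub>C x n) < 1 / real (Suc n)" by metis
  have "norm (u n) \<le> 1 + \<bar>a\<bar>" for n
  proof -
    have "1 / real (Suc n) \<le> 1" by simp
    then show ?thesis
      using norm_triangle_ineq[of "u n - complex_of_real a *\<^sub>C x n" "complex_of_real a *\<^sub>C x n"]
        xu(2)[of n] less_le_trans[OF xu(3)[of n], of 1] by simp
  qed
  then obtain s y where s: "strict_mono s" "(\<lambda>n. x (s n)) \<longlonglongrightarrow> y"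
    using compact_resolvent_subseq[OF A, of x u "1 + \<bar>a\<bar>"] xu(1,2) by auto
  have "(\<lambda>n. u n - complex_of_real a *\<^sub>C x n) \<longlonglongrightarrow> 0"
    using xu(3) by (intro Lim_null_comparison[OF _ LIMSEQ_inverse_real_of_nat])
      (auto intro!: always_eventually less_imp_le simp: inverse_eq_divide)
  from LIMSEQ_subseq_LIMSEQ[OF this s(1)]
  have "(\<lambda>n. (u (s n) - complex_of_real a *\<^sub>C x (s n)) + complex_of_real a *\<^sub>C x (s n)) \<longlonglongrightarrow> 0 + complex_of_real a *\<^sub>C y"
    by (intro tendsto_add scaleC.tendsto s tendsto_const) (simp add: o_def)
  then have "(\<lambda>n. u (s n)) \<longlonglongrightarrow> complex_of_real a *\<^sub>C y" by simp
  then have "(y, complex_of_real a *\<^sub>C y) \<in> A"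
    by (intro self_adjoint_closed[OF A(1) _ s(2), of "\<lambda>n. u (s n)"] xu(1))
  moreover have "norm y = 1"
    using tendsto_norm[OF s(2)] xu(2) by (simp add: LIMSEQ_const_iff)
  ultimately show False using e unfolding eigenvalue_def by force
qed

lemma norm_blinfun_approx:
  fixes B :: "'a::chilbert_space \<Rightarrow>\<^sub>L 'b::chilbert_space"
  assumes "0 \<le> c" "c < norm B"
  obtains u where "norm u = 1" "c < norm (B u)"
proof -
  have "\<not> (\<forall>x. norm (B x) \<le> c * norm x)" using norm_blinfun_bound[OF assms(1), of B] assms(2) by auto
  then obtain x where x: "c * norm x < norm (B x)" by (auto simp: not_le)
  then have x0: "norm x > 0" by (cases "x = 0") (simp_all add: blinfun.zero_right)
  show thesis
    by (rule that[of "(1 / norm x) *\<^sub>R x"]) (use x x0 in \<open>simp_all add: blinfun.scaleR_right field_simps\<close>)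
qed

text \<open>The norm of the bounded inverse is an eigenvalue of it up to sign, because the approximate
  maximizers \<open>u\<close> of \<open>norm (B u)\<close> are approximate eigenvectors of \<open>B\<^sup>2\<close>.\<close>

lemma real_resolvent_bound:
  assumes A: "self_adjoint A" "compact_resolvent A" and B: "is_resolvent A (complex_of_real a) B"
    and d: "\<And>t. eigenvalue A (complex_of_real t) \<Longrightarrow> d \<le> \<bar>a - t\<bar>"
  shows "d * norm B \<le> 1"
proof (cases "norm B = 0")
  case False
  define \<beta> where "\<beta> = norm B"
  have \<beta>: "\<beta> > 0" using False by (simp add: \<beta>_def)
  note lin = self_adjoint_linear_graph[OF A(1)]
  note clin = clinear_opD[OF is_resolvent_clinear[OF lin B]]
  have graph: "(B x, x + complex_of_real a *\<^sub>C B x) \<in> A" for x using B unfolding is_resolvent_def by blast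
  have sym: "cinner (B x) y = cinner x (B y)" for x y
    by (rule resolvent_adjoint[OF A(1) B]) (use B in simp)
  have "\<exists>u. norm u = 1 \<and> \<beta> - \<beta> / real (Suc n) < norm (B u)" for n
  proof -
    have "0 \<le> \<beta> - \<beta> / real (Suc n)" "\<beta> - \<beta> / real (Suc n) < norm B" using \<beta> by (auto simp: field_simps \<beta>_def)
    then show ?thesis using norm_blinfun_approx by metis
  qed
  then obtain u where u: "\<And>n. norm (u n) = 1" "\<And>n. \<beta> - \<beta> / real (Suc n) < norm (B (u n))" by metis
  have Bu: "norm (B (u n)) \<le> \<beta>" for n using norm_blinfun[of B "u n"] u by (simp add: \<beta>_def)
  have lim1: "(\<lambda>n. norm (B (u n))) \<longlonglongrightarrow> \<beta>"
  proof (rule real_tendsto_sandwich)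
    have "(\<lambda>n. \<beta> - \<beta> * inverse (real (Suc n))) \<longlonglongrightarrow> \<beta> - \<beta> * 0"
      by (intro tendsto_intros LIMSEQ_inverse_real_of_nat)
    then show "(\<lambda>n. \<beta> - \<beta> / real (Suc n)) \<longlonglongrightarrow> \<beta>" by (simp add: divide_inverse)
    show "(\<lambda>n. \<beta>) \<longlonglongrightarrow> \<beta>" by simp
  qed (use u Bu in \<open>auto intro!: always_eventually less_imp_le\<close>)
  \<comment> \<open>When the square is expanded, the mixed term becomes
    \<open>(norm (B (u n)))^2\<close> by symmetry of \<open>B\<close>. As this tends to
    \<open>\<beta>^2\<close>, the right-hand side tends to zero.\<close>
  have est: "(norm (B (B (u n)) - \<beta>\<^sup>2 *\<^sub>R u n))\<^sup>2 \<le> 2 * \<beta>^4 - 2 * \<beta>\<^sup>2 * (norm (B (u n)))\<^sup>2" for n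
  proof -
    have "norm (B (B (u n))) \<le> \<beta> * \<beta>"
      using norm_blinfun[of B "B (u n)"] mult_left_mono[OF Bu[of n], of \<beta>] \<beta> unfolding \<beta>_def by linarith
    then have "(norm (B (B (u n))))\<^sup>2 \<le> (\<beta> * \<beta>)\<^sup>2" by (intro power_mono) auto
    moreover have "inner (B (B (u n))) (u n) = (norm (B (u n)))\<^sup>2"
      by (simp add: inner_eq_Re_cinner sym power2_norm_eq_inner)
    moreover have "(norm (B (B (u n)) - \<beta>\<^sup>2 *\<^sub>R u n))\<^sup>2 =
        (norm (B (B (u n))))\<^sup>2 - 2 * \<beta>\<^sup>2 * inner (B (B (u n))) (u n) + (\<beta>\<^sup>2)\<^sup>2 * (norm (u n))\<^sup>2"
      unfolding power2_norm_eq_inner inner_diff_left inner_diff_right inner_scaleR_left inner_scaleR_right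
        inner_commute[of "u n" "B (B (u n))"]
      by (simp add: power2_eq_square algebra_simps)
    ultimately show ?thesis by (simp add: u(1) power2_eq_square power4_eq_xxxx)
  qed
  have "(\<lambda>n. 2 * \<beta>^4 - 2 * \<beta>\<^sup>2 * (norm (B (u n)))\<^sup>2) \<longlonglongrightarrow> 2 * \<beta>^4 - 2 * \<beta>\<^sup>2 * \<beta>\<^sup>2"
    by (intro tendsto_intros lim1)
  then have "(\<lambda>n. 2 * \<beta>^4 - 2 * \<beta>\<^sup>2 * (norm (B (u n)))\<^sup>2) \<longlonglongrightarrow> 0" by (simp add: power2_eq_square power4_eq_xxxx)
  then have "(\<lambda>n. (norm (B (B (u n)) - \<beta>\<^sup>2 *\<^sub>R u n))\<^sup>2) \<longlonglongrightarrow> 0"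
    by (rule Lim_null_comparison[rotated]) (use est in \<open>auto intro!: always_eventually\<close>)
  then have "(\<lambda>n. (norm (norm (B (B (u n)) - \<beta>\<^sup>2 *\<^sub>R u n)))^2) \<longlonglongrightarrow> 0" by simp
  then have "(\<lambda>n. norm (B (B (u n)) - \<beta>\<^sup>2 *\<^sub>R u n)) \<longlonglongrightarrow> 0"
    using tendsto_real_sqrt[of "\<lambda>n. (norm (B (B (u n)) - \<beta>\<^sup>2 *\<^sub>R u n))\<^sup>2" 0] by simp
  then have lim2: "(\<lambda>n. B (B (u n)) - \<beta>\<^sup>2 *\<^sub>R u n) \<longlonglongrightarrow> 0" by (rule tendsto_norm_zero_cancel)
  define M where "M = 1 + \<bar>a\<bar> * \<beta> + \<beta>"
  have "norm (B (u n)) \<le> M" for n using Bu[of n] \<beta> by (simp add: M_def add_increasing)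
  moreover have "norm (u n + complex_of_real a *\<^sub>C B (u n)) \<le> M" for n
  proof -
    have "\<bar>a\<bar> * norm (B (u n)) \<le> \<bar>a\<bar> * \<beta>" by (intro mult_left_mono Bu) auto
    then show ?thesis
      using norm_triangle_ineq[of "u n" "complex_of_real a *\<^sub>C B (u n)"] \<beta>
      by (simp add: M_def u(1))
  qed
  ultimately obtain s v where s: "strict_mono s" "(\<lambda>n. B (u (s n))) \<longlonglongrightarrow> v"
    using compact_resolvent_subseq[OF A, of "\<lambda>n. B (u n)" "\<lambda>n. u n + complex_of_real a *\<^sub>C B (u n)" M] graph
    by blast
  have "(\<lambda>n. (1 / \<beta>\<^sup>2) *\<^sub>R (B (B (u (s n))) - (B (B (u (s n))) - \<beta>\<^sup>2 *\<^sub>R u (s n)))) \<longlonglongrightarrow> (1 / \<beta>\<^sup>2) *\<^sub>R (B v - 0)"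
    using LIMSEQ_subseq_LIMSEQ[OF lim2 s(1)]
    by (intro tendsto_intros blinfun.tendsto s(2)) (simp add: o_def)
  then have lim3: "(\<lambda>n. u (s n)) \<longlonglongrightarrow> (1 / \<beta>\<^sup>2) *\<^sub>R B v" using \<beta> by simp
  define w where "w = (1 / \<beta>\<^sup>2) *\<^sub>R B v"
  have w1: "norm w = 1" using tendsto_norm[OF lim3, folded w_def] unfolding u(1) LIMSEQ_const_iff by simp
  have "(\<lambda>n. B (u (s n))) \<longlonglongrightarrow> B w" unfolding w_def by (intro blinfun.tendsto tendsto_const lim3)
  then have Bw: "B w = v" using s(2) LIMSEQ_unique by blast
  then have BBw: "B (B w) = \<beta>\<^sup>2 *\<^sub>R w" using \<beta> by (simp add: w_def)
  \<comment> \<open>An eigenvector of \<open>B\<close> with eigenvalue \<open>c\<close> is an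
    eigenvector of \<open>A\<close> with eigenvalue \<open>a + 1 / c\<close>, which lies at distance
    \<open>1 / \<beta>\<close> from \<open>a\<close>.\<close>
  have key: "d \<le> 1 / \<beta>" if x: "B x = c *\<^sub>R x" "x \<noteq> 0" "\<bar>c\<bar> = \<beta>" for x c
  proof -
    have c: "c \<noteq> 0" using x \<beta> by auto
    have "(complex_of_real (1 / c) *\<^sub>C B x, complex_of_real (1 / c) *\<^sub>C (x + complex_of_real a *\<^sub>C B x)) \<in> A"
      by (rule linear_graph_scale[OF lin graph])
    moreover have "complex_of_real (1 / c) *\<^sub>C B x = x" using c by (simp only: scaleC_of_real x) simp
    moreover have "complex_of_real (1 / c) *\<^sub>C (x + complex_of_real a *\<^sub>C B x) = complex_of_real (a + 1 / c) *\<^sub>C x"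
      using c by (simp only: scaleC_of_real x scaleR_add_right scaleR_add_left scaleR_scaleR) simp
    ultimately have "eigenvalue A (complex_of_real (a + 1 / c))"
      unfolding eigenvalue_def using x(2) by metis
    from d[OF this] show ?thesis using x(3) by simp
  qed
  have "d \<le> 1 / \<beta>"
  \<comment> \<open>From \<open>B (B w) = \<beta>^2 w\<close> one has
    \<open>(B - \<beta>) (B + \<beta>) w = 0\<close>: either \<open>w\<close> belongs to
    \<open>- \<beta>\<close>, or \<open>(B + \<beta>) w\<close> is nonzero and belongs to
    \<open>\<beta>\<close>.\<close>
  proof (cases "B w + \<beta> *\<^sub>R w = 0")
    case True
    moreover have "w \<noteq> 0" using w1 by (metis norm_zero zero_neq_one)
    ultimately show ?thesis using key[of w "- \<beta>"] \<beta> by (simp add: eq_neg_iff_add_eq_0)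
  next
    case False
    have "B (B w + \<beta> *\<^sub>R w) = \<beta> *\<^sub>R (B w + \<beta> *\<^sub>R w)"
      by (simp add: blinfun.add_right blinfun.scaleR_right BBw scaleR_add_right power2_eq_square add.commute)
    then show ?thesis using key[of "B w + \<beta> *\<^sub>R w" \<beta>] False \<beta> by simp
  qed
  then show ?thesis using \<beta> by (simp add: \<beta>_def field_simps)
qed simp

text \<open>If the imaginary part \<open>b\<close> does not already give the bound, the real part
  \<open>a\<close> still has distance \<open>e = sqrt (d^2 - b^2)\<close> from the eigenvalues. The
  inverse at \<open>a\<close> is then bounded by \<open>1 / e\<close>, and Pythagoras restores
  \<open>d\<close>.\<close>

lemma self_adjoint_lower_bound:
  assumes A: "self_adjoint A" "compact_resolvent A" and "d > 0"
    and d: "\<And>t. eigenvalue A (complex_of_real t) \<Longrightarrow> d \<le> cmod (z - complex_of_real t)"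
    and xu: "(x, u) \<in> A"
  shows "d * norm x \<le> norm (u - z *\<^sub>C x)"
proof -
  obtain a b where z: "z = Complex a b" by (cases z)
  have eq: "(norm (u - z *\<^sub>C x))\<^sup>2 = (norm (u - complex_of_real a *\<^sub>C x))\<^sup>2 + b\<^sup>2 * (norm x)\<^sup>2"
    unfolding z by (rule self_adjoint_norm_shift[OF A(1) xu])
  have "d\<^sup>2 * (norm x)\<^sup>2 \<le> (norm (u - z *\<^sub>C x))\<^sup>2"
  proof (cases "d \<le> \<bar>b\<bar>")
    case True
    then have "d\<^sup>2 \<le> b\<^sup>2" using \<open>d > 0\<close> by (simp add: abs_le_square_iff[symmetric])
    then show ?thesis unfolding eq by (simp add: add_increasing mult_right_mono)
  next
    case False
    define e where "e = sqrt (d\<^sup>2 - b\<^sup>2)"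
    have "b\<^sup>2 < d\<^sup>2" using False by (metis abs_le_square_iff abs_of_pos assms(3) not_le)
    then have e: "e > 0" "e\<^sup>2 = d\<^sup>2 - b\<^sup>2" by (auto simp: e_def)
    have dist: "e \<le> \<bar>a - t\<bar>" if "eigenvalue A (complex_of_real t)" for t
    proof -
      have "d\<^sup>2 \<le> (cmod (z - complex_of_real t))\<^sup>2" using d[OF that] \<open>d > 0\<close> by (intro power_mono) auto
      also have "\<dots> = (a - t)\<^sup>2 + b\<^sup>2" by (simp add: z cmod_power2)
      finally have "e\<^sup>2 \<le> \<bar>a - t\<bar>\<^sup>2" using e by simp
      then show ?thesis by (rule power2_le_imp_le) simp
    qed
    then have "\<not> eigenvalue A (complex_of_real a)" using e(1) by force
    then obtain m where m: "m > 0" "\<And>x u. (x, u) \<in> A \<Longrightarrow> m * norm x \<le> norm (u - complex_of_real a *\<^sub>C x)"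
      using not_eigenvalue_lower_bound[OF A] by blast
    obtain B where B: "is_resolvent A (complex_of_real a) B"
      using self_adjoint_resolvent[OF A(1) m(1), of "complex_of_real a"] m(2) by auto
    have "x = B (u - complex_of_real a *\<^sub>C x)" using B xu unfolding is_resolvent_def by force
    then have "norm x \<le> norm B * norm (u - complex_of_real a *\<^sub>C x)" by (metis norm_blinfun)
    then have "e * norm x \<le> (e * norm B) * norm (u - complex_of_real a *\<^sub>C x)"
      using e(1) by (simp add: mult.assoc)
    also have "\<dots> \<le> 1 * norm (u - complex_of_real a *\<^sub>C x)"
      by (intro mult_right_mono real_resolvent_bound[OF A B] dist) auto
    finally have "(e * norm x)\<^sup>2 \<le> (norm (u - complex_of_real a *\<^sub>C x))\<^sup>2"
      using e(1) by (intro power_mono) auto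
    then show ?thesis unfolding eq by (simp add: power_mult_distrib e algebra_simps)
  qed
  then have "(d * norm x)\<^sup>2 \<le> (norm (u - z *\<^sub>C x))\<^sup>2" by (simp add: power_mult_distrib)
  then show ?thesis by (rule power2_le_imp_le) simp
qed

section \<open>Bounded perturbations\<close>

lemma graph_plus_0 [simp]: "graph_plus A 0 = A"
  unfolding graph_plus_def by auto

lemma graph_plus_iff: "(x, u) \<in> graph_plus A X \<longleftrightarrow> (x, u - X x) \<in> A"
proof
  assume "(x, u - X x) \<in> A"
  then show "(x, u) \<in> graph_plus A X"
    unfolding graph_plus_def by (intro CollectI exI[of _ x] exI[of _ "u - X x"]) auto
qed (auto simp: graph_plus_def)

locale perturbed_operator =
  fixes A :: "'a::chilbert_space graph" and \<Lambda> :: "real set" and X :: "'a \<Rightarrow>\<^sub>L 'a"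
  assumes sa: "self_adjoint A" and compact: "compact_resolvent A"
    and \<Lambda>: "\<And>t. eigenvalue A (complex_of_real t) \<Longrightarrow> t \<in> \<Lambda>"
    and X: "clinear_op X"
begin

abbreviation H where "H \<equiv> graph_plus A X"

abbreviation dist_spec :: "complex \<Rightarrow> real" where "dist_spec z \<equiv> infdist z (complex_of_real ` \<Lambda>)"

text \<open>An explicit open part of the resolvent set of \<open>H\<close>, on which the distance to
  \<open>\<Lambda>\<close> dominates the perturbation. For \<open>X = 0\<close> it consists of the
  points at positive distance.\<close>

definition U where "U = {z. norm X < dist_spec z}"

lemma linear_graph_H: "linear_graph H"
proof -
  note lin = self_adjoint_linear_graph[OF sa]
  have "(x + y, u + v) \<in> H" if "(x, u) \<in> H" "(y, v) \<in> H" for x y u v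
    using linear_graph_add[OF lin, of x "u - X x" y "v - X y"] that
    by (simp add: graph_plus_iff blinfun.add_right algebra_simps)
  moreover have "(c *\<^sub>C x, c *\<^sub>C u) \<in> H" if "(x, u) \<in> H" for c x u
    using linear_graph_scale[OF lin, of x "u - X x" c] that
    by (simp add: graph_plus_iff clinear_opD[OF X] scaleC.diff_right)
  ultimately show ?thesis unfolding linear_graph_def by blast
qed

lemma infdist_pos: "z \<in> U \<Longrightarrow> 0 < dist_spec z"
  unfolding U_def by (auto intro: le_less_trans[OF norm_ge_zero])

lemma lower_bound_A:
  assumes "(x, u) \<in> A" "dist_spec z > 0"
  shows "dist_spec z * norm x \<le> norm (u - z *\<^sub>C x)"
proof (rule self_adjoint_lower_bound[OF sa compact assms(2) _ assms(1)])
  show "dist_spec z \<le> cmod (z - complex_of_real t)"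
    if "eigenvalue A (complex_of_real t)" for t
    using infdist_le[of "complex_of_real t" "complex_of_real ` \<Lambda>" z] \<Lambda>[OF that] by (simp add: dist_norm)
qed

lemma infdist_cnj: "dist_spec (cnj z) = dist_spec z"
proof -
  have "dist (cnj z) (complex_of_real t) = dist z (complex_of_real t)" for t
    by (metis complex_cnj_complex_of_real complex_cnj_diff complex_mod_cnj dist_norm)
  then show ?thesis by (auto simp: infdist_def image_image)
qed

lemma lower_bound_H:
  assumes "(x, u) \<in> H" "z \<in> U"
  shows "(dist_spec z - norm X) * norm x \<le> norm (u - z *\<^sub>C x)"
proof -
  have pos: "dist_spec z > 0"
    by (rule infdist_pos[OF assms(2)])
  have "(x, u - X x) \<in> A" using assms(1) by (simp add: graph_plus_iff)
  from lower_bound_A[OF this pos]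
  have "dist_spec z * norm x \<le> norm ((u - z *\<^sub>C x) - X x)" by (simp add: algebra_simps)
  also have "\<dots> \<le> norm (u - z *\<^sub>C x) + norm X * norm x"
    by (rule order_trans[OF norm_triangle_ineq4]) (simp add: norm_blinfun)
  finally show ?thesis by (simp add: algebra_simps)
qed

lemma resolvent_A:
  assumes "dist_spec z > 0"
  shows "is_resolvent A z (resolvent A z)"
    and "norm (resolvent A z) \<le> 1 / dist_spec z"
proof -
  obtain R where R: "is_resolvent A z R"
    using self_adjoint_resolvent[OF sa assms] lower_bound_A[OF _ assms] lower_bound_A[of _ _ "cnj z"] assms
    by (metis infdist_cnj)
  then show *: "is_resolvent A z (resolvent A z)" by (simp add: resolvent_eqI[OF R])
  show "norm (resolvent A z) \<le> 1 / dist_spec z"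
    by (rule is_resolvent_bound[OF * assms]) (rule lower_bound_A[OF _ assms])
qed

lemma resolvent_H:
  assumes z: "z \<in> U"
  shows "is_resolvent H z (resolvent H z)"
    and "norm (resolvent H z) \<le> 1 / (dist_spec z - norm X)"
proof -
  define d where "d = dist_spec z"
  have d: "norm X < d" "0 < d" using z infdist_pos[OF z] unfolding U_def d_def by auto
  have RA: "is_resolvent A z (resolvent A z)" "norm (resolvent A z) \<le> 1 / d"
    using resolvent_A[of z] d by (auto simp: d_def)
  have "\<exists>R. is_resolvent H z R"
  proof (rule is_resolventI[OF linear_graph_H])
    show "0 < d - norm X" using d by simp
    show "(d - norm X) * norm x \<le> norm (y - z *\<^sub>C x)" if "(x, y) \<in> H" for x y
      unfolding d_def by (rule lower_bound_H[OF that z])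
    show "\<exists>x. (x, w + z *\<^sub>C x) \<in> H" for w
    proof -
      \<comment> \<open>The equation \<open>(A + X - z) x = w\<close> is a fixed point problem for a
        contraction with factor \<open>norm X / d\<close>.\<close>
      have "\<exists>!x. resolvent A z (w - X x) = x"
      proof (rule banach_fix_type[of "norm X / d"])
        show "\<forall>x y. dist (resolvent A z (w - X x)) (resolvent A z (w - X y)) \<le> norm X / d * dist x y"
        proof safe
          fix x y
          have "dist (resolvent A z (w - X x)) (resolvent A z (w - X y)) = norm (resolvent A z (X (y - x)))"
            by (simp add: dist_norm blinfun.diff_right)
          also have "\<dots> \<le> norm (resolvent A z) * norm (X (y - x))" by (rule norm_blinfun)
          also have "\<dots> \<le> (1 / d) * (norm X * norm (y - x))"
            by (intro mult_mono RA norm_blinfun) (use d in auto)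
          finally show "dist (resolvent A z (w - X x)) (resolvent A z (w - X y)) \<le> norm X / d * dist x y"
            by (simp add: dist_norm norm_minus_commute)
        qed
      qed (use d in auto)
      then obtain x where "resolvent A z (w - X x) = x" by blast
      then have "(x, w - X x + z *\<^sub>C x) \<in> A"
        using RA(1) unfolding is_resolvent_def by metis
      then show ?thesis by (intro exI[of _ x]) (simp add: graph_plus_iff algebra_simps)
    qed
  qed
  then obtain R where R: "is_resolvent H z R" by blast
  then show *: "is_resolvent H z (resolvent H z)" by (simp add: resolvent_eqI[OF R])
  show "norm (resolvent H z) \<le> 1 / (dist_spec z - norm X)"
    by (rule is_resolvent_bound[OF *]) (use d in \<open>auto simp: d_def lower_bound_H[OF _ z]\<close>)
qed

text \<open>The second resolvent identity. Its two resolvent factors are the source of the quadratic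
  decay in the distance on which the comparison of the projections rests.\<close>

lemma resolvent_difference:
  assumes z: "z \<in> U"
  shows "resolvent H z x - resolvent A z x = - resolvent H z (X (resolvent A z x))"
proof -
  have pos: "dist_spec z > 0"
    by (rule infdist_pos[OF z])
  define a where "a = resolvent A z x"
  have "(a, x + z *\<^sub>C a) \<in> A" unfolding a_def using resolvent_A(1)[OF pos] unfolding is_resolvent_def by blast
  then have "(a, x + z *\<^sub>C a + X a) \<in> H" by (simp add: graph_plus_iff)
  then have "resolvent H z (x + z *\<^sub>C a + X a - z *\<^sub>C a) = a"
    using resolvent_H(1)[OF z] unfolding is_resolvent_def by blast
  then have "resolvent H z x + resolvent H z (X a) = a" by (simp add: blinfun.add_right add.commute)
  then show ?thesis by (simp add: a_def eq_neg_iff_add_eq_0 algebra_simps)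
qed

end

subsection \<open>Riesz integrals of pseudo-resolvents\<close>

abbreviation two_pi_i :: complex where "two_pi_i \<equiv> 2 * complex_of_real pi * \<i>"

text \<open>\<open>riesz_op\<close> with the resolvent replaced by an arbitrary operator function,
  so that the calculus can be developed from the resolvent identity alone.\<close>

definition riesz_integral ::
    "(complex \<Rightarrow> ('a::chilbert_space \<Rightarrow>\<^sub>L 'a)) \<Rightarrow> complex \<Rightarrow> real \<Rightarrow> ('a \<Rightarrow>\<^sub>L 'a)"
  where "riesz_integral R c \<rho> = scaleC_op (- 1 / two_pi_i)
    (integral {0..1} (line_integrand R (circlepath c \<rho>)))"

lemma riesz_op_eq: "riesz_op H c \<rho> = riesz_integral (resolvent H) c \<rho>"
  unfolding riesz_op_def riesz_integral_def by (simp add: mult.assoc)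

lemma line_integrand_integrable:
  fixes F :: "complex \<Rightarrow> ('a::chilbert_space \<Rightarrow>\<^sub>L 'b::chilbert_space)"
  assumes "\<rho> > 0" "continuous_on (sphere c \<rho>) F"
  shows "line_integrand F (circlepath c \<rho>) integrable_on {0..1}"
proof (rule integrable_continuous_interval)
  have "circlepath c \<rho> ` {0..1} \<subseteq> sphere c \<rho>"
    using path_image_circlepath[of c \<rho>] assms by (simp add: path_image_def)
  then have "continuous_on {0..1} (\<lambda>t. F (circlepath c \<rho> t))"
    using continuous_on_compose2[OF assms(2) path_circlepath[unfolded path_def]] by blast
  then show "continuous_on {0..1} (line_integrand F (circlepath c \<rho>))"
    unfolding line_integrand_def vector_derivative_circlepath
    by (intro scaleC_op.continuous_on continuous_intros)
qed

text \<open>The passage from operator integrals to scalar contour integrals: a complex-linear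
  functional \<open>l\<close> may be pulled through the integral, and matrix elements determine the
  operator.\<close>

lemma riesz_integral_functional:
  fixes F :: "complex \<Rightarrow> ('a::chilbert_space \<Rightarrow>\<^sub>L 'a)"
  assumes "\<rho> > 0" "continuous_on (sphere c \<rho>) F"
    and l: "bounded_linear l" "\<And>d T. l (scaleC_op d T) = d * l T"
  shows "((\<lambda>z. l (F z)) has_contour_integral (- two_pi_i * l (riesz_integral F c \<rho>))) (circlepath c \<rho>)"
proof -
  have "((\<lambda>t. l (line_integrand F (circlepath c \<rho>) t)) has_integral
      l (integral {0..1} (line_integrand F (circlepath c \<rho>)))) {0..1}"
    using has_integral_linear[OF integrable_integral[OF line_integrand_integrable[OF assms(1,2)]] l(1)]
    by (simp add: o_def)
  moreover have "l (integral {0..1} (line_integrand F (circlepath c \<rho>))) = - two_pi_i * l (riesz_integral F c \<rho>)"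
    by (simp add: riesz_integral_def l(2))
  ultimately show ?thesis
    unfolding has_contour_integral line_integrand_def l(2) by (simp add: mult.commute)
qed

lemma bounded_linear_matrix_element:
  "bounded_linear (\<lambda>T. cinner y (blinfun_apply S (blinfun_apply T (x::'a::chilbert_space))))"
  by (rule bounded_linear_compose[OF cinner.bounded_linear_right])
    (rule bounded_linear_compose[OF blinfun.bounded_linear_right blinfun.bounded_linear_left])

lemma has_contour_integral_riesz:
  fixes F :: "complex \<Rightarrow> ('a::chilbert_space \<Rightarrow>\<^sub>L 'a)"
  assumes "\<rho> > 0" "continuous_on (sphere c \<rho>) F" "clinear_op S"
  shows "((\<lambda>z. cinner y (blinfun_apply S (F z x))) has_contour_integral
    (- two_pi_i * cinner y (S (riesz_integral F c \<rho> x)))) (circlepath c \<rho>)"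
  by (rule riesz_integral_functional[OF assms(1,2) bounded_linear_matrix_element])
    (simp add: clinear_opD[OF assms(3)])

lemma has_contour_integral_riesz':
  fixes F :: "complex \<Rightarrow> ('a::chilbert_space \<Rightarrow>\<^sub>L 'a)"
  assumes "\<rho> > 0" "continuous_on (sphere c \<rho>) F"
  shows "((\<lambda>z. cinner y (F z x)) has_contour_integral
    (- two_pi_i * cinner y (riesz_integral F c \<rho> x))) (circlepath c \<rho>)"
  using has_contour_integral_riesz[OF assms, of id_blinfun] by (simp add: clinear_op_def)

lemma riesz_integral_clinear:
  fixes F :: "complex \<Rightarrow> ('a::chilbert_space \<Rightarrow>\<^sub>L 'a)"
  assumes "\<rho> > 0" "continuous_on (sphere c \<rho>) F" "\<And>z. z \<in> sphere c \<rho> \<Longrightarrow> clinear_op (F z)"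
  shows "clinear_op (riesz_integral F c \<rho>)"
  unfolding clinear_op_def
proof safe
  fix a x
  show "riesz_integral F c \<rho> (a *\<^sub>C x) = a *\<^sub>C riesz_integral F c \<rho> x"
  proof (rule cinner_eqI)
    fix y
    have "((\<lambda>z. a * cinner y (F z x)) has_contour_integral
      (a * (- two_pi_i * cinner y (riesz_integral F c \<rho> x)))) (circlepath c \<rho>)"
      by (intro has_contour_integral_lmul has_contour_integral_riesz' assms)
    then have "((\<lambda>z. cinner y (F z (a *\<^sub>C x))) has_contour_integral
      (a * (- two_pi_i * cinner y (riesz_integral F c \<rho> x)))) (circlepath c \<rho>)"
      by (rule has_contour_integral_eq) (use assms(1,3) in \<open>simp add: clinear_opD\<close>)
    from contour_integral_unique[OF this]
      contour_integral_unique[OF has_contour_integral_riesz'[OF assms(1,2), of y "a *\<^sub>C x"]]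
    show "cinner y (riesz_integral F c \<rho> (a *\<^sub>C x)) = cinner y (a *\<^sub>C riesz_integral F c \<rho> x)" by simp
  qed
qed

lemma riesz_integral_commute:
  fixes F :: "complex \<Rightarrow> ('a::chilbert_space \<Rightarrow>\<^sub>L 'a)"
  assumes "\<rho> > 0" "continuous_on (sphere c \<rho>) F" "clinear_op T"
    and "\<And>z. z \<in> sphere c \<rho> \<Longrightarrow> T (F z x) = F z (T x)"
  shows "T (riesz_integral F c \<rho> x) = riesz_integral F c \<rho> (T x)"
proof (rule cinner_eqI)
  fix y
  have "((\<lambda>z. cinner y (F z (T x))) has_contour_integral
      (- two_pi_i * cinner y (T (riesz_integral F c \<rho> x)))) (circlepath c \<rho>)"
    by (rule has_contour_integral_eq[OF has_contour_integral_riesz[OF assms(1-3)]])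
      (use assms(1,4) in simp)
  from contour_integral_unique[OF this]
    contour_integral_unique[OF has_contour_integral_riesz'[OF assms(1,2), of y "T x"]]
  show "cinner y (T (riesz_integral F c \<rho> x)) = cinner y (riesz_integral F c \<rho> (T x))" by simp
qed

section \<open>Cauchy transforms over circles\<close>

definition cauchy_transform :: "complex \<Rightarrow> real \<Rightarrow> (complex \<Rightarrow> complex) \<Rightarrow> complex \<Rightarrow> complex"
  where "cauchy_transform c \<rho> f w = contour_integral (circlepath c \<rho>) (\<lambda>z. f z / (z - w)) / two_pi_i"

lemma has_contour_integral_cauchy_transform:
  assumes "\<rho> > 0" "continuous_on (sphere c \<rho>) f" "w \<notin> sphere c \<rho>"
  shows "((\<lambda>z. f z / (z - w)) has_contour_integral two_pi_i * cauchy_transform c \<rho> f w) (circlepath c \<rho>)"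
proof -
  have "continuous_on (sphere c \<rho>) (\<lambda>z. f z / (z - w))"
    by (intro continuous_intros assms) (use assms(3) in auto)
  then have "(\<lambda>z. f z / (z - w)) contour_integrable_on (circlepath c \<rho>)"
    using assms(1) by (intro contour_integrable_continuous_circlepath) simp
  from has_contour_integral_integral[OF this] show ?thesis by (simp add: cauchy_transform_def)
qed

text \<open>Differentiation under the integral sign, with exponent \<open>1\<close> in the rule for
  Cauchy kernels. It covers both sides of the circle and asks of \<open>f\<close> only continuity on
  the circle.\<close>

lemma cauchy_transform_holomorphic:
  assumes "\<rho> > 0" "continuous_on (sphere c \<rho>) f"
  shows "cauchy_transform c \<rho> f holomorphic_on (- sphere c \<rho>)"
proof -
  define C where "C w = two_pi_i * cauchy_transform c \<rho> f w" for w
  have "\<exists>d. (C has_field_derivative d) (at w)" if "w \<in> - sphere c \<rho>" for w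
  proof -
    have "(C has_field_derivative (of_nat 1 * contour_integral (circlepath c \<rho>) (\<lambda>z. f z / (z - w) ^ Suc 1))) (at w)"
    proof (rule Cauchy_next_derivative(2)[where S = UNIV and B = "cmod (2 * pi * \<i> * \<rho>)"])
      show "continuous_on (path_image (circlepath c \<rho>)) f" using assms by simp
      show "cmod (vector_derivative (circlepath c \<rho>) (at t)) \<le> cmod (2 * pi * \<i> * \<rho>)" for t
        unfolding vector_derivative_circlepath by (simp add: norm_mult norm_exp_eq_Re)
      show "((\<lambda>z. f z / (z - w) ^ 1) has_contour_integral C w) (circlepath c \<rho>)"
        if "w \<in> UNIV - path_image (circlepath c \<rho>)" for w
        using has_contour_integral_cauchy_transform[OF assms, of w] that assms(1) by (simp add: C_def)
    qed (use that assms in auto)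
    then show ?thesis by blast
  qed
  then have "C holomorphic_on (- sphere c \<rho>)"
    by (intro holomorphic_onI) (auto simp: field_differentiable_def intro: has_field_derivative_at_within)
  then have "(\<lambda>w. C w / two_pi_i) holomorphic_on (- sphere c \<rho>)" by (intro holomorphic_intros) auto
  then show ?thesis by (simp add: C_def)
qed

lemma has_contour_integral_inverse_inside:
  assumes "w \<in> ball c \<rho>"
  shows "((\<lambda>z. 1 / (z - w)) has_contour_integral two_pi_i) (circlepath c \<rho>)"
  using Cauchy_integral_circlepath_simple[of "\<lambda>_. 1" c \<rho> w] assms
  by (simp add: dist_norm norm_minus_commute)

lemma has_contour_integral_holomorphic_disc:
  assumes "\<rho> > 0" "f holomorphic_on cball c \<rho>"
  shows "(f has_contour_integral 0) (circlepath c \<rho>)"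
  by (rule Cauchy_theorem_convex_simple[OF assms(2)]) (use assms(1) in \<open>auto simp: sphere_cball\<close>)

lemma has_contour_integral_inverse_outside:
  assumes "\<rho> > 0" "w \<notin> cball c \<rho>"
  shows "((\<lambda>z. 1 / (z - w)) has_contour_integral 0) (circlepath c \<rho>)"
  by (rule has_contour_integral_holomorphic_disc[OF assms(1)])
    (intro holomorphic_intros, use assms(2) in auto)

text \<open>The interface of the Riesz calculus. It is instantiated with the resolvent of
  \<open>H\<close> and, through \<open>X = 0\<close>, with that of \<open>A\<close>.\<close>

locale pseudo_resolvent =
  fixes U :: "complex set" and R :: "complex \<Rightarrow> ('a::chilbert_space \<Rightarrow>\<^sub>L 'a)"
  assumes open_U: "open U" and continuous_R: "continuous_on U R"
    and clinear_R: "\<And>z. z \<in> U \<Longrightarrow> clinear_op (R z)"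
    and resolvent_identity: "\<And>z w x. z \<in> U \<Longrightarrow> w \<in> U \<Longrightarrow> R w x - R z x = (w - z) *\<^sub>C R w (R z x)"
begin

abbreviation "Q \<equiv> riesz_integral R"

lemma continuous_R_sphere: "sphere c \<rho> \<subseteq> U \<Longrightarrow> continuous_on (sphere c \<rho>) R"
  using continuous_R continuous_on_subset by blast

lemma R_commute:
  assumes "z \<in> U" "w \<in> U"
  shows "R w (R z x) = R z (R w x)"
proof (cases "w = z")
  case False
  have "(w - z) *\<^sub>C R w (R z x) = - ((z - w) *\<^sub>C R z (R w x))"
    using resolvent_identity[OF assms] resolvent_identity[OF assms(2,1)] by (metis minus_diff_eq)
  also have "\<dots> = (w - z) *\<^sub>C R z (R w x)"
    by (metis minus_diff_eq scaleC.minus_left)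
  finally show ?thesis using False by simp
qed simp

lemma clinear_Q: "\<rho> > 0 \<Longrightarrow> sphere c \<rho> \<subseteq> U \<Longrightarrow> clinear_op (Q c \<rho>)"
  by (intro riesz_integral_clinear continuous_R_sphere clinear_R) auto

lemma R_Q_commute: "\<rho> > 0 \<Longrightarrow> sphere c \<rho> \<subseteq> U \<Longrightarrow> w \<in> U \<Longrightarrow> R w (Q c \<rho> x) = Q c \<rho> (R w x)"
  by (intro riesz_integral_commute continuous_R_sphere clinear_R R_commute) auto

lemma Q_commute:
  assumes "\<rho> > 0" "sphere c \<rho> \<subseteq> U" "\<rho>' > 0" "sphere c' \<rho>' \<subseteq> U"
  shows "Q c \<rho> (Q c' \<rho>' x) = Q c' \<rho>' (Q c \<rho> x)"
  by (intro riesz_integral_commute continuous_R_sphere clinear_Q R_Q_commute[symmetric] assms)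
    (use assms in auto)

lemma continuous_element: "continuous_on U (\<lambda>z. cinner y (R z x))"
  by (intro cinner.continuous_on continuous_on_const blinfun.continuous_on continuous_R)

lemma holomorphic_element: "(\<lambda>z. cinner y (R z x)) holomorphic_on U"
  unfolding holomorphic_on_def
proof
  fix z assume z: "z \<in> U"
  have ev: "eventually (\<lambda>w. (cinner y (R w x) - cinner y (R z x)) / (w - z) = cinner y (R w (R z x))) (at z)"
  proof -
    have "eventually (\<lambda>w. w \<in> U \<and> w \<noteq> z) (at z)"
      using eventually_at_topological open_U z by blast
    then show ?thesis
    proof eventually_elim
      case (elim w)
      have "cinner y (R w x) - cinner y (R z x) = (w - z) * cinner y (R w (R z x))"
        using resolvent_identity[OF z, of w x] elim by (simp flip: cinner.diff_right)
      then show ?case using elim by simp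
    qed
  qed
  have "((\<lambda>w. cinner y (R w (R z x))) \<longlongrightarrow> cinner y (R z (R z x))) (at z)"
    using continuous_element[of y "R z x"] z open_U by (simp add: continuous_on_eq_continuous_at isCont_def)
  then have "((\<lambda>w. (cinner y (R w x) - cinner y (R z x)) / (w - z)) \<longlongrightarrow> cinner y (R z (R z x))) (at z)"
    using tendsto_cong[OF ev] by blast
  then have "((\<lambda>z. cinner y (R z x)) has_field_derivative cinner y (R z (R z x))) (at z)"
    by (simp add: has_field_derivative_iff)
  then show "(\<lambda>z. cinner y (R z x)) field_differentiable at z within U"
    by (meson field_differentiable_at_within field_differentiable_def)
qed

text \<open>By \<open>G_inside\<close> and \<open>G_outside\<close> this is the matrix element of
  \<open>R w (x - Q x)\<close> inside the circle and of \<open>- R w (Q x)\<close> outside it,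
  wherever \<open>R\<close> is available. On either side it is holomorphic also at the remaining
  points, so it continues these elements across the spectrum.\<close>

definition G where "G c \<rho> x y = cauchy_transform c \<rho> (\<lambda>z. cinner y (R z x))"

lemma G_holomorphic: "\<rho> > 0 \<Longrightarrow> sphere c \<rho> \<subseteq> U \<Longrightarrow> G c \<rho> x y holomorphic_on (- sphere c \<rho>)"
  unfolding G_def by (intro cauchy_transform_holomorphic) (auto intro: continuous_on_subset[OF continuous_element])

text \<open>\<open>n\<close> is the winding number, \<open>1\<close> inside and \<open>0\<close>
  outside. The resolvent identity turns \<open>(R z - R w) / (z - w)\<close> into
  \<open>R w (R z)\<close>, whose integral over \<open>z\<close> is the term with
  \<open>R w (Q x)\<close>.\<close>

lemma has_contour_integral_G:
  assumes "\<rho> > 0" "sphere c \<rho> \<subseteq> U" "w \<in> U" "w \<notin> sphere c \<rho>"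
    and n: "((\<lambda>z. 1 / (z - w)) has_contour_integral two_pi_i * n) (circlepath c \<rho>)"
  shows "n * cinner y (R w x) - cinner y (R w (Q c \<rho> x)) = G c \<rho> x y w"
proof -
  let ?f = "\<lambda>z. cinner y (R z x)"
  have cont: "continuous_on (sphere c \<rho>) ?f" by (rule continuous_on_subset[OF continuous_element assms(2)])
  have "((\<lambda>z. ?f z / (z - w) - ?f w * (1 / (z - w))) has_contour_integral
      (two_pi_i * G c \<rho> x y w - ?f w * (two_pi_i * n))) (circlepath c \<rho>)"
    unfolding G_def by (intro has_contour_integral_diff has_contour_integral_lmul n
        has_contour_integral_cauchy_transform assms cont)
  then have "((\<lambda>z. cinner y (R w (R z x))) has_contour_integral
      (two_pi_i * G c \<rho> x y w - ?f w * (two_pi_i * n))) (circlepath c \<rho>)"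
  proof (rule has_contour_integral_eq)
    fix z assume "z \<in> path_image (circlepath c \<rho>)"
    then have z: "z \<in> sphere c \<rho>" using assms(1) by simp
    then have "z \<in> U" "z \<noteq> w" using assms by auto
    have "?f w - ?f z = (w - z) * cinner y (R w (R z x))"
      using resolvent_identity[OF \<open>z \<in> U\<close> assms(3), of x] by (simp flip: cinner.diff_right)
    then have "?f z - ?f w = (z - w) * cinner y (R w (R z x))" by (simp add: algebra_simps)
    moreover have "?f z / (z - w) - ?f w * (1 / (z - w)) = (?f z - ?f w) / (z - w)"
      by (simp add: diff_divide_distrib)
    ultimately show "?f z / (z - w) - ?f w * (1 / (z - w)) = cinner y (R w (R z x))"
      using \<open>z \<noteq> w\<close> by simp
  qed
  from contour_integral_unique[OF this] contour_integral_unique[OF has_contour_integral_riesz[OF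
        assms(1) continuous_R_sphere[OF assms(2)] clinear_R[OF assms(3)], of y x]]
  have "- two_pi_i * cinner y (R w (Q c \<rho> x)) = two_pi_i * G c \<rho> x y w - ?f w * (two_pi_i * n)" by simp
  then have "two_pi_i * (n * ?f w - cinner y (R w (Q c \<rho> x))) = two_pi_i * G c \<rho> x y w"
    by (simp add: algebra_simps)
  then show ?thesis by (simp del: mult_cancel_left add: mult_left_cancel)
qed

lemma G_inside:
  assumes "\<rho> > 0" "sphere c \<rho> \<subseteq> U" "w \<in> U" "w \<in> ball c \<rho>"
  shows "cinner y (R w (x - Q c \<rho> x)) = G c \<rho> x y w"
  using has_contour_integral_G[OF assms(1-3), of 1 y x] has_contour_integral_inverse_inside[OF assms(4)] assms(4)
  by (simp add: blinfun.diff_right cinner.diff_right)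

lemma G_outside:
  assumes "\<rho> > 0" "sphere c \<rho> \<subseteq> U" "w \<in> U" "w \<notin> cball c \<rho>"
  shows "cinner y (R w (Q c \<rho> x)) = - G c \<rho> x y w"
  using has_contour_integral_G[OF assms(1-3), of 0 y x] has_contour_integral_inverse_outside[OF assms(1,4)] assms(4)
  by (simp add: eq_neg_iff_add_eq_0 neg_eq_iff_add_eq_0 add.commute flip: minus_equation_iff)

text \<open>The product formulas below apply this with \<open>h\<close> a Cauchy transform over the other circle.\<close>

lemma Q_vanish:
  assumes "\<rho> > 0" "sphere c \<rho> \<subseteq> U"
    and h: "\<And>y. \<exists>h. h holomorphic_on cball c \<rho> \<and> (\<forall>w\<in>sphere c \<rho>. cinner y (R w x) = h w)"
  shows "Q c \<rho> x = 0"
proof (rule cinner_eqI)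
  fix y
  obtain h where h: "h holomorphic_on cball c \<rho>" "\<And>w. w \<in> sphere c \<rho> \<Longrightarrow> cinner y (R w x) = h w"
    using h by blast
  have "((\<lambda>w. cinner y (R w x)) has_contour_integral 0) (circlepath c \<rho>)"
    by (rule has_contour_integral_eq[OF has_contour_integral_holomorphic_disc[OF assms(1) h(1)]])
      (use h(2) assms(1) in simp)
  from contour_integral_unique[OF this]
    contour_integral_unique[OF has_contour_integral_riesz'[OF assms(1) continuous_R_sphere[OF assms(2)], of y x]]
  show "cinner y (Q c \<rho> x) = cinner y 0" by simp
qed

lemma Q_disjoint:
  assumes "\<rho> > 0" "sphere c \<rho> \<subseteq> U" "\<rho>' > 0" "sphere c' \<rho>' \<subseteq> U" "cball c \<rho> \<inter> cball c' \<rho>' = {}"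
  shows "Q c \<rho> (Q c' \<rho>' x) = 0"
proof (rule Q_vanish[OF assms(1,2)], intro exI conjI ballI)
  fix y
  have "cball c \<rho> \<subseteq> - sphere c' \<rho>'" using assms(5) by auto
  then have "G c' \<rho>' x y holomorphic_on cball c \<rho>"
    using G_holomorphic[OF assms(3,4)] holomorphic_on_subset by blast
  then show "(\<lambda>w. - G c' \<rho>' x y w) holomorphic_on cball c \<rho>" by (intro holomorphic_intros)
  show "cinner y (R w (Q c' \<rho>' x)) = - G c' \<rho>' x y w" if "w \<in> sphere c \<rho>" for w
  proof (rule G_outside[OF assms(3,4)])
    show "w \<in> U" using that assms(2) by blast
    show "w \<notin> cball c' \<rho>'" using that assms(5) sphere_cball by blast
  qed
qed

lemma Q_nested:
  assumes "\<rho> > 0" "sphere c \<rho> \<subseteq> U" "\<rho>' > 0" "sphere c' \<rho>' \<subseteq> U" "cball c \<rho> \<subseteq> ball c' \<rho>'"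
  shows "Q c \<rho> (Q c' \<rho>' x) = Q c \<rho> x"
proof -
  have "Q c \<rho> (x - Q c' \<rho>' x) = 0"
  proof (rule Q_vanish[OF assms(1,2)], intro exI conjI ballI)
    fix y
    have "cball c \<rho> \<subseteq> - sphere c' \<rho>'" using assms(5) by auto
    then show "G c' \<rho>' x y holomorphic_on cball c \<rho>"
      using G_holomorphic[OF assms(3,4)] holomorphic_on_subset by blast
    show "cinner y (R w (x - Q c' \<rho>' x)) = G c' \<rho>' x y w" if "w \<in> sphere c \<rho>" for w
    proof (rule G_inside[OF assms(3,4)])
      show "w \<in> U" using that assms(2) by blast
      show "w \<in> ball c' \<rho>'" using that assms(5) sphere_cball by blast
    qed
  qed
  then show ?thesis by (simp add: blinfun.diff_right)
qed

text \<open>On each inner disc, \<open>R w (x - (\<Sum>j\<in>J. Q j x))\<close> continues to the sum of the Cauchy transforms, so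
  that it is holomorphic inside the big circle.\<close>

lemma Q_gather:
  assumes \<rho>: "\<rho> > 0" "sphere c \<rho> \<subseteq> U" and J: "finite J"
    and \<rho>j: "\<And>j. j \<in> J \<Longrightarrow> \<rho>j j > 0" "\<And>j. j \<in> J \<Longrightarrow> sphere (cj j) (\<rho>j j) \<subseteq> U"
      "\<And>j. j \<in> J \<Longrightarrow> cball (cj j) (\<rho>j j) \<subseteq> ball c \<rho>"
    and disj: "\<And>i j. i \<in> J \<Longrightarrow> j \<in> J \<Longrightarrow> i \<noteq> j \<Longrightarrow> cball (cj i) (\<rho>j i) \<inter> cball (cj j) (\<rho>j j) = {}"
    and cover: "cball c \<rho> \<subseteq> U \<union> (\<Union>j\<in>J. ball (cj j) (\<rho>j j))"
  shows "Q c \<rho> x = (\<Sum>j\<in>J. Q (cj j) (\<rho>j j) x)"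
proof -
  define x' where "x' = x - (\<Sum>j\<in>J. Q (cj j) (\<rho>j j) x)"
  have "Q c \<rho> x' = 0"
  proof (rule Q_vanish[OF \<rho>])
    fix y
    define V where "V = (\<Union>j\<in>J. ball (cj j) (\<rho>j j))"
    define S where "S w = (\<Sum>j\<in>J. G (cj j) (\<rho>j j) x y w)" for w
    define h where "h w = (if w \<in> V then S w else cinner y (R w x'))" for w
    have "open V" unfolding V_def by auto
    have S: "cinner y (R w x') = S w" if w: "w \<in> U" "w \<in> ball (cj i) (\<rho>j i)" and i: "i \<in> J" for w i
    proof -
      have "cinner y (R w (Q (cj j) (\<rho>j j) x)) = - G (cj j) (\<rho>j j) x y w" if "j \<in> J - {i}" for j
      proof (rule G_outside)
        show "w \<notin> cball (cj j) (\<rho>j j)" using disj[of i j] that i w(2) ball_subset_cball by blast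
      qed (use that \<rho>j w in auto)
      then have "(\<Sum>j\<in>J - {i}. cinner y (R w (Q (cj j) (\<rho>j j) x))) = - (\<Sum>j\<in>J - {i}. G (cj j) (\<rho>j j) x y w)"
        by (simp add: sum_negf)
      moreover have "cinner y (R w x) - cinner y (R w (Q (cj i) (\<rho>j i) x)) = G (cj i) (\<rho>j i) x y w"
        using G_inside[OF \<rho>j(1,2)[OF i] w] by (simp add: blinfun.diff_right cinner.diff_right)
      moreover have "cinner y (R w x') = cinner y (R w x) - (\<Sum>j\<in>J. cinner y (R w (Q (cj j) (\<rho>j j) x)))"
        by (simp add: x'_def blinfun.diff_right cinner.diff_right blinfun.sum_right cinner.sum_right)
      ultimately show ?thesis by (simp add: S_def sum.remove[OF J i])
    qed
    have hU: "h w = cinner y (R w x')" if "w \<in> U" for w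
      using S[OF that] by (auto simp: h_def V_def)
    have "h holomorphic_on U"
      using holomorphic_element by (rule holomorphic_transform) (simp add: hU)
    moreover have "h holomorphic_on V"
    proof -
      have "S holomorphic_on V"
        unfolding S_def
      proof (intro holomorphic_intros)
        fix j assume j: "j \<in> J"
        have "V \<subseteq> - sphere (cj j) (\<rho>j j)"
        proof
          fix w assume "w \<in> V"
          then obtain i where i: "i \<in> J" "w \<in> ball (cj i) (\<rho>j i)" unfolding V_def by blast
          show "w \<in> - sphere (cj j) (\<rho>j j)"
          proof (cases "i = j")
            case False
            then have "w \<notin> cball (cj j) (\<rho>j j)" using disj[of i j] i j ball_subset_cball by blast
            then show ?thesis using sphere_cball by blast
          qed (use i in auto)
        qed
        then show "G (cj j) (\<rho>j j) x y holomorphic_on V"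
          using G_holomorphic[OF \<rho>j(1,2)[OF j]] holomorphic_on_subset by blast
      qed
      then show ?thesis by (rule holomorphic_transform) (simp add: h_def)
    qed
    ultimately have "h holomorphic_on (U \<union> V)" using open_U \<open>open V\<close> by (rule holomorphic_on_Un)
    then have "h holomorphic_on cball c \<rho>" using cover by (auto simp: V_def intro: holomorphic_on_subset)
    moreover have "\<forall>w\<in>sphere c \<rho>. cinner y (R w x') = h w" using hU \<rho>(2) by auto
    ultimately show "\<exists>h. h holomorphic_on cball c \<rho> \<and> (\<forall>w\<in>sphere c \<rho>. cinner y (R w x') = h w)" by blast
  qed
  \<comment> \<open>Splitting \<open>x'\<close> leaves the products of the big projection with the
    small ones. By commutation and nesting each of them is the small projection itself.\<close>
  then have "Q c \<rho> x = (\<Sum>j\<in>J. Q c \<rho> (Q (cj j) (\<rho>j j) x))"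
    by (simp add: x'_def blinfun.diff_right blinfun.sum_right)
  also have "\<dots> = (\<Sum>j\<in>J. Q (cj j) (\<rho>j j) x)"
    by (intro sum.cong refl) (simp add: Q_commute[OF \<rho> \<rho>j(1,2)] Q_nested[OF \<rho>j(1,2) \<rho> \<rho>j(3)])
  finally show ?thesis .
qed

text \<open>A circle is not nested in itself. Shrinking it within the annulus does not change the
  projection, by \<open>Q_gather\<close> with a single inner disc, and then \<open>Q_nested\<close>
  applies.\<close>

lemma Q_idem:
  assumes "0 < \<rho>'" "\<rho>' < \<rho>" "cball c \<rho> - ball c \<rho>' \<subseteq> U"
  shows "Q c \<rho> (Q c \<rho> x) = Q c \<rho> x"
proof -
  have s: "sphere c \<rho> \<subseteq> U" "sphere c \<rho>' \<subseteq> U" using assms by (auto simp: subset_iff)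
  have sub: "cball c \<rho>' \<subseteq> ball c \<rho>" using assms by auto
  have eq: "Q c \<rho> x = Q c \<rho>' x" for x
    using Q_gather[of \<rho> c "{()}" "\<lambda>_. \<rho>'" "\<lambda>_. c" x] assms s sub by auto
  have "Q c \<rho>' (Q c \<rho> x) = Q c \<rho>' x" by (rule Q_nested) (use assms s sub in auto)
  then show ?thesis by (simp flip: eq)
qed

end

context perturbed_operator
begin

lemma open_U: "open U"
proof -
  have "U = {z. norm X < dist_spec z}" by (rule U_def)
  then show ?thesis by (auto intro!: open_Collect_less continuous_intros)
qed

lemma resolvent_H_lipschitz:
  assumes "z \<in> U" "w \<in> U"
  shows "norm (resolvent H w - resolvent H z) \<le> cmod (w - z) * (norm (resolvent H w) * norm (resolvent H z))"
proof (rule norm_blinfun_bound)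
  show "norm ((resolvent H w - resolvent H z) x)
      \<le> cmod (w - z) * (norm (resolvent H w) * norm (resolvent H z)) * norm x" for x
  proof -
    have "norm ((resolvent H w - resolvent H z) x) = cmod (w - z) * norm (resolvent H w (resolvent H z x))"
      using is_resolvent_identity[OF linear_graph_H resolvent_H(1)[OF assms(1)] resolvent_H(1)[OF assms(2)]]
      by (simp add: blinfun.diff_left)
    also have "norm (resolvent H w (resolvent H z x)) \<le> norm (resolvent H w) * (norm (resolvent H z) * norm x)"
      by (rule order_trans[OF norm_blinfun]) (intro mult_left_mono norm_blinfun norm_ge_zero)
    finally show ?thesis by (simp add: mult_left_mono mult.assoc)
  qed
qed auto

sublocale pseudo_resolvent U "resolvent H"
proof
  show "open U" by (rule open_U)
  show "clinear_op (resolvent H z)" if "z \<in> U" for z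
    by (rule is_resolvent_clinear[OF linear_graph_H resolvent_H(1)[OF that]])
  show "resolvent H w x - resolvent H z x = (w - z) *\<^sub>C resolvent H w (resolvent H z x)"
    if "z \<in> U" "w \<in> U" for z w x
    by (rule is_resolvent_identity[OF linear_graph_H resolvent_H(1)[OF that(1)] resolvent_H(1)[OF that(2)]])
  show "continuous_on U (resolvent H)"
    unfolding continuous_on_def
  proof
    fix z assume z: "z \<in> U"
    define d where "d w = infdist w (complex_of_real ` \<Lambda>) - norm X" for w
    have d: "d z > 0" using z by (simp add: d_def U_def)
    have "((\<lambda>w. cmod (w - z) * (1 / d w * (1 / d z))) \<longlongrightarrow> cmod (z - z) * (1 / d z * (1 / d z))) (at z within U)"
      unfolding d_def by (intro tendsto_intros) (use d in \<open>auto simp: d_def\<close>)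
    then have lim: "((\<lambda>w. cmod (w - z) * (1 / d w * (1 / d z))) \<longlongrightarrow> 0) (at z within U)" by simp
    have "((\<lambda>w. resolvent H w - resolvent H z) \<longlongrightarrow> 0) (at z within U)"
    proof (rule Lim_null_comparison[OF _ lim])
      show "\<forall>\<^sub>F w in at z within U. norm (resolvent H w - resolvent H z) \<le> cmod (w - z) * (1 / d w * (1 / d z))"
        unfolding eventually_at_filter
      proof (rule always_eventually, safe)
        fix w assume w: "w \<in> U"
        have "norm (resolvent H w) * norm (resolvent H z) \<le> 1 / d w * (1 / d z)"
          using resolvent_H(2)[OF z] resolvent_H(2)[OF w] w
          by (intro mult_mono) (auto simp: d_def U_def)
        then show "norm (resolvent H w - resolvent H z) \<le> cmod (w - z) * (1 / d w * (1 / d z))"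
          by (intro order_trans[OF resolvent_H_lipschitz[OF z w]] mult_left_mono) auto
      qed
    qed
    then show "(resolvent H \<longlongrightarrow> resolvent H z) (at z within U)" by (simp add: LIM_zero_iff)
  qed
qed

end

subsection \<open>Circles through the spectral gaps\<close>

text \<open>By concavity the sine lies above its chord over the first quarter period.\<close>

lemma jordan_sine_bound:
  assumes "0 \<le> t" "t \<le> 1"
  shows "t \<le> sin (t * (pi / 2))"
proof -
  have "concave_on {0..pi} sin"
    by (rule f''_le0_imp_concave[where f' = cos and f'' = "\<lambda>x. - sin x"])
      (auto intro!: derivative_eq_intros sin_ge_zero)
  from concave_onD[OF this assms, of 0 "pi / 2"] show ?thesis using pi_gt_zero by simp
qed

text \<open>The points \<open>0\<close>, \<open>1/2\<close>, \<open>1\<close> are the zeros of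
  \<open>sin (2 * pi * t)\<close> in the unit interval. In each quarter of it Jordan's inequality is
  used at the nearest zero.\<close>

lemma sine_lower_bound:
  assumes "0 \<le> t" "t \<le> 1"
  shows "\<exists>k\<in>{0, 1/2, 1}. (4 * (t - k))\<^sup>2 \<le> (sin (2 * pi * t))\<^sup>2"
proof -
  have sq: "a\<^sup>2 \<le> b\<^sup>2" if "\<bar>a\<bar> \<le> \<bar>b\<bar>" for a b :: real using that by (simp add: abs_le_square_iff)
  consider "t \<le> 1/4" | "1/4 \<le> t" "t \<le> 1/2" | "1/2 \<le> t" "t \<le> 3/4" | "3/4 \<le> t" by linarith
  then show ?thesis
  proof cases
    case 1
    have "4 * t \<le> sin (4 * t * (pi / 2))" using 1 assms by (intro jordan_sine_bound) auto
    also have "4 * t * (pi / 2) = 2 * pi * t" by simp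
    finally show ?thesis using assms by (intro bexI[of _ 0] sq) auto
  next
    case 2
    have "2 - 4 * t \<le> sin ((2 - 4 * t) * (pi / 2))" using 2 by (intro jordan_sine_bound) auto
    also have "(2 - 4 * t) * (pi / 2) = pi - 2 * pi * t" by (simp add: algebra_simps)
    finally show ?thesis using 2 by (intro bexI[of _ "1/2"] sq) auto
  next
    case 3
    have "4 * t - 2 \<le> sin ((4 * t - 2) * (pi / 2))" using 3 by (intro jordan_sine_bound) auto
    also have "(4 * t - 2) * (pi / 2) = 2 * pi * t - pi" by (simp add: algebra_simps)
    also have "sin (2 * pi * t - pi) = - sin (2 * pi * t)" by (simp add: sin_diff)
    finally show ?thesis using 3 by (intro bexI[of _ "1/2"] sq) auto
  next
    case 4
    have "4 - 4 * t \<le> sin ((4 - 4 * t) * (pi / 2))" using 4 assms by (intro jordan_sine_bound) auto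
    also have "(4 - 4 * t) * (pi / 2) = 2 * pi - 2 * pi * t" by (simp add: algebra_simps)
    also have "sin (2 * pi - 2 * pi * t) = - sin (2 * pi * t)" by (simp add: sin_diff)
    finally show ?thesis using assms by (intro bexI[of _ 1] sq) auto
  qed
qed

lemma has_integral_lorentzian:
  assumes "R > 0" "s > 0"
  shows "((\<lambda>t. R / (s\<^sup>2 + (R * (4 * (t - k)))\<^sup>2)) has_integral
    (arctan (4 * R * (1 - k) / s) / (4 * s) - arctan (4 * R * (0 - k) / s) / (4 * s))) {0..1}"
proof (rule fundamental_theorem_of_calculus)
  fix t :: real
  have "((\<lambda>t. arctan (4 * R * (t - k) / s) / (4 * s)) has_real_derivative
      (4 * R / s) / (1 + (4 * R * (t - k) / s)\<^sup>2) / (4 * s)) (at t)"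
  proof -
    have "((\<lambda>t. 4 * R * (t - k) / s) has_real_derivative 4 * R / s) (at t)"
      using assms by (auto intro!: derivative_eq_intros)
    from DERIV_cdivide[OF DERIV_arctan[THEN DERIV_chain2, OF this], of "4 * s"]
    show ?thesis by (simp add: field_simps)
  qed
  also have "(4 * R / s) / (1 + (4 * R * (t - k) / s)\<^sup>2) / (4 * s) = R / (s\<^sup>2 + (R * (4 * (t - k)))\<^sup>2)"
  proof -
    have e: "4 * R * (t - k) = R * (4 * (t - k))" by simp
    have "1 + (4 * R * (t - k) / s)\<^sup>2 = (s\<^sup>2 + (R * (4 * (t - k)))\<^sup>2) / s\<^sup>2"
      unfolding e using assms by (simp add: power_divide add_divide_distrib)
    then show ?thesis using assms by (simp add: power2_eq_square)
  qed
  finally show "((\<lambda>t. arctan (4 * R * (t - k) / s) / (4 * s)) has_vector_derivative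
      R / (s\<^sup>2 + (R * (4 * (t - k)))\<^sup>2)) (at t within {0..1})"
    by (simp add: has_real_derivative_iff_has_vector_derivative has_vector_derivative_at_within)
qed simp

text \<open>The circle is long, of length \<open>2 * pi * R\<close>, but the bound on the integrand exceeds \<open>K / (2 * s\<^sup>2)\<close>
  only on arcs of length of the order of \<open>s\<close>. The sine is replaced by the distance to its zeros.\<close>

lemma contour_integral_circle_bound:
  assumes f: "(f has_contour_integral I) (circlepath c R)"
    and R: "R > 0" and s: "s > 0" and K: "K \<ge> 0"
    and le: "\<And>t. 0 \<le> t \<Longrightarrow> t \<le> 1 \<Longrightarrow>
      cmod (f (circlepath c R t)) \<le> K / (s\<^sup>2 + (R * sin (2 * pi * t))\<^sup>2)"
  shows "cmod I \<le> (3 * pi\<^sup>2 / 2) * K / s"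
proof -
  define L where "L k t = R / (s\<^sup>2 + (R * (4 * (t - k)))\<^sup>2)" for k t :: real
  have int: "L k integrable_on {0..1}" "integral {0..1} (L k) \<le> pi / (4 * s)" for k
  proof -
    note h = has_integral_lorentzian[OF R s, of k, folded L_def]
    from h have h: "(L k has_integral (arctan (4 * R * (1 - k) / s) / (4 * s) - arctan (4 * R * (0 - k) / s) / (4 * s))) {0..1}"
      unfolding L_def .
    then show "L k integrable_on {0..1}" by blast
    \<comment> \<open>The range of the arctangent has length \<open>pi\<close>, which makes the
      bound independent of \<open>R\<close>, that is, of the length of the circle.\<close>
    have "arctan (4 * R * (1 - k) / s) - arctan (4 * R * (0 - k) / s) \<le> pi"
      using arctan_ubound[of "4 * R * (1 - k) / s"] arctan_lbound[of "4 * R * (0 - k) / s"] by linarith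
    then show "integral {0..1} (L k) \<le> pi / (4 * s)"
      using s by (simp add: integral_unique[OF h] divide_right_mono flip: diff_divide_distrib)
  qed
  have L0: "L k t \<ge> 0" for k t using R by (simp add: L_def)
  \<comment> \<open>One summand for each zero of the sine, since the nearest zero depends on
    \<open>t\<close>. The factor \<open>2 * pi\<close>, with the \<open>R\<close> inside
    \<open>L\<close>, is the speed of the parametrization; three integrals of at most
    \<open>pi / (4 * s)\<close> give the constant.\<close>
  define g where "g t = 2 * pi * K * (L 0 t + L (1/2) t + L 1 t)" for t
  have g: "g integrable_on {0..1}"
    unfolding g_def by (intro integrable_on_mult_right integrable_add int)
  have "integral {0..1} g = 2 * pi * K * (integral {0..1} (L 0) + integral {0..1} (L (1/2)) + integral {0..1} (L 1))"
    unfolding g_def by (simp add: integral_add integrable_add int)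
  also have "\<dots> \<le> 2 * pi * K * (pi / (4 * s) + pi / (4 * s) + pi / (4 * s))"
    using K by (intro mult_left_mono add_mono int) auto
  also have "\<dots> = (3 * pi\<^sup>2 / 2) * K / s" by (simp add: power2_eq_square field_simps)
  finally have g_le: "integral {0..1} g \<le> (3 * pi\<^sup>2 / 2) * K / s" .
  have h: "((\<lambda>t. f (circlepath c R t) * vector_derivative (circlepath c R) (at t)) has_integral I) {0..1}"
    using f by (simp add: has_contour_integral)
  have "cmod I = cmod (integral {0..1} (\<lambda>t. f (circlepath c R t) * vector_derivative (circlepath c R) (at t)))"
    by (simp add: integral_unique[OF h])
  also have "\<dots> \<le> integral {0..1} g"
  proof (rule integral_norm_bound_integral[OF has_integral_integrable[OF h] g])
    fix t :: real assume t: "t \<in> {0..1}"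
    obtain k where k: "k \<in> {0, 1/2, 1}" "(4 * (t - k))\<^sup>2 \<le> (sin (2 * pi * t))\<^sup>2"
      using sine_lower_bound t by (metis atLeastAtMost_iff)
    have "(R * (4 * (t - k)))\<^sup>2 \<le> (R * sin (2 * pi * t))\<^sup>2"
      using k(2) by (simp only: power_mult_distrib[of R]) (rule mult_left_mono, auto)
    then have "R / (s\<^sup>2 + (R * sin (2 * pi * t))\<^sup>2) \<le> L k t"
      unfolding L_def using R s by (intro divide_left_mono add_left_mono mult_pos_pos)
        (auto intro: add_pos_nonneg)
    also have "\<dots> \<le> L 0 t + L (1/2) t + L 1 t"
    proof -
      from k(1) consider "k = 0" | "k = 1/2" | "k = 1" by blast
      then show ?thesis
      proof cases
        case 2
        then have "L k t = L (1/2) t" by (rule arg_cong)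
        then show ?thesis using L0[of 0 t] L0[of 1 t] by linarith
      qed (use L0[of 0 t] L0[of "1/2" t] L0[of 1 t] in simp_all)
    qed
    finally have Lk: "R / (s\<^sup>2 + (R * sin (2 * pi * t))\<^sup>2) \<le> L 0 t + L (1/2) t + L 1 t" .
    have "cmod (f (circlepath c R t) * vector_derivative (circlepath c R) (at t))
        = cmod (f (circlepath c R t)) * (2 * pi * R)"
      unfolding vector_derivative_circlepath using R by (simp add: norm_mult norm_exp_eq_Re)
    also have "\<dots> \<le> K / (s\<^sup>2 + (R * sin (2 * pi * t))\<^sup>2) * (2 * pi * R)"
      using t R by (intro mult_right_mono le) auto
    also have "\<dots> = 2 * pi * K * (R / (s\<^sup>2 + (R * sin (2 * pi * t))\<^sup>2))" by simp
    also have "\<dots> \<le> g t" unfolding g_def using K by (intro mult_left_mono Lk) auto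
    finally show "cmod (f (circlepath c R t) * vector_derivative (circlepath c R) (at t)) \<le> g t" .
  qed
  finally show ?thesis using g_le by simp
qed

section \<open>Geometry of the block circles and of the big circles\<close>

lemma Im_circlepath: "Im (circlepath (complex_of_real a) R t) = R * sin (2 * pi * t)"
  by (simp add: circlepath_def part_circlepath_def linepath_def Im_exp algebra_simps)

lemma cball_subset_ball:
  fixes a b :: "'m::metric_space"
  assumes "dist a b + p < q"
  shows "cball a p \<subseteq> ball b q"
proof
  fix x assume "x \<in> cball a p"
  then show "x \<in> ball b q" using assms dist_triangle[of b x a] by (simp add: dist_commute)
qed

lemma cball_disjoint:
  fixes a b :: "'m::metric_space"
  assumes "p + q < dist a b"
  shows "cball a p \<inter> cball b q = {}"
proof -
  have "False" if "x \<in> cball a p" "x \<in> cball b q" for x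
    using assms dist_triangle2[of a b x] that by simp
  then show ?thesis by blast
qed

lemma norm_le_cinnerI:
  assumes "\<And>y. cmod (cinner y v) \<le> K * norm y" "K \<ge> 0"
  shows "norm v \<le> K"
proof (cases "v = 0")
  case False
  have "norm v * norm v \<le> K * norm v"
    using assms(1)[of v] norm_sq_cinner[of v] by (simp add: power2_eq_square)
  then show ?thesis using False by simp
qed (use assms in simp)

locale block_circles = perturbed_operator A "lam ` {1..}" X
  for A :: "'a::chilbert_space graph" and lam :: "nat \<Rightarrow> real" and X +
  fixes r :: real and i0 :: nat
  assumes lam_mono: "strict_mono_on {1..} lam" and i0: "2 \<le> i0"
    and gap: "\<And>i. i0 \<le> i \<Longrightarrow> 2 * r < lam i - lam (i - 1)"
    and X_small: "norm X < r"
begin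

text \<open>Together with \<open>rad\<close>, the disc whose diameter is the interval from
  \<open>lam a\<close> to \<open>lam b\<close> extended by \<open>q\<close> at both ends. The circle
  around a single eigenvalue is the case \<open>a = b\<close>.\<close>

definition ctr :: "nat \<Rightarrow> nat \<Rightarrow> complex" where "ctr a b = complex_of_real ((lam a + lam b) / 2)"
definition rad :: "nat \<Rightarrow> nat \<Rightarrow> real \<Rightarrow> real" where "rad a b q = (lam b - lam a) / 2 + q"
text \<open>Block \<open>0\<close> gathers the eigenvalues with indices \<open>1\<close> to
  \<open>i0 - 1\<close>; block \<open>k > 0\<close> consists of the single index
  \<open>i0 + k - 1\<close>. The subtraction does not truncate, because
  \<open>2 \<le> i0\<close>.\<close>

definition last_of :: "nat \<Rightarrow> nat" where "last_of k = i0 + k - 1"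
definition first_of :: "nat \<Rightarrow> nat" where "first_of k = (if k = 0 then 1 else last_of k)"
definition half_gap :: "nat \<Rightarrow> real" where "half_gap n = (lam (Suc n) - lam n) / 2"

abbreviation "bctr k \<equiv> ctr (first_of k) (last_of k)"
abbreviation "brad k \<equiv> rad (first_of k) (last_of k)"
text \<open>With this radius the circle meets the real axis at the midpoint of the gap above
  \<open>lam n\<close> and, on the left, at the same distance below \<open>lam 1\<close>.\<close>

abbreviation "big_rad n \<equiv> rad 1 n (half_gap n)"

abbreviation Qblock :: "nat \<Rightarrow> ('a \<Rightarrow>\<^sub>L 'a)"
  where "Qblock k \<equiv> Q (bctr k) (brad k r)"

abbreviation Qbig :: "nat \<Rightarrow> ('a \<Rightarrow>\<^sub>L 'a)"
  where "Qbig n \<equiv> Q (ctr 1 n) (big_rad n)"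

lemma r_pos: "r > 0" using X_small norm_ge_zero[of X] by linarith

lemma lam_le: "1 \<le> i \<Longrightarrow> i \<le> j \<Longrightarrow> lam i \<le> lam j"
  using strict_mono_on_leD[OF lam_mono, of i j] by simp

lemma lam_less: "1 \<le> i \<Longrightarrow> i < j \<Longrightarrow> lam i < lam j"
  using strict_mono_onD[OF lam_mono, of i j] by simp

lemma first_last: "1 \<le> first_of k" "first_of k \<le> last_of k" "1 \<le> last_of k"
  using i0 by (auto simp: first_of_def last_of_def)

lemma half_gap_pos: "1 \<le> n \<Longrightarrow> half_gap n > 0"
  using lam_less[of n "Suc n"] by (simp add: half_gap_def)

lemma half_gap_last: "r < half_gap (last_of k)"
  using gap[of "Suc (last_of k)"] i0 by (simp add: half_gap_def last_of_def)

lemma rad_ge: "1 \<le> a \<Longrightarrow> a \<le> b \<Longrightarrow> q \<le> rad a b q"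
  using lam_le[of a b] by (simp add: rad_def)

lemma away_outside:
  assumes "z \<notin> ball (ctr a b) (rad a b q)" "1 \<le> a" "a \<le> i" "i \<le> b"
  shows "q \<le> cmod (z - complex_of_real (lam i))"
proof -
  have "rad a b q \<le> dist (ctr a b) z" using assms(1) by simp
  also have "\<dots> \<le> dist (ctr a b) (complex_of_real (lam i)) + cmod (z - complex_of_real (lam i))"
    using dist_triangle[of "ctr a b" z "complex_of_real (lam i)"] by (simp add: dist_norm norm_minus_commute)
  also have "dist (ctr a b) (complex_of_real (lam i)) = \<bar>(lam a + lam b) / 2 - lam i\<bar>"
    by (simp only: ctr_def dist_of_real dist_real_def)
  also have "\<dots> \<le> (lam b - lam a) / 2" using lam_le[of a i] lam_le[of i b] assms by (simp add: abs_le_iff field_simps)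
  finally show ?thesis by (simp add: rad_def)
qed

lemma away_inside:
  assumes "z \<in> cball (ctr a n) (rad a n (half_gap n))" "1 \<le> n" "n < i"
  shows "half_gap n \<le> cmod (z - complex_of_real (lam i))"
proof -
  have "dist (ctr a n) (complex_of_real (lam i)) \<le> rad a n (half_gap n) + cmod (z - complex_of_real (lam i))"
    using dist_triangle[of "ctr a n" "complex_of_real (lam i)" z] assms(1) by (simp add: dist_norm norm_minus_commute)
  moreover have "dist (ctr a n) (complex_of_real (lam i)) = \<bar>(lam a + lam n) / 2 - lam i\<bar>"
    by (simp only: ctr_def dist_of_real dist_real_def)
  moreover have "lam (Suc n) \<le> lam i" using assms by (intro lam_le) auto
  moreover have "lam i - (lam a + lam n) / 2 \<le> \<bar>(lam a + lam n) / 2 - lam i\<bar>" by linarith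
  ultimately show ?thesis by (simp only: rad_def half_gap_def diff_divide_distrib add_divide_distrib)
qed

lemma infdist_geI:
  assumes "\<And>i. 1 \<le> i \<Longrightarrow> d \<le> cmod (z - complex_of_real (lam i))"
  shows "d \<le> dist_spec z"
  unfolding infdist_def using assms by (auto simp: dist_norm intro!: cINF_greatest)

lemma in_U_I:
  assumes "norm X < d" "\<And>i. 1 \<le> i \<Longrightarrow> d \<le> cmod (z - complex_of_real (lam i))"
  shows "z \<in> U"
  using infdist_geI[of d z] assms unfolding U_def by fastforce

text \<open>The widths \<open>q k\<close> may differ from block to block. Taking all of them to be
  \<open>r\<close> gives the covering for \<open>Q_gather\<close>; a smaller width at one block
  gives the annulus for \<open>Q_idem\<close>. The room between \<open>norm X\<close> and
  \<open>r\<close> allows both.\<close>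

lemma covered:
  assumes q: "norm X < p" "p \<le> r" "\<And>k. k \<le> j \<Longrightarrow> p \<le> q k"
    and z: "z \<in> cball (ctr 1 (last_of j)) (big_rad (last_of j))"
      "\<And>k. k \<le> j \<Longrightarrow> z \<notin> ball (bctr k) (brad k (q k))"
  shows "z \<in> U"
proof (rule in_U_I[OF q(1)])
  fix i :: nat assume i: "1 \<le> i"
  show "p \<le> cmod (z - complex_of_real (lam i))"
  proof (cases "i \<le> last_of j")
    case True
    \<comment> \<open>The block that contains the index \<open>i\<close>, the inverse of
      \<open>last_of\<close> for indices from \<open>i0\<close> on.\<close>
    define k where "k = (if i < i0 then 0 else i + 1 - i0)"
    have k: "k \<le> j" "first_of k \<le> i" "i \<le> last_of k"
      using True i i0 by (auto simp: k_def first_of_def last_of_def)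
    show ?thesis using away_outside[OF z(2)[OF k(1)] first_last(1) k(2,3)] q(3)[OF k(1)] by simp
  next
    case False
    have "half_gap (last_of j) \<le> cmod (z - complex_of_real (lam i))"
      using away_inside[OF z(1) first_last(3)] False by simp
    then show ?thesis using half_gap_last[of j] q(2) by simp
  qed
qed

text \<open>Only block \<open>0\<close> can contain several eigenvalues. The later block thus has a
  single one, and the gap below it, longer than \<open>2 * r\<close>, separates the discs.\<close>

lemma blocks_disjoint_less:
  assumes "k < k'"
  shows "cball (bctr k) (brad k r) \<inter>
    cball (bctr k') (brad k' r) = {}"
proof (rule cball_disjoint)
  have e: "first_of k' = last_of k'" "last_of k \<le> last_of k' - 1" using assms by (auto simp: first_of_def last_of_def)
  have "lam (last_of k) \<le> lam (last_of k' - 1)" by (intro lam_le e first_last)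
  moreover have "2 * r < lam (last_of k') - lam (last_of k' - 1)"
    using assms by (intro gap) (auto simp: last_of_def)
  ultimately have g: "lam (last_of k) + 2 * r < lam (last_of k')" by linarith
  have "dist (bctr k) (bctr k') =
      \<bar>(lam (first_of k) + lam (last_of k)) / 2 - (lam (last_of k') + lam (last_of k')) / 2\<bar>"
    by (simp only: e(1) ctr_def dist_of_real dist_real_def)
  then show "brad k r + brad k' r
      < dist (bctr k) (bctr k')"
    using g by (simp add: rad_def e field_simps abs_if)
qed

lemma blocks_disjoint:
  "k \<noteq> k' \<Longrightarrow> cball (bctr k) (brad k r) \<inter>
    cball (bctr k') (brad k' r) = {}"
  using blocks_disjoint_less[of k k'] blocks_disjoint_less[of k' k] by (cases "k < k'") (auto simp: Int_commute)

lemma block_nested: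
  assumes "k \<le> j"
  shows "cball (bctr k) (brad k r)
    \<subseteq> ball (ctr 1 (last_of j)) (big_rad (last_of j))"
proof (rule cball_subset_ball)
  have "last_of k \<le> last_of j" using assms by (simp add: last_of_def)
  then have "lam (last_of k) \<le> lam (last_of j)" by (intro lam_le first_last)
  moreover have "lam 1 \<le> lam (first_of k)" by (intro lam_le first_last) simp
  moreover have "r < half_gap (last_of j)" by (rule half_gap_last)
  moreover have "dist (bctr k) (ctr 1 (last_of j)) =
      \<bar>(lam (first_of k) + lam (last_of k)) / 2 - (lam 1 + lam (last_of j)) / 2\<bar>"
    by (simp only: ctr_def dist_of_real dist_real_def)
  ultimately show "dist (bctr k) (ctr 1 (last_of j)) + brad k r
      < big_rad (last_of j)"
    by (simp add: rad_def field_simps abs_if)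
qed

lemma block_rad_pos: "brad k r > 0"
  using rad_ge[OF first_last(1,2), of r k] r_pos by linarith

lemma big_rad_pos: "1 \<le> n \<Longrightarrow> big_rad n > 0"
  using rad_ge[of 1 n "half_gap n"] half_gap_pos[of n] by simp

lemma block_annulus:
  assumes "norm X < p" "p \<le> r"
  shows "cball (bctr k) (brad k r) -
    ball (bctr k) (brad k p) \<subseteq> U"
proof
  fix z assume z: "z \<in> cball (bctr k) (brad k r) -
    ball (bctr k) (brad k p)"
  show "z \<in> U"
  proof (rule covered[OF assms, of k "\<lambda>k'. if k' = k then p else r"])
    show "z \<in> cball (ctr 1 (last_of k)) (big_rad (last_of k))"
      using block_nested[of k k] z ball_subset_cball by blast
    show "z \<notin> ball (bctr k') (brad k' (if k' = k then p else r))" for k'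
      using z blocks_disjoint[of k k'] ball_subset_cball by (cases "k' = k") auto
  qed (use assms in auto)
qed

lemma block_sphere: "sphere (bctr k) (brad k r) \<subseteq> U"
  using block_annulus[OF X_small, of k] by auto

lemma big_sphere:
  assumes "1 \<le> n" "norm X < half_gap n"
  shows "sphere (ctr 1 n) (big_rad n) \<subseteq> U"
proof
  fix z assume z: "z \<in> sphere (ctr 1 n) (big_rad n)"
  show "z \<in> U"
  proof (rule in_U_I[OF assms(2)])
    fix i :: nat assume "1 \<le> i"
    then show "half_gap n \<le> cmod (z - complex_of_real (lam i))"
      using away_outside[of z 1 n "half_gap n" i] away_inside[of z 1 n i] z assms(1) by (cases "i \<le> n") auto
  qed
qed

lemma big_sphere_last: "sphere (ctr 1 (last_of j)) (big_rad (last_of j)) \<subseteq> U"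
  using half_gap_last[of j] X_small by (intro big_sphere first_last) simp

lemma Qblock_clinear: "clinear_op (Qblock k)"
  by (rule clinear_Q[OF block_rad_pos block_sphere])

lemma Qblock_orthogonal: "k \<noteq> k' \<Longrightarrow> Qblock k (Qblock k' x) = 0"
  by (intro Q_disjoint block_rad_pos block_sphere blocks_disjoint)

lemma Qblock_idem: "Qblock k (Qblock k x) = Qblock k x"
proof -
  obtain p where p: "norm X < p" "p < r" using X_small dense by blast
  then have "p > 0" using norm_ge_zero[of X] by linarith
  show ?thesis
  proof (rule Q_idem)
    show "0 < brad k p" using rad_ge[OF first_last(1,2), of p k] \<open>p > 0\<close> by linarith
    show "brad k p < brad k r" using p by (simp add: rad_def)
  qed (use block_annulus[OF p(1)] p in auto)
qed

lemma Qbig_eq_sum: "Qbig (last_of j) x = (\<Sum>k\<le>j. Qblock k x)"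
proof (rule Q_gather[OF big_rad_pos[OF first_last(3)] big_sphere_last])
  show "cball (ctr 1 (last_of j)) (big_rad (last_of j))
      \<subseteq> U \<union> (\<Union>k\<in>{..j}. ball (bctr k) (brad k r))"
    using covered[OF X_small, of j "\<lambda>_. r"] by fastforce
qed (use block_rad_pos block_sphere block_nested blocks_disjoint in auto)

text \<open>The distance to the real points \<open>lam i\<close> dominates both the half gap and the
  imaginary part; adding the squares costs the factor \<open>2\<close>. This brings integrands of
  size \<open>K / d^2\<close> into the form required by
  \<open>contour_integral_circle_bound\<close>.\<close>

lemma infdist_sq_bound:
  assumes "z = circlepath (ctr 1 n) (big_rad n) t" "1 \<le> n"
  shows "(half_gap n)\<^sup>2 + (big_rad n * sin (2 * pi * t))\<^sup>2
    \<le> 2 * (dist_spec z)\<^sup>2"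
    and "half_gap n \<le> dist_spec z"
proof -
  define d where "d = dist_spec z"
  define R where "R = big_rad n"
  have R: "R > 0" using big_rad_pos[OF assms(2)] by (simp add: R_def)
  have Imz: "Im z = R * sin (2 * pi * t)" unfolding assms(1) ctr_def R_def by (rule Im_circlepath)
  have "z \<in> sphere (ctr 1 n) R"
    unfolding assms(1) R_def[symmetric] using R
    by (simp add: circlepath_def part_circlepath_def linepath_def dist_norm norm_mult norm_exp_eq_Re)
  then show s: "half_gap n \<le> dist_spec z"
    using away_outside[of z 1 n "half_gap n"] away_inside[of z 1 n] assms(2)
    by (intro infdist_geI) (metis R_def not_le_imp_less mem_ball mem_cball mem_sphere order_refl order_less_irrefl)
  have im: "\<bar>Im z\<bar> \<le> d"
    unfolding d_def
  proof (rule infdist_geI)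
    show "\<bar>Im z\<bar> \<le> cmod (z - complex_of_real (lam i))" for i
      using abs_Im_le_cmod[of "z - complex_of_real (lam i)"] by simp
  qed
  have "(half_gap n)\<^sup>2 \<le> d\<^sup>2" using s half_gap_pos[OF assms(2)] unfolding d_def by (intro power_mono) auto
  moreover have "(Im z)\<^sup>2 \<le> d\<^sup>2" using power_mono[OF im, of 2] by simp
  ultimately show "(half_gap n)\<^sup>2 + (big_rad n * sin (2 * pi * t))\<^sup>2
      \<le> 2 * (dist_spec z)\<^sup>2"
    unfolding Imz R_def d_def by simp
qed

text \<open>The circle bound is applied with \<open>2 * K\<close>, because of the factor in
  \<open>infdist_sq_bound\<close>, and divided by the modulus of \<open>two_pi_i\<close>; this is
  where \<open>3 * pi / 2\<close> comes from.\<close>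

lemma contour_integral_big_bound:
  assumes f: "(f has_contour_integral (two_pi_i * I)) (circlepath (ctr 1 n) (big_rad n))"
    and n: "1 \<le> n" and K: "K \<ge> 0"
    and le: "\<And>z. z \<in> sphere (ctr 1 n) (big_rad n) \<Longrightarrow>
      half_gap n \<le> dist_spec z \<Longrightarrow>
      cmod (f z) \<le> K / (dist_spec z)\<^sup>2"
  shows "cmod I \<le> 3 * pi / 2 * K / half_gap n"
proof -
  let ?R = "big_rad n"
  have R: "?R > 0" by (rule big_rad_pos[OF n])
  have "cmod (two_pi_i * I) \<le> (3 * pi\<^sup>2 / 2) * (2 * K) / half_gap n"
  proof (rule contour_integral_circle_bound[OF f R half_gap_pos[OF n]])
    fix t :: real assume t: "0 \<le> t" "t \<le> 1"
    define z where "z = circlepath (ctr 1 n) ?R t"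
    have "z \<in> path_image (circlepath (ctr 1 n) ?R)" unfolding z_def path_image_def using t by auto
    then have zs: "z \<in> sphere (ctr 1 n) ?R" using R by simp
    define d where "d = dist_spec z"
    note b = infdist_sq_bound[OF z_def n, folded d_def]
    have d: "d > 0" using b(2) half_gap_pos[OF n] by linarith
    define E where "E = (half_gap n)\<^sup>2 + (?R * sin (2 * pi * t))\<^sup>2"
    have E: "E > 0" unfolding E_def using half_gap_pos[OF n] by (intro add_pos_nonneg) auto
    have "cmod (f z) \<le> K / d\<^sup>2" using le[OF zs] b(2) by (simp add: d_def)
    also have "\<dots> = (2 * K) / (2 * d\<^sup>2)" by simp
    also have "\<dots> \<le> (2 * K) / E" using b(1) K d E unfolding E_def[symmetric] by (intro divide_left_mono mult_pos_pos) auto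
    finally show "cmod (f (circlepath (ctr 1 n) ?R t)) \<le> 2 * K / ((half_gap n)\<^sup>2 + (?R * sin (2 * pi * t))\<^sup>2)"
      by (simp add: z_def E_def)
  qed (use K in simp)
  then have "2 * pi * cmod I \<le> 2 * pi * (3 * pi / 2 * K / half_gap n)"
    by (simp add: norm_mult power2_eq_square field_simps)
  then show ?thesis using pi_gt_zero by (simp only: mult_le_cancel_left_pos mult_pos_pos zero_less_numeral)
qed

end

text \<open>A second name for the same locale: attached to it, the interpretation with
  \<open>X = 0\<close> is not applied to its own instance. Every fact about \<open>Q\<close> becomes
  available for \<open>A\<close> under the prefix \<open>unperturbed\<close>.\<close>

locale gap_perturbation = block_circles

sublocale gap_perturbation \<subseteq> unperturbed: block_circles A lam 0 r i0
  rewrites "graph_plus A 0 = A"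
proof -
  show "block_circles A lam 0 r i0"
  proof
    show "clinear_op (0 :: 'a \<Rightarrow>\<^sub>L 'a)" by (simp add: clinear_op_def blinfun.zero_left)
  qed (use sa compact \<Lambda> lam_mono i0 gap r_pos in auto)
qed simp

context gap_perturbation
begin

abbreviation "P \<equiv> riesz_integral (resolvent A)"

abbreviation Pblock :: "nat \<Rightarrow> ('a \<Rightarrow>\<^sub>L 'a)"
  where "Pblock k \<equiv> P (bctr k) (brad k r)"

abbreviation Pbig :: "nat \<Rightarrow> ('a \<Rightarrow>\<^sub>L 'a)"
  where "Pbig n \<equiv> P (ctr 1 n) (big_rad n)"

text \<open>The second hypothesis gives \<open>d - norm X \<ge> d / 2\<close> on the circle. Hence
  the resolvent of \<open>H\<close> is at most \<open>2 / d\<close>, and the difference of the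
  resolvents at most \<open>2 * norm X / d^2\<close>.\<close>

lemma Qbig_Pbig_close:
  assumes n: "1 \<le> n" "2 * norm X \<le> half_gap n"
  shows "norm (Qbig n - Pbig n) \<le> 3 * pi * norm X / half_gap n"
proof (rule norm_blinfun_bound)
  note s0 = half_gap_pos[OF n(1)]
  have Xs: "norm X < half_gap n" using n(2) s0 norm_ge_zero[of X] by linarith
  fix x
  show "norm ((Qbig n - Pbig n) x) \<le> 3 * pi * norm X / half_gap n * norm x"
  proof (rule norm_le_cinnerI)
    fix y
    let ?R = "big_rad n"
    have sph: "sphere (ctr 1 n) ?R \<subseteq> U" "sphere (ctr 1 n) ?R \<subseteq> unperturbed.U"
      using big_sphere[OF n(1) Xs] unperturbed.big_sphere[OF n(1)] s0 by auto
    have "((\<lambda>z. cinner y (resolvent A z x) - cinner y (resolvent H z x)) has_contour_integral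
        (- two_pi_i * cinner y (Pbig n x) - - two_pi_i * cinner y (Qbig n x)))
        (circlepath (ctr 1 n) ?R)"
      by (intro has_contour_integral_diff has_contour_integral_riesz' big_rad_pos n
          continuous_R_sphere[OF sph(1)] unperturbed.continuous_R_sphere[OF sph(2)])
    then have h: "((\<lambda>z. cinner y (resolvent A z x) - cinner y (resolvent H z x)) has_contour_integral
        (two_pi_i * cinner y ((Qbig n - Pbig n) x))) (circlepath (ctr 1 n) ?R)"
      by (simp add: blinfun.diff_left cinner.diff_right algebra_simps)
    have "cmod (cinner y ((Qbig n - Pbig n) x)) \<le> 3 * pi / 2 * (2 * norm X * norm x * norm y) / half_gap n"
    proof (rule contour_integral_big_bound[OF h n(1)])
      fix z assume z: "z \<in> sphere (ctr 1 n) ?R"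
      define d where "d = dist_spec z"
      assume "half_gap n \<le> dist_spec z"
      then have d: "half_gap n \<le> d" by (simp add: d_def)
      have zU: "z \<in> U" "z \<in> unperturbed.U" using z sph by auto
      have d0: "d > 0" "d - norm X \<ge> d / 2" using d s0 n(2) by linarith+
      have RA: "norm (resolvent A z) \<le> 1 / d" using resolvent_A(2)[of z] d0 by (simp add: d_def)
      have "norm (resolvent H z) \<le> 1 / (d - norm X)" using resolvent_H(2)[OF zU(1)] by (simp add: d_def)
      also have "\<dots> \<le> 1 / (d / 2)" using d0 by (intro divide_left_mono) (auto intro!: mult_pos_pos)
      finally have RH: "norm (resolvent H z) \<le> 2 / d" by simp
      have "cinner y (resolvent A z x) - cinner y (resolvent H z x) = cinner y (resolvent H z (X (resolvent A z x)))"
        using arg_cong[OF resolvent_difference[OF zU(1), of x], of uminus] by (simp flip: cinner.diff_right)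
      then have "cmod (cinner y (resolvent A z x) - cinner y (resolvent H z x))
          \<le> norm y * norm (resolvent H z (X (resolvent A z x)))" by (simp add: cmod_cinner_le)
      also have "norm y * norm (resolvent H z (X (resolvent A z x))) \<le> norm y * (2 / d * (norm X * (1 / d * norm x)))"
      proof (rule mult_left_mono)
        have "norm (resolvent A z x) \<le> 1 / d * norm x"
          by (rule order_trans[OF norm_blinfun]) (intro mult_right_mono RA norm_ge_zero)
        then have "norm X * norm (resolvent A z x) \<le> norm X * (1 / d * norm x)"
          by (rule mult_left_mono) simp
        then have "norm (X (resolvent A z x)) \<le> norm X * (1 / d * norm x)"
          by (rule order_trans[OF norm_blinfun])
        then have "norm (resolvent H z) * norm (X (resolvent A z x)) \<le> 2 / d * (norm X * (1 / d * norm x))"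
          using d0 by (intro mult_mono RH) auto
        then show "norm (resolvent H z (X (resolvent A z x))) \<le> 2 / d * (norm X * (1 / d * norm x))"
          by (rule order_trans[OF norm_blinfun])
      qed simp
      finally show "cmod (cinner y (resolvent A z x) - cinner y (resolvent H z x))
          \<le> 2 * norm X * norm x * norm y / (dist_spec z)\<^sup>2"
        unfolding d_def[symmetric] by (simp add: power2_eq_square ac_simps)
    qed simp
    then show "cmod (cinner y ((Qbig n - Pbig n) x)) \<le> 3 * pi * norm X / half_gap n * norm x * norm y"
      by (simp add: field_simps)
  qed (use s0 in simp)
qed (use half_gap_pos[OF n(1)] in simp)

lemma base_point: "Complex (lam 1) 1 \<in> unperturbed.U"
proof (rule unperturbed.in_U_I[of 1])
  show "1 \<le> cmod (Complex (lam 1) 1 - complex_of_real (lam i))" for i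
    using abs_Im_le_cmod[of "Complex (lam 1) 1 - complex_of_real (lam i)"] by simp
qed simp

text \<open>Stands in for completeness of the eigenvectors. By \<open>G_inside\<close> the left-hand
  vector is a Cauchy integral of \<open>resolvent A z x / (z - w)\<close>, whose kernel supplies the
  second factor \<open>1 / d\<close>. As \<open>w\<close> has distance \<open>1\<close> from
  \<open>lam 1\<close>, a half gap of at least \<open>2\<close> puts \<open>w\<close> inside the
  circle and gives \<open>cmod (z - w) \<ge> d - 1 \<ge> d / 2\<close>.\<close>

lemma Pblock_tail_bound:
  assumes n: "1 \<le> n" "2 \<le> half_gap n" and w: "w = Complex (lam 1) 1"
  shows "norm (resolvent A w (x - Pbig n x)) \<le> 3 * pi / half_gap n * norm x"
proof (rule norm_le_cinnerI)
  note s0 = half_gap_pos[OF n(1)]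
  fix y
  let ?R = "big_rad n"
  have sph: "sphere (ctr 1 n) ?R \<subseteq> unperturbed.U"
    using unperturbed.big_sphere[OF n(1)] s0 by auto
  have w1: "cmod (w - complex_of_real (lam 1)) = 1" by (simp add: w norm_complex_def)
  have wU: "w \<in> unperturbed.U" unfolding w by (rule base_point)
  have wb: "w \<in> ball (ctr 1 n) ?R"
  proof -
    have "dist (ctr 1 n) w \<le> dist (ctr 1 n) (complex_of_real (lam 1)) + 1"
      using dist_triangle2[of "ctr 1 n" w "complex_of_real (lam 1)"] w1
      by (simp add: dist_norm norm_minus_commute)
    also have "dist (ctr 1 n) (complex_of_real (lam 1)) = \<bar>(lam 1 + lam n) / 2 - lam 1\<bar>"
      by (simp only: ctr_def dist_of_real dist_real_def)
    also have "\<dots> = (lam n - lam 1) / 2" using lam_le[of 1 n] n(1) by (simp add: field_simps)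
    finally show ?thesis using n(2) by (simp add: rad_def)
  qed
  have cont: "continuous_on (sphere (ctr 1 n) ?R) (\<lambda>z. cinner y (resolvent A z x))"
    by (rule continuous_on_subset[OF unperturbed.continuous_element sph])
  have "((\<lambda>z. cinner y (resolvent A z x) / (z - w)) has_contour_integral
      (two_pi_i * unperturbed.G (ctr 1 n) ?R x y w)) (circlepath (ctr 1 n) ?R)"
    unfolding unperturbed.G_def using wb
    by (intro has_contour_integral_cauchy_transform big_rad_pos n cont) simp
  moreover have "unperturbed.G (ctr 1 n) ?R x y w = cinner y (resolvent A w (x - Pbig n x))"
    by (rule unperturbed.G_inside[symmetric]) (use big_rad_pos n sph wU wb in auto)
  ultimately have h: "((\<lambda>z. cinner y (resolvent A z x) / (z - w)) has_contour_integral
      (two_pi_i * cinner y (resolvent A w (x - Pbig n x)))) (circlepath (ctr 1 n) ?R)" by simp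
  have "cmod (cinner y (resolvent A w (x - Pbig n x))) \<le> 3 * pi / 2 * (2 * norm x * norm y) / half_gap n"
  proof (rule contour_integral_big_bound[OF h n(1)])
    fix z assume z: "z \<in> sphere (ctr 1 n) ?R"
    define d where "d = dist_spec z"
    assume "half_gap n \<le> dist_spec z"
    then have d: "half_gap n \<le> d" by (simp add: d_def)
    have d0: "d > 0" "d - 1 \<ge> d / 2" using d s0 n(2) by linarith+
    have RA: "norm (resolvent A z) \<le> 1 / d" using resolvent_A(2)[of z] d0 by (simp add: d_def)
    have "d \<le> cmod (z - complex_of_real (lam 1))"
      using infdist_le[of "complex_of_real (lam 1)" "complex_of_real ` lam ` {1..}" z] by (simp add: d_def dist_norm)
    also have "\<dots> \<le> cmod (z - w) + 1"
      using norm_triangle_ineq[of "z - w" "w - complex_of_real (lam 1)"] w1 by simp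
    finally have zw: "d / 2 \<le> cmod (z - w)" using d0 by linarith
    have "cmod (cinner y (resolvent A z x)) \<le> norm y * norm (resolvent A z x)" by (rule cmod_cinner_le)
    also have "\<dots> \<le> norm y * (1 / d * norm x)"
      by (intro mult_left_mono order_trans[OF norm_blinfun] mult_right_mono RA norm_ge_zero)
    finally have "cmod (cinner y (resolvent A z x) / (z - w)) \<le> norm y * (1 / d * norm x) / (d / 2)"
      unfolding norm_divide using zw d0 by (intro frac_le) auto
    then show "cmod (cinner y (resolvent A z x) / (z - w))
        \<le> 2 * norm x * norm y / (dist_spec z)\<^sup>2"
      unfolding d_def[symmetric] by (simp add: power2_eq_square field_simps)
  qed simp
  then show "cmod (cinner y (resolvent A w (x - Pbig n x))) \<le> 3 * pi / half_gap n * norm x * norm y"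
    by (simp add: field_simps)
qed (use half_gap_pos[OF n(1)] in simp)

text \<open>Conjugation maps a circle with real centre to itself with reversed orientation. The sign
  from the reversal cancels against the one from conjugating \<open>two_pi_i\<close>, and the
  resolvents at \<open>z\<close> and \<open>cnj z\<close> are adjoint to each other.\<close>

lemma unperturbed_Q_symmetric:
  assumes \<rho>: "\<rho> > 0" and sph: "sphere (complex_of_real a) \<rho> \<subseteq> unperturbed.U"
  shows "cinner (P (complex_of_real a) \<rho> x) y = cinner x (P (complex_of_real a) \<rho> y)"
proof -
  let ?\<gamma> = "circlepath (complex_of_real a) \<rho>" and ?P = "P (complex_of_real a) \<rho>"
  define f where "f z = cinner y (resolvent A z x)" for z
  have rev: "cnj \<circ> ?\<gamma> = reversepath ?\<gamma>"
  proof
    fix t :: real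
    have "exp (2 * complex_of_real pi * \<i> * complex_of_real (1 - t)) = exp (- (2 * complex_of_real pi * \<i> * complex_of_real t))"
      using exp_plus_2pin[of "- (2 * complex_of_real pi * \<i> * complex_of_real t)" 1]
      by (simp add: algebra_simps)
    then show "(cnj \<circ> ?\<gamma>) t = reversepath ?\<gamma> t"
      by (simp add: circlepath reversepath_def exp_cnj)
  qed
  have I1: "contour_integral ?\<gamma> f = - two_pi_i * cinner y (?P x)"
    unfolding f_def by (rule contour_integral_unique, rule has_contour_integral_riesz'[OF \<rho>])
      (rule unperturbed.continuous_R_sphere[OF sph])
  have I2: "contour_integral ?\<gamma> (\<lambda>z. cinner x (resolvent A z y)) = - two_pi_i * cinner x (?P y)"
    by (rule contour_integral_unique, rule has_contour_integral_riesz'[OF \<rho>])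
      (rule unperturbed.continuous_R_sphere[OF sph])
  have "(cnj \<circ> f \<circ> cnj) z = cinner x (resolvent A z y)" if "z \<in> path_image ?\<gamma>" for z
  proof -
    have pos: "dist_spec z > 0"
      using that sph \<rho> unfolding unperturbed.U_def by auto
    have "(cnj \<circ> f \<circ> cnj) z = cinner (resolvent A (cnj z) x) y"
      by (simp add: f_def flip: cinner_commute)
    also have "\<dots> = cinner x (resolvent A z y)"
    proof (rule resolvent_adjoint[OF sa])
      show "is_resolvent A (cnj z) (resolvent A (cnj z))" using pos by (intro resolvent_A(1)) (simp only: infdist_cnj)
      show "is_resolvent A (cnj (cnj z)) (resolvent A z)" using resolvent_A(1)[OF pos] by simp
    qed
    finally show ?thesis .
  qed
  then have "contour_integral ?\<gamma> (cnj \<circ> f \<circ> cnj) = contour_integral ?\<gamma> (\<lambda>z. cinner x (resolvent A z y))"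
    by (rule contour_integral_cong[OF refl])
  moreover have "contour_integral (cnj \<circ> ?\<gamma>) f = cnj (contour_integral ?\<gamma> (cnj \<circ> f \<circ> cnj))"
    by (rule contour_integral_cnj) simp
  moreover have "contour_integral (reversepath ?\<gamma>) f = - contour_integral ?\<gamma> f"
    by (rule contour_integral_reversepath) simp
  ultimately have "two_pi_i * cinner y (?P x) = cnj (- two_pi_i * cinner x (?P y))"
    unfolding rev I1 I2 by simp
  then have "cinner y (?P x) = cnj (cinner x (?P y))" by simp
  then show ?thesis using cinner_commute[of "?P x" y] by simp
qed

lemma Pblock_orth_projection: "orth_projection (Pblock k)"
  unfolding orth_projection_def adjoint_pair_def
proof (intro conjI allI)
  show "Pblock k o\<^sub>L Pblock k = Pblock k"
    by (rule blinfun_eqI) (simp add: unperturbed.Qblock_idem)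
  show "cinner (Pblock k x) y = cinner x (Pblock k y)" for x y
    using unperturbed_Q_symmetric[of "brad k r" "(lam (first_of k) + lam (last_of k)) / 2" x y]
      block_rad_pos[of k] unperturbed.block_sphere[of k] by (simp add: ctr_def)
qed

text \<open>A sum of mutually annihilating orthogonal projections. It supplies the uniform bound by
  \<open>1\<close> in the proof of \<open>Pbig_tendsto\<close>.\<close>

lemma Pbig_orth_projection: "orth_projection (Pbig (last_of j))"
  unfolding orth_projection_def adjoint_pair_def
proof (intro conjI allI)
  show "Pbig (last_of j) o\<^sub>L Pbig (last_of j) = Pbig (last_of j)"
  proof (rule blinfun_eqI)
    fix x
    have "(\<Sum>k\<le>j. Pblock k (Pblock i x)) = Pblock i x" if "i \<le> j" for i
    proof -
      have "(\<Sum>k\<le>j. Pblock k (Pblock i x)) = (\<Sum>k\<le>j. if k = i then Pblock i x else 0)"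
        by (intro sum.cong refl) (auto simp: unperturbed.Qblock_idem unperturbed.Qblock_orthogonal)
      then show ?thesis using that by simp
    qed
    then show "(Pbig (last_of j) o\<^sub>L Pbig (last_of j)) x = Pbig (last_of j) x"
      unfolding blinfun_apply_blinfun_compose unperturbed.Qbig_eq_sum blinfun.sum_right by simp
  qed
  show "cinner (Pbig (last_of j) x) y = cinner x (Pbig (last_of j) y)" for x y
    using orth_projection_cinner[OF Pblock_orth_projection]
    unfolding unperturbed.Qbig_eq_sum cinner.sum_left cinner.sum_right by simp
qed

end

subsection \<open>Bases of subspaces\<close>

lemma square_sum_le: "(a + b)\<^sup>2 \<le> 2 * a\<^sup>2 + 2 * b\<^sup>2" for a b :: real
  using zero_le_power2[of "a - b"] by (simp add: power2_sum power2_diff)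

text \<open>The projections may be oblique, as the \<open>Qblock k\<close> in general are; the
  orthogonal \<open>Pblock k\<close> are the other instance.\<close>

locale projection_sequence =
  fixes E :: "nat \<Rightarrow> ('a::chilbert_space \<Rightarrow>\<^sub>L 'a)"
  assumes E_clinear: "\<And>k. clinear_op (E k)"
    and E_idem: "\<And>k x. E k (E k x) = E k x"
    and E_orth: "\<And>k k' x. k \<noteq> k' \<Longrightarrow> E k (E k' x) = 0"
    and E_sum: "\<And>x. (\<lambda>j. \<Sum>k\<le>j. E k x) \<longlonglongrightarrow> x"
begin

lemma range_E_iff: "x \<in> range (E k) \<longleftrightarrow> E k x = x"
  using E_idem by (metis rangeE rangeI)

lemma csubspace_range_E: "csubspace (range (E k))"
proof (rule complex_vector.subspaceI)
  show "0 \<in> range (E k)" by (simp add: range_E_iff blinfun.zero_right)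
qed (simp_all add: range_E_iff blinfun.add_right clinear_opD[OF E_clinear])

lemma closed_range_E: "closed (range (E k))"
proof -
  have "range (E k) = {x. E k x = x}" using range_E_iff by blast
  moreover have "closed {x. E k x = x}"
    by (intro closed_Collect_eq continuous_intros blinfun.continuous_on)
  ultimately show ?thesis by simp
qed

definition partial_sum where "partial_sum j = (\<Sum>k\<le>j. E k)"

lemma E_partial_sum: "E k (partial_sum j x) = (if k \<le> j then E k x else 0)"
proof -
  have "E k (partial_sum j x) = (\<Sum>i\<le>j. if i = k then E k x else 0)"
    unfolding partial_sum_def blinfun.sum_left blinfun.sum_right
    by (intro sum.cong refl) (auto simp: E_idem E_orth)
  then show ?thesis by simp
qed

lemma partial_sum_idem: "partial_sum j (partial_sum j x) = partial_sum j x"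
proof -
  have "partial_sum j (partial_sum j x) = (\<Sum>k\<le>j. E k (partial_sum j x))"
    by (simp add: partial_sum_def blinfun.sum_left)
  then show ?thesis by (simp add: E_partial_sum) (simp add: partial_sum_def blinfun.sum_left)
qed

lemma partial_sum_clinear: "clinear_op (partial_sum j)"
  by (simp add: clinear_op_def partial_sum_def blinfun.sum_left complex_vector.scale_sum_right
      clinear_opD[OF E_clinear])

lemma E_sums: "(\<lambda>k. E k x) sums x"
  unfolding sums_def_le by (rule E_sum)

lemma E_eq_0I: "(\<And>k. E k x = 0) \<Longrightarrow> x = 0"
  using E_sums[of x] sums_unique[of "\<lambda>k. 0 :: 'a"] by (simp add: sums_unique2[OF _ sums_zero])

text \<open>Applying \<open>E k\<close> to an expansion termwise isolates its component in block
  \<open>k\<close>, whence uniqueness.\<close>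

lemma subspace_basis_range: "subspace_basis (\<lambda>k. range (E k))"
  unfolding subspace_basis_def
proof (intro conjI allI csubspace_range_E closed_range_E ex1I)
  fix x
  show "\<And>k. E k x \<in> range (E k)" by simp
  show "(\<lambda>k. E k x) sums x" by (rule E_sums)
  fix u assume u: "(\<forall>k. u k \<in> range (E k)) \<and> u sums x"
  then have uE: "E k (u k) = u k" for k by (simp add: range_E_iff)
  show "u = (\<lambda>k. E k x)"
  proof
    fix k
    have "(\<lambda>i. E k (u i)) sums E k x"
      by (rule bounded_linear.sums[OF blinfun.bounded_linear_right]) (use u in simp)
    moreover have "(\<lambda>i. E k (u i)) = (\<lambda>i. if i = k then u i else 0)"
      using E_orth[of k _ "u _"] uE by (intro ext) (metis (full_types))
    ultimately show "u k = E k x" using sums_single[of k u] by (simp add: sums_unique2)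
  qed
qed

end

section \<open>Completeness and quadratic closeness of the Riesz projections\<close>

context gap_perturbation
begin

text \<open>On an eigenvector the resolvent is multiplication by \<open>1 / (lam i - z)\<close>, so
  Cauchy's formula evaluates the integral. It follows later that no \<open>Pblock k\<close>
  vanishes.\<close>

lemma eigenvector_in_Pblock:
  assumes x: "(x, complex_of_real (lam i) *\<^sub>C x) \<in> A" and i: "first_of k \<le> i" "i \<le> last_of k"
  shows "Pblock k x = x"
proof (rule cinner_eqI)
  fix y
  let ?c = "bctr k" and ?R = "brad k r"
  have "lam (first_of k) \<le> lam i" "lam i \<le> lam (last_of k)" using i first_last[of k] by (auto intro: lam_le)
  then have "complex_of_real (lam i) \<in> ball ?c ?R"
    using r_pos unfolding mem_ball ctr_def dist_of_real dist_real_def rad_def by (simp add: abs_less_iff field_simps)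
  then have "((\<lambda>z. - cinner y x * (1 / (z - complex_of_real (lam i)))) has_contour_integral - cinner y x * two_pi_i)
      (circlepath ?c ?R)"
    by (intro has_contour_integral_lmul has_contour_integral_inverse_inside)
  then have "((\<lambda>z. cinner y (resolvent A z x)) has_contour_integral - cinner y x * two_pi_i) (circlepath ?c ?R)"
  proof (rule has_contour_integral_eq)
    fix z assume "z \<in> path_image (circlepath ?c ?R)"
    then have zs: "z \<in> sphere ?c ?R" using block_rad_pos[of k] by simp
    then have zU: "z \<in> unperturbed.U" using unperturbed.block_sphere by blast
    then have R: "is_resolvent A z (resolvent A z)" by (rule unperturbed.resolvent_H(1))
    have ne: "z \<noteq> complex_of_real (lam i)"
      using zs \<open>complex_of_real (lam i) \<in> ball ?c ?R\<close> by auto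
    have "resolvent A z (complex_of_real (lam i) *\<^sub>C x - z *\<^sub>C x) = x"
      using R x unfolding is_resolvent_def by blast
    then have "(complex_of_real (lam i) - z) *\<^sub>C resolvent A z x = x"
      using clinear_opD[OF unperturbed.clinear_R[OF zU], of "complex_of_real (lam i) - z" x]
      by (simp add: scaleC.diff_left)
    then have "(complex_of_real (lam i) - z) * cinner y (resolvent A z x) = cinner y x"
      by (metis cinner_scaleC_right)
    then show "- cinner y x * (1 / (z - complex_of_real (lam i))) = cinner y (resolvent A z x)"
      using ne by (simp add: divide_simps) (simp add: algebra_simps)
  qed
  from contour_integral_unique[OF this] contour_integral_unique[OF has_contour_integral_riesz'[OF block_rad_pos
        unperturbed.continuous_R_sphere[OF unperturbed.block_sphere[of k]], of y x]]
  show "cinner y (Pblock k x) = cinner y x" by simp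
qed

end

locale summable_gaps = gap_perturbation +
  assumes gaps: "summable (\<lambda>i. 1 / (lam (Suc (Suc i)) - lam (Suc i))\<^sup>2)"
    and lam_eigenvalue: "\<And>i. 1 \<le> i \<Longrightarrow> eigenvalue A (complex_of_real (lam i))"
begin

lemma summable_half_gap: "summable (\<lambda>k. 1 / (half_gap (last_of k))\<^sup>2)"
proof -
  have "summable (\<lambda>i. 4 * (1 / (lam (Suc (Suc i)) - lam (Suc i))\<^sup>2))" by (intro summable_mult gaps)
  moreover have "4 * (1 / (lam (Suc (Suc i)) - lam (Suc i))\<^sup>2) = 1 / (half_gap (Suc i))\<^sup>2" for i
    by (simp add: half_gap_def power_divide)
  ultimately have "summable (\<lambda>i. 1 / (half_gap (Suc i))\<^sup>2)" by simp
  \<comment> \<open>The gaps of the hypothesis start at index \<open>1\<close>, those of the blocks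
    at \<open>last_of 0 = i0 - 1\<close>; this is a shift by \<open>i0 - 2\<close>.\<close>
  then have "summable (\<lambda>k. 1 / (half_gap (Suc (k + (i0 - 2))))\<^sup>2)"
    by (subst summable_iff_shift)
  moreover have "Suc (k + (i0 - 2)) = last_of k" for k using i0 by (simp add: last_of_def)
  ultimately show ?thesis by simp
qed

lemma inverse_half_gap_tendsto: "(\<lambda>k. 1 / half_gap (last_of k)) \<longlonglongrightarrow> 0"
proof -
  have "(\<lambda>k. sqrt (1 / (half_gap (last_of k))\<^sup>2)) \<longlonglongrightarrow> sqrt 0"
    by (intro tendsto_real_sqrt summable_LIMSEQ_zero summable_half_gap)
  moreover have "sqrt (1 / (half_gap (last_of k))\<^sup>2) = 1 / half_gap (last_of k)" for k
    using half_gap_pos[OF first_last(3), of k] by (simp add: real_sqrt_divide)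
  ultimately show ?thesis by simp
qed

text \<open>Summability of the inverse squares forces the gaps to tend to infinity, so each of the
  lower bounds on half gaps required above holds eventually.\<close>

lemma eventually_half_gap: "eventually (\<lambda>k. M \<le> half_gap (last_of k)) sequentially"
proof -
  define M' where "M' = max M 1"
  have "eventually (\<lambda>k. 1 / half_gap (last_of k) < 1 / M') sequentially"
    by (rule order_tendstoD(2)[OF inverse_half_gap_tendsto]) (simp add: M'_def)
  then show ?thesis
  proof eventually_elim
    case (elim k)
    have "M' < half_gap (last_of k)"
      using elim half_gap_pos[OF first_last(3), of k] by (simp add: M'_def field_simps)
    then show ?case by (simp add: M'_def)
  qed
qed

text \<open>Vectors of the domain are values of the resolvent at \<open>w\<close>, which commutes
  with \<open>Pbig\<close>, so the tail bound applies to them. Density of the domain and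
  \<open>norm (Pbig y) \<le> norm y\<close> extend the convergence to all vectors.\<close>

lemma Pbig_tendsto: "(\<lambda>j. Pbig (last_of j) x) \<longlonglongrightarrow> x"
proof (rule tendstoI)
  fix \<epsilon> :: real assume "\<epsilon> > 0"
  define w where "w = Complex (lam 1) 1"
  have wU: "w \<in> unperturbed.U" unfolding w_def by (rule base_point)
  have "x \<in> closure (Domain A)" using sa unfolding self_adjoint_def by simp
  then obtain x' where x': "x' \<in> Domain A" "dist x' x < \<epsilon> / 3"
    unfolding closure_approachable using \<open>\<epsilon> > 0\<close> by (meson divide_pos_pos zero_less_numeral)
  then obtain u where "(x', u) \<in> A" by blast
  then have x'v: "resolvent A w (u - w *\<^sub>C x') = x'"
    using unperturbed.resolvent_H(1)[OF wU] unfolding is_resolvent_def by blast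
  define v where "v = u - w *\<^sub>C x'"
  have "(\<lambda>j. 3 * pi * norm v * (1 / half_gap (last_of j))) \<longlonglongrightarrow> 3 * pi * norm v * 0"
    by (intro tendsto_mult tendsto_const inverse_half_gap_tendsto)
  then have "eventually (\<lambda>j. 3 * pi * norm v * (1 / half_gap (last_of j)) < \<epsilon> / 3) sequentially"
    using \<open>\<epsilon> > 0\<close> by (intro order_tendstoD) auto
  with eventually_half_gap[of 2]
  show "eventually (\<lambda>j. dist (Pbig (last_of j) x) x < \<epsilon>) sequentially"
  proof eventually_elim
    case (elim j)
    have "resolvent A w (Pbig (last_of j) v) = Pbig (last_of j) x'"
      unfolding x'v[folded v_def, symmetric]
      by (rule unperturbed.R_Q_commute[OF big_rad_pos[OF first_last(3)] unperturbed.big_sphere_last wU])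
    then have tail: "x' - Pbig (last_of j) x' = resolvent A w (v - Pbig (last_of j) v)"
      using x'v by (simp add: blinfun.diff_right v_def)
    then have 1: "norm (x' - Pbig (last_of j) x') < \<epsilon> / 3"
    proof -
      have "norm (x' - Pbig (last_of j) x') \<le> 3 * pi / half_gap (last_of j) * norm v"
        using Pblock_tail_bound[OF first_last(3) elim(1) w_def, of v] by (simp only: tail)
      also have "\<dots> = 3 * pi * norm v * (1 / half_gap (last_of j))" by simp
      finally show ?thesis using elim(2) by linarith
    qed
    have 2: "norm (Pbig (last_of j) (x' - x)) < \<epsilon> / 3"
      using orth_projection_norm_le[OF Pbig_orth_projection, of j "x' - x"] x'(2) by (simp add: dist_norm)
    have e: "Pbig (last_of j) x - x = (x' - x) - (x' - Pbig (last_of j) x') - Pbig (last_of j) (x' - x)"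
      by (simp add: blinfun.diff_right)
    have "norm (Pbig (last_of j) x - x)
        \<le> norm (x' - x) + norm (x' - Pbig (last_of j) x') + norm (Pbig (last_of j) (x' - x))"
      unfolding e by (rule order_trans[OF norm_triangle_ineq4 add_right_mono[OF norm_triangle_ineq4]])
    then show ?case using 1 2 x'(2) unfolding dist_norm by linarith
  qed
qed

lemma eventually_Qbig_Pbig_close:
  "eventually (\<lambda>j. norm (Qbig (last_of j) - Pbig (last_of j)) \<le> 3 * pi * norm X / half_gap (last_of j)) sequentially"
  using eventually_half_gap[of "2 * norm X"] by eventually_elim (rule Qbig_Pbig_close[OF first_last(3)])

lemma Qbig_Pbig_tendsto: "(\<lambda>j. Qbig (last_of j) - Pbig (last_of j)) \<longlonglongrightarrow> 0"
proof (rule Lim_null_comparison[OF eventually_Qbig_Pbig_close])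
  have "(\<lambda>j. 3 * pi * norm X * (1 / half_gap (last_of j))) \<longlonglongrightarrow> 3 * pi * norm X * 0"
    by (intro tendsto_mult tendsto_const inverse_half_gap_tendsto)
  then show "(\<lambda>j. 3 * pi * norm X / half_gap (last_of j)) \<longlonglongrightarrow> 0" by simp
qed

sublocale Q: projection_sequence Qblock
proof
  show "(\<lambda>j. \<Sum>k\<le>j. Qblock k x) \<longlonglongrightarrow> x" for x
  proof -
    have "(\<lambda>j. (Qbig (last_of j) - Pbig (last_of j)) x + Pbig (last_of j) x) \<longlonglongrightarrow> (0 :: 'a \<Rightarrow>\<^sub>L 'a) x + x"
      by (intro tendsto_add blinfun.tendsto Qbig_Pbig_tendsto tendsto_const Pbig_tendsto)
    then show ?thesis unfolding Qbig_eq_sum[symmetric] by (simp add: blinfun.diff_left blinfun.zero_left)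
  qed
qed (use Qblock_clinear Qblock_idem Qblock_orthogonal in auto)

sublocale P: projection_sequence Pblock
proof
  show "(\<lambda>j. \<Sum>k\<le>j. Pblock k x) \<longlonglongrightarrow> x" for x
    using Pbig_tendsto[of x] unfolding unperturbed.Qbig_eq_sum .
  show "Pblock k (Pblock k x) = Pblock k x" for k x
    by (rule orth_projection_idem[OF Pblock_orth_projection])
  show "Pblock k (Pblock k' x) = 0" if "k \<noteq> k'" for k k' x
    by (rule unperturbed.Qblock_orthogonal[OF that])
qed (rule orth_projection_clinear[OF Pblock_orth_projection])

lemma Qblock_Suc:  "Qblock (Suc k) = Qbig (last_of (Suc k)) - Qbig (last_of k)"
  by (rule blinfun_eqI) (simp only: blinfun.diff_left Qbig_eq_sum sum.atMost_Suc add_diff_cancel_left')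

lemma Pblock_Suc: "Pblock (Suc k) = Pbig (last_of (Suc k)) - Pbig (last_of k)"
  by (rule blinfun_eqI) (simp only: blinfun.diff_left unperturbed.Qbig_eq_sum sum.atMost_Suc add_diff_cancel_left')

lemma summable_Qblock_Pblock: "summable (\<lambda>k. (norm (Qblock k - Pblock k))\<^sup>2)"
proof -
  define C where "C = 3 * pi * norm X"
  define g where "g k = 1 / (half_gap (last_of k))\<^sup>2" for k
  have "eventually (\<lambda>k. norm (Qbig (last_of k) - Pbig (last_of k)) \<le> C / half_gap (last_of k) \<and>
      norm (Qbig (last_of (Suc k)) - Pbig (last_of (Suc k))) \<le> C / half_gap (last_of (Suc k))) sequentially"
    using eventually_Qbig_Pbig_close eventually_sequentially_Suc[THEN iffD2, OF eventually_Qbig_Pbig_close]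
    unfolding C_def by (rule eventually_conj)
  then have "eventually (\<lambda>k. norm ((norm (Qblock (Suc k) - Pblock (Suc k)))\<^sup>2) \<le> 2 * C\<^sup>2 * g k + 2 * C\<^sup>2 * g (Suc k)) sequentially"
  proof eventually_elim
    case (elim k)
    have e: "Qblock (Suc k) - Pblock (Suc k) =
        (Qbig (last_of (Suc k)) - Pbig (last_of (Suc k))) - (Qbig (last_of k) - Pbig (last_of k))"
      unfolding Qblock_Suc Pblock_Suc by simp
    have "norm (Qblock (Suc k) - Pblock (Suc k)) \<le> C / half_gap (last_of (Suc k)) + C / half_gap (last_of k)"
      unfolding e using norm_triangle_ineq4[of "Qbig (last_of (Suc k)) - Pbig (last_of (Suc k))" "Qbig (last_of k) - Pbig (last_of k)"]
        elim by linarith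
    then have "(norm (Qblock (Suc k) - Pblock (Suc k)))\<^sup>2 \<le> (C / half_gap (last_of (Suc k)) + C / half_gap (last_of k))\<^sup>2"
      by (intro power_mono) auto
    also have "\<dots> \<le> 2 * (C / half_gap (last_of (Suc k)))\<^sup>2 + 2 * (C / half_gap (last_of k))\<^sup>2"
      by (rule square_sum_le)
    finally show ?case by (simp add: g_def power_divide)
  qed
  moreover have "summable (\<lambda>k. 2 * C\<^sup>2 * g k + 2 * C\<^sup>2 * g (Suc k))"
    using summable_half_gap unfolding g_def[symmetric]
    by (intro summable_add summable_mult) (auto simp: summable_Suc_iff)
  ultimately have "summable (\<lambda>k. (norm (Qblock (Suc k) - Pblock (Suc k)))\<^sup>2)"
    by (rule summable_comparison_test_ev)
  \<comment> \<open>Block \<open>0\<close> is not a difference of two consecutive big projections,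
    but a single term does not affect summability.\<close>
  then show ?thesis by (subst (asm) summable_Suc_iff)
qed

lemma proj_Pblock: "proj (range (Pblock k)) = Pblock k"
  by (intro orth_projection_unique proj_properties P.csubspace_range_E P.closed_range_E Pblock_orth_projection)

lemma quadratically_close_Qblock: "quadratically_close_to_orthogonal (\<lambda>k. range (Qblock k))"
  unfolding quadratically_close_to_orthogonal_def
proof (intro exI conjI)
  show "subspace_basis (\<lambda>k. range (Pblock k))" by (rule P.subspace_basis_range)
  show "orthogonal_subspaces (\<lambda>k. range (Pblock k))"
    unfolding orthogonal_subspaces_def
  proof safe
    fix i j :: nat and x y assume ij: "i \<noteq> j"
    show "cinner (Pblock i x) (Pblock j y) = 0"
      unfolding orth_projection_cinner[OF Pblock_orth_projection] P.E_orth[OF ij] by simp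
  qed
  \<comment> \<open>The definition compares orthogonal projections, while \<open>Qblock k\<close> is
    oblique. Passing to the orthogonal projection onto its range costs a factor \<open>2\<close>,
    hence \<open>4\<close> for the squares.\<close>
  have "norm ((norm (proj (range (Qblock k)) - proj (range (Pblock k))))\<^sup>2) \<le> 4 * (norm (Qblock k - Pblock k))\<^sup>2" for k
  proof -
    have "norm (proj (range (Qblock k)) - Pblock k) \<le> 2 * norm (Qblock k - Pblock k)"
      by (rule orth_projection_onto_range_close[OF Pblock_orth_projection])
        (use proj_properties[OF Q.csubspace_range_E Q.closed_range_E] Q.E_idem in auto)
    then have "(norm (proj (range (Qblock k)) - Pblock k))\<^sup>2 \<le> (2 * norm (Qblock k - Pblock k))\<^sup>2"
      by (intro power_mono) auto
    then show ?thesis unfolding proj_Pblock by (simp add: power_mult_distrib)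
  qed
  then show "summable (\<lambda>k. (norm (proj (range (Qblock k)) - proj (range (Pblock k))))\<^sup>2)"
    by (intro summable_comparison_test'[OF summable_mult[OF summable_Qblock_Pblock, of 4]])
qed

end

subsection \<open>Orthonormal families\<close>

text \<open>Indexed by an arbitrary set, so that one notion covers sequences, sets of vectors (with
  \<open>id\<close>) and vectors indexed by the basis vectors whose partners they are.\<close>

definition orthonormal_family :: "('i \<Rightarrow> 'a::chilbert_space) \<Rightarrow> 'i set \<Rightarrow> bool"
  where "orthonormal_family \<phi> S \<longleftrightarrow> (\<forall>i\<in>S. \<forall>j\<in>S. cinner (\<phi> i) (\<phi> j) = (if i = j then 1 else 0))"

lemma orthonormal_familyD:
  "orthonormal_family \<phi> S \<Longrightarrow> i \<in> S \<Longrightarrow> j \<in> S \<Longrightarrow> cinner (\<phi> i) (\<phi> j) = (if i = j then 1 else 0)"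
  unfolding orthonormal_family_def by blast

lemma orthonormal_family_mono: "orthonormal_family \<phi> S \<Longrightarrow> S' \<subseteq> S \<Longrightarrow> orthonormal_family \<phi> S'"
  unfolding orthonormal_family_def by blast

lemma orthonormal_family_norm:
  assumes "orthonormal_family \<phi> S" "i \<in> S"
  shows "norm (\<phi> i) = 1"
proof -
  have "(norm (\<phi> i))\<^sup>2 = 1\<^sup>2" using orthonormal_familyD[OF assms(1,2,2)] by (simp add: norm_sq_cinner)
  then show ?thesis by (rule power2_eq_imp_eq) auto
qed

lemma orthonormal_family_image:
  assumes "orthonormal_family \<phi> S"
  shows "inj_on \<phi> S" "orthonormal_family id (\<phi> ` S)"
proof -
  show inj: "inj_on \<phi> S"
  proof (rule inj_onI, rule ccontr)
    fix i j assume "i \<in> S" "j \<in> S" "\<phi> i = \<phi> j" "i \<noteq> j"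
    then show False
      using orthonormal_familyD[OF assms, of i j] orthonormal_familyD[OF assms, of i i] by simp
  qed
  then show "orthonormal_family id (\<phi> ` S)"
    using assms unfolding orthonormal_family_def by (auto dest: inj_onD)
qed

lemma cinner_orthonormal_sum:
  assumes "orthonormal_family \<phi> S" "finite S" "i \<in> S"
  shows "cinner (\<phi> i) (\<Sum>j\<in>S. c j *\<^sub>C \<phi> j) = c i"
proof -
  have "cinner (\<phi> i) (\<Sum>j\<in>S. c j *\<^sub>C \<phi> j) = (\<Sum>j\<in>S. if j = i then c i else 0)"
    unfolding cinner.sum_right
    by (intro sum.cong refl) (use orthonormal_familyD[OF assms(1,3)] in auto)
  then show ?thesis using assms(2,3) by simp
qed

lemma norm_orthonormal_sum:
  assumes "orthonormal_family \<phi> S" "finite S"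
  shows "(norm (\<Sum>j\<in>S. c j *\<^sub>C \<phi> j))\<^sup>2 = (\<Sum>j\<in>S. (cmod (c j))\<^sup>2)"
proof -
  define y where "y = (\<Sum>j\<in>S. c j *\<^sub>C \<phi> j)"
  have "cinner y y = (\<Sum>j\<in>S. cnj (c j) * cinner (\<phi> j) y)"
    unfolding y_def cinner.sum_left by simp
  also have "\<dots> = (\<Sum>j\<in>S. cnj (c j) * c j)"
    unfolding y_def by (intro sum.cong refl) (simp add: cinner_orthonormal_sum[OF assms])
  also have "\<dots> = of_real (\<Sum>j\<in>S. (cmod (c j))\<^sup>2)"
    unfolding of_real_sum by (intro sum.cong refl) (metis complex_norm_square mult.commute)
  finally show ?thesis unfolding y_def[symmetric] cinner_self of_real_eq_iff .
qed

lemma bessel_finite: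
  assumes "orthonormal_family \<phi> S" "finite S"
  shows "(\<Sum>j\<in>S. (cmod (cinner (\<phi> j) x))\<^sup>2) \<le> (norm x)\<^sup>2"
proof -
  define y where "y = (\<Sum>j\<in>S. cinner (\<phi> j) x *\<^sub>C \<phi> j)"
  have n: "(norm y)\<^sup>2 = (\<Sum>j\<in>S. (cmod (cinner (\<phi> j) x))\<^sup>2)"
    unfolding y_def by (rule norm_orthonormal_sum[OF assms])
  have "cinner y x = (\<Sum>j\<in>S. cnj (cinner (\<phi> j) x) * cinner (\<phi> j) x)"
    unfolding y_def cinner.sum_left by simp
  also have "\<dots> = of_real (\<Sum>j\<in>S. (cmod (cinner (\<phi> j) x))\<^sup>2)"
    unfolding of_real_sum by (intro sum.cong refl) (metis complex_norm_square mult.commute)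
  finally have "cinner y y = cinner y x" by (simp add: n cinner_self)
  then have "norm y \<le> norm x" by (rule norm_le_if_cinner_eq)
  then show ?thesis unfolding n[symmetric] by (intro power_mono) auto
qed

lemma summable_orthonormal:
  fixes \<phi> :: "nat \<Rightarrow> 'a::chilbert_space"
  assumes "orthonormal_family \<phi> UNIV" "summable (\<lambda>j. (cmod (c j))\<^sup>2)"
  shows "summable (\<lambda>j. c j *\<^sub>C \<phi> j)"
  unfolding summable_Cauchy
proof (intro allI impI)
  fix e :: real assume "e > 0"
  then obtain N where N: "\<And>m n. m \<ge> N \<Longrightarrow> norm (\<Sum>j = m..<n. (cmod (c j))\<^sup>2) < e\<^sup>2"
    using assms(2) unfolding summable_Cauchy by (meson zero_less_power)
  have "norm (\<Sum>j = m..<n. c j *\<^sub>C \<phi> j) < e" if "m \<ge> N" for m n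
  proof (rule power2_less_imp_less)
    have "(norm (\<Sum>j = m..<n. c j *\<^sub>C \<phi> j))\<^sup>2 = (\<Sum>j = m..<n. (cmod (c j))\<^sup>2)"
      by (intro norm_orthonormal_sum orthonormal_family_mono[OF assms(1)]) auto
    then show "(norm (\<Sum>j = m..<n. c j *\<^sub>C \<phi> j))\<^sup>2 < e\<^sup>2" using N[OF that, of n] by simp
  qed (use \<open>e > 0\<close> in simp)
  then show "\<exists>N. \<forall>m\<ge>N. \<forall>n. norm (\<Sum>j = m..<n. c j *\<^sub>C \<phi> j) < e" by blast
qed

lemma cinner_sums: "f sums x \<Longrightarrow> (\<lambda>j. cinner y (f j)) sums cinner y x"
  by (rule bounded_linear.sums[OF cinner.bounded_linear_right])

lemma cinner_orthonormal_sums: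
  fixes \<phi> :: "nat \<Rightarrow> 'a::chilbert_space"
  assumes "orthonormal_family \<phi> UNIV" "(\<lambda>j. c j *\<^sub>C \<phi> j) sums x"
  shows "cinner (\<phi> i) x = c i"
proof -
  have "(\<lambda>j. cinner (\<phi> i) (c j *\<^sub>C \<phi> j)) sums cinner (\<phi> i) x" by (rule cinner_sums[OF assms(2)])
  moreover have "(\<lambda>j. cinner (\<phi> i) (c j *\<^sub>C \<phi> j)) = (\<lambda>j. if j = i then c j else 0)"
    using orthonormal_familyD[OF assms(1)] by auto
  ultimately show ?thesis using sums_single[of i c] by (simp add: sums_unique2)
qed

lemma orthonormal_basisI:
  fixes \<phi> :: "nat \<Rightarrow> 'a::chilbert_space"
  assumes \<phi>: "orthonormal_family \<phi> UNIV" and complete: "\<And>x. (\<And>j. cinner (\<phi> j) x = 0) \<Longrightarrow> x = 0"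
  shows "orthonormal_basis \<phi>"
  unfolding orthonormal_basis_def vector_basis_def
proof (intro conjI allI ex1I)
  fix x
  have "summable (\<lambda>j. (cmod (cinner (\<phi> j) x))\<^sup>2)"
  proof (rule summableI_nonneg_bounded)
    show "(\<Sum>j<n. (cmod (cinner (\<phi> j) x))\<^sup>2) \<le> (norm x)\<^sup>2" for n
      by (rule bessel_finite[OF orthonormal_family_mono[OF \<phi> subset_UNIV] finite_lessThan])
  qed (rule zero_le_power2)
  from summable_sums[OF summable_orthonormal[OF \<phi> this]]
  obtain y where y: "(\<lambda>j. cinner (\<phi> j) x *\<^sub>C \<phi> j) sums y" ..
  have "x - y = 0"
    by (rule complete) (simp only: cinner.diff_right cinner_orthonormal_sums[OF \<phi> y] diff_self)
  then have xy: "y = x" by simp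
  show "(\<lambda>j. cinner (\<phi> j) x *\<^sub>C \<phi> j) sums x" using y unfolding xy .
  show "c = (\<lambda>j. cinner (\<phi> j) x)" if "(\<lambda>j. c j *\<^sub>C \<phi> j) sums x" for c
    by (rule ext) (rule cinner_orthonormal_sums[OF \<phi> that, symmetric])
next
  fix i j :: nat
  show "cinner (\<phi> i) (\<phi> j) = (if i = j then 1 else 0)" by (rule orthonormal_familyD[OF \<phi>]) simp_all
qed

text \<open>The vectors that agree with their finite Fourier sum form a closed subspace containing
  \<open>B\<close>.\<close>

lemma orthonormal_expansion:
  assumes B: "orthonormal_family id B" "finite B" and x: "x \<in> closure (cspan B)"
  shows "(\<Sum>b\<in>B. cinner b x *\<^sub>C b) = x"
proof -
  define S where "S = {x. (\<Sum>b\<in>B. cinner b x *\<^sub>C b) = x}"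
  have "csubspace S"
  proof (rule complex_vector.subspaceI)
    fix c x assume "x \<in> S"
    then have x: "(\<Sum>b\<in>B. cinner b x *\<^sub>C b) = x" by (simp add: S_def)
    have "(\<Sum>b\<in>B. cinner b (c *\<^sub>C x) *\<^sub>C b) = c *\<^sub>C (\<Sum>b\<in>B. cinner b x *\<^sub>C b)"
      by (simp add: complex_vector.scale_sum_right)
    then show "c *\<^sub>C x \<in> S" by (simp add: S_def x)
  qed (simp_all add: S_def cinner.add_right scaleC.add_left sum.distrib)
  moreover have "b \<in> S" if "b \<in> B" for b
  proof -
    have "(\<Sum>b'\<in>B. cinner b' b *\<^sub>C b') = (\<Sum>b'\<in>B. if b' = b then b else 0)"
      by (intro sum.cong refl) (use orthonormal_familyD[OF B(1) _ that] complex_vector.scale_one in auto)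
    then show ?thesis using that B(2) by (simp add: S_def)
  qed
  ultimately have "cspan B \<subseteq> S" by (intro complex_vector.span_minimal) auto
  moreover have "closed S"
    unfolding S_def by (intro closed_Collect_eq continuous_intros scaleC.continuous_on cinner.continuous_on)
  ultimately have "closure (cspan B) \<subseteq> S" by (rule closure_minimal)
  then show ?thesis using x by (auto simp: S_def)
qed

lemma closure_cspan_finite:
  assumes "orthonormal_family id B" "finite B"
  shows "closure (cspan B) = cspan B"
proof
  show "closure (cspan B) \<subseteq> cspan B"
  proof
    fix x assume x: "x \<in> closure (cspan B)"
    have "(\<Sum>b\<in>B. cinner b x *\<^sub>C b) \<in> cspan B"
      by (intro complex_vector.span_sum complex_vector.span_scale complex_vector.span_base)
    then show "x \<in> cspan B" using orthonormal_expansion[OF assms x] by simp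
  qed
qed (rule closure_subset)

text \<open>Writing the functionals with an operator \<open>T b\<close> inside covers orthonormal
  sets, with the identity, as well as the coordinates taken after an oblique projection.\<close>

lemma biorthogonal_independent:
  assumes T: "\<And>b. b \<in> B \<Longrightarrow> clinear_op (T b)"
    and bio: "\<And>b b'. b \<in> B \<Longrightarrow> b' \<in> B \<Longrightarrow> cinner b (blinfun_apply (T b) b') = (if b = b' then 1 else 0)"
  shows "complex_vector.independent B"
  unfolding complex_vector.independent_explicit_finite_subsets
proof (intro allI impI ballI)
  fix S u v assume S: "S \<subseteq> B" "finite S" and z: "(\<Sum>v\<in>S. u v *\<^sub>C v) = 0" and v: "v \<in> S"
  have vB: "v \<in> B" using v S by blast
  have "0 = cinner v (T v (\<Sum>w\<in>S. u w *\<^sub>C w))" by (simp add: z blinfun.zero_right)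
  also have "\<dots> = (\<Sum>w\<in>S. if w = v then u w else 0)"
    unfolding blinfun.sum_right cinner.sum_right
    by (intro sum.cong refl) (use S vB bio[OF vB] in \<open>auto simp: clinear_opD[OF T[OF vB]]\<close>)
  also have "\<dots> = u v" using v S by simp
  finally show "u v = 0" by simp
qed

lemma orthonormal_independent:
  assumes "orthonormal_family id B"
  shows "complex_vector.independent B"
  by (rule biorthogonal_independent[where T = "\<lambda>_. id_blinfun"])
    (use orthonormal_familyD[OF assms] in \<open>auto simp: clinear_op_def\<close>)

text \<open>All comparisons of dimensions below go through this counting of independent sets, so
  that finiteness is part of the outcome.\<close>

lemma card_le_injective_image:
  fixes T :: "'a::chilbert_space \<Rightarrow>\<^sub>L 'b::chilbert_space"
  assumes C: "complex_vector.independent C" "C \<subseteq> V" and V: "csubspace V"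
    and T: "clinear_op T" "\<And>x. x \<in> V \<Longrightarrow> T x = 0 \<Longrightarrow> x = 0"
    and D: "T ` V \<subseteq> cspan D" "finite D"
  shows "finite C \<and> card C \<le> card D"
proof -
  interpret T: module_hom "scaleC :: complex \<Rightarrow> 'a \<Rightarrow> 'a" "scaleC :: complex \<Rightarrow> 'b \<Rightarrow> 'b" T
    by unfold_locales (simp_all add: blinfun.add_right clinear_opD[OF T(1)])
  have sub: "cspan C \<subseteq> V" using C(2) V by (rule complex_vector.span_minimal)
  have inj: "inj_on T V"
  proof (rule inj_onI)
    fix x y assume "x \<in> V" "y \<in> V" "T x = T y"
    then have "x - y = 0" by (intro T(2) complex_vector.subspace_diff[OF V]) (auto simp: blinfun.diff_right)
    then show "x = y" by simp
  qed
  have "complex_vector.independent (T ` C)"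
    by (rule T.independent_injective_image[OF C(1)], fold cspan_def) (rule inj_on_subset[OF inj sub])
  moreover have "T ` C \<subseteq> cspan D" using C(2) D(1) by blast
  ultimately have "finite (T ` C) \<and> card (T ` C) \<le> card D"
    by (rule complex_vector.independent_span_bound[OF D(2)])
  moreover have "inj_on T C" by (rule inj_on_subset[OF inj C(2)])
  ultimately show ?thesis by (simp add: finite_image_iff card_image)
qed

lemma cdim_le_spanning:
  assumes "cdim_le V n"
  obtains D where "finite D" "card D \<le> n" "V \<subseteq> cspan D"
proof -
  obtain F where F: "finite F" "V \<subseteq> cspan F" and n: "cdim V \<le> n" using assms unfolding cdim_le_def by blast
  obtain D where D: "D \<subseteq> V" "complex_vector.independent D" "V \<subseteq> cspan D" "card D = cdim V"
    by (rule complex_vector.basis_exists)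
  have "finite D" using complex_vector.independent_span_bound[OF F(1) D(2)] D(1) F(2) by blast
  then show thesis using that D n by simp
qed

text \<open>One Gram-Schmidt step makes \<open>m\<close> corrections of size at most \<open>(2 * g + 1) * \<epsilon>\<close>, and the normalization
  doubles the error.\<close>

primrec gram_schmidt_const :: "nat \<Rightarrow> real"
  where "gram_schmidt_const 0 = 1"
  | "gram_schmidt_const (Suc m) = 2 * (1 + real m * (2 * gram_schmidt_const m + 1))"

lemma gram_schmidt_const_ge_1: "1 \<le> gram_schmidt_const m"
proof (induction m)
  case (Suc m)
  then show ?case by (auto intro: add_increasing2 mult_nonneg_nonneg)
qed simp

lemma gram_schmidt_const_Suc: "gram_schmidt_const m \<le> gram_schmidt_const (Suc m)"
proof (cases "m = 0")
  case False
  have step: "g \<le> 2 * (1 + c * (2 * g + 1))" if "1 \<le> g" "1 \<le> c" for g c :: real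
  proof -
    have "0 \<le> (c - 1) * (2 * g + 1)" using that by (intro mult_nonneg_nonneg) auto
    then have "2 * g + 1 \<le> c * (2 * g + 1)" by (simp add: left_diff_distrib)
    moreover have "0 \<le> g" using that by simp
    ultimately have "g \<le> 1 + c * (2 * g + 1)" "0 \<le> 1 + c * (2 * g + 1)" by linarith+
    then show ?thesis by simp
  qed
  show ?thesis
    unfolding gram_schmidt_const.simps by (rule step) (use False gram_schmidt_const_ge_1 in auto)
qed simp

lemma gram_schmidt_const_mono: "m \<le> n \<Longrightarrow> gram_schmidt_const m \<le> gram_schmidt_const n"
  by (rule lift_Suc_mono_le[of gram_schmidt_const, OF gram_schmidt_const_Suc])

text \<open>\<open>B\<close> is its own index set: \<open>\<phi> b\<close> is the partner of
  \<open>b\<close>. By the last hypothesis the vector \<open>w\<close> of each step has distance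
  less than \<open>1/2\<close> from the unit vector \<open>b\<close>, hence is nonzero and can be
  normalized.\<close>

lemma gram_schmidt_perturbation:
  assumes "finite B" "orthonormal_family id B" "csubspace M"
    and "\<And>b. b \<in> B \<Longrightarrow> v b \<in> M" "\<And>b. b \<in> B \<Longrightarrow> norm (v b - b) \<le> \<epsilon>"
    and "0 \<le> \<epsilon>" "gram_schmidt_const (card B) * \<epsilon> < 1"
  shows "\<exists>\<phi>. orthonormal_family \<phi> B \<and>
    (\<forall>b\<in>B. \<phi> b \<in> M \<and> norm (\<phi> b - b) \<le> gram_schmidt_const (card B) * \<epsilon>)"
  using assms
proof (induction B rule: finite_induct)
  case (insert b B)
  define g where "g = gram_schmidt_const (card B)"
  define g' where "g' = gram_schmidt_const (card (insert b B))"
  have g': "g' = 2 * (1 + real (card B) * (2 * g + 1))" using insert.hyps by (simp add: g'_def g_def)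
  have g1: "1 \<le> g" and gg: "g \<le> g'"
    using gram_schmidt_const_ge_1 gram_schmidt_const_Suc[of "card B"] insert.hyps by (auto simp: g_def g'_def)
  have g\<epsilon>: "g * \<epsilon> \<le> g' * \<epsilon>" using gg insert.prems(5) by (rule mult_right_mono)
  have lt: "g' * \<epsilon> < 1" using insert.prems(6) by (simp add: g'_def)
  have "orthonormal_family id B" using insert.prems(1) orthonormal_family_mono by blast
  then obtain \<phi> where \<phi>: "orthonormal_family \<phi> B" "\<And>a. a \<in> B \<Longrightarrow> \<phi> a \<in> M"
    "\<And>a. a \<in> B \<Longrightarrow> norm (\<phi> a - a) \<le> g * \<epsilon>"
  proof -
    have "gram_schmidt_const (card B) * \<epsilon> < 1" using g\<epsilon> lt unfolding g_def by linarith
    from insert.IH[OF \<open>orthonormal_family id B\<close> insert.prems(2) insert.prems(3)[OF insertI2]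
        insert.prems(4)[OF insertI2] insert.prems(5) this]
    show thesis using that unfolding g_def by blast
  qed
  define w where "w = v b - (\<Sum>a\<in>B. cinner (\<phi> a) (v b) *\<^sub>C \<phi> a)"
  have \<epsilon>1: "\<epsilon> \<le> 1" using g1 g\<epsilon> lt mult_right_mono[OF g1 insert.prems(5)] by linarith
  have nb: "norm b = 1" using orthonormal_family_norm[OF insert.prems(1), of b] by simp
  have nv: "norm (v b) \<le> 2"
    using norm_triangle_sub[of "v b" b] insert.prems(4)[of b] nb \<epsilon>1 by simp
  have coeff: "norm (cinner (\<phi> a) (v b) *\<^sub>C \<phi> a) \<le> (2 * g + 1) * \<epsilon>" if a: "a \<in> B" for a
  proof -
    have "a \<noteq> b" using a insert.hyps by blast
    then have "cinner a b = 0" using orthonormal_familyD[OF insert.prems(1), of a b] a by simp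
    \<comment> \<open>Since \<open>a\<close> and \<open>b\<close> are orthogonal, the coefficient
      splits into two small terms, of size at most \<open>2 * g * \<epsilon>\<close> and
      \<open>\<epsilon>\<close>.\<close>
    then have "cinner (\<phi> a) (v b) = cinner (\<phi> a - a) (v b) + cinner a (v b - b)"
      by (simp add: cinner.diff_left cinner.diff_right)
    then have "cmod (cinner (\<phi> a) (v b)) \<le> cmod (cinner (\<phi> a - a) (v b)) + cmod (cinner a (v b - b))"
      by (metis norm_triangle_ineq)
    also have "\<dots> \<le> norm (\<phi> a - a) * norm (v b) + norm a * norm (v b - b)"
      by (intro add_mono cmod_cinner_le)
    also have "\<dots> \<le> (g * \<epsilon>) * 2 + 1 * \<epsilon>"
      using orthonormal_family_norm[OF insert.prems(1), of a] a g1 insert.prems(5)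
      by (intro add_mono mult_mono \<phi>(3) nv insert.prems(4)) auto
    finally show ?thesis using orthonormal_family_norm[OF \<phi>(1) a] by (simp add: algebra_simps)
  qed
  have "norm (w - b) \<le> norm (v b - b) + norm (\<Sum>a\<in>B. cinner (\<phi> a) (v b) *\<^sub>C \<phi> a)"
    using norm_triangle_ineq4[of "v b - b" "\<Sum>a\<in>B. cinner (\<phi> a) (v b) *\<^sub>C \<phi> a"]
    by (simp add: w_def algebra_simps)
  also have "\<dots> \<le> \<epsilon> + real (card B) * ((2 * g + 1) * \<epsilon>)"
    by (intro add_mono insert.prems(4) sum_norm_bound coeff) auto
  also have "\<dots> = g' * \<epsilon> / 2" by (simp add: g' algebra_simps)
  finally have wb: "norm (w - b) \<le> g' * \<epsilon> / 2" .
  have nw: "\<bar>norm w - 1\<bar> \<le> norm (w - b)" using norm_triangle_ineq3[of w b] nb by simp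
  have w0: "norm w > 0" using nw wb lt by linarith
  define \<phi>b where "\<phi>b = complex_of_real (1 / norm w) *\<^sub>C w"
  have orth: "cinner (\<phi> a) \<phi>b = 0" if "a \<in> B" for a
    by (simp add: \<phi>b_def w_def cinner.diff_right cinner_orthonormal_sum[OF \<phi>(1) insert.hyps(1) that])
  have "norm \<phi>b = 1" using w0 by (simp add: \<phi>b_def norm_divide)
  then have self: "cinner \<phi>b \<phi>b = 1" by (simp add: cinner_self)
  \<comment> \<open>Rescaling moves \<open>w\<close> by \<open>abs (1 - norm w)\<close>, which is at
    most its distance from the unit vector \<open>b\<close>.\<close>
  have "\<phi>b - w = (1 / norm w - 1) *\<^sub>R w" by (simp only: \<phi>b_def scaleC_of_real scaleR_left_diff_distrib scaleR_one)
  then have "norm (\<phi>b - w) = \<bar>1 / norm w - 1\<bar> * norm w" by simp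
  also have "\<dots> = \<bar>(1 / norm w - 1) * norm w\<bar>" by (simp add: abs_mult)
  also have "(1 / norm w - 1) * norm w = 1 - norm w" using w0 by (simp add: left_diff_distrib)
  finally have "norm (\<phi>b - w) \<le> norm (w - b)" using nw by (simp add: abs_minus_commute)
  then have close: "norm (\<phi>b - b) \<le> g' * \<epsilon>"
    using norm_triangle_ineq[of "\<phi>b - w" "w - b"] wb by simp
  have "w \<in> M" unfolding w_def
    by (intro complex_vector.subspace_diff complex_vector.subspace_sum complex_vector.subspace_scale
        insert.prems \<phi>) auto
  then have inM: "\<phi>b \<in> M" unfolding \<phi>b_def by (intro complex_vector.subspace_scale insert.prems)
  have "orthonormal_family (\<phi>(b := \<phi>b)) (insert b B)"
    unfolding orthonormal_family_def
  proof (intro ballI)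
    fix i j assume "i \<in> insert b B" "j \<in> insert b B"
    then show "cinner ((\<phi>(b := \<phi>b)) i) ((\<phi>(b := \<phi>b)) j) = (if i = j then 1 else 0)"
      using orth self orthonormal_familyD[OF \<phi>(1)] insert.hyps(2) cinner_sym_zero[of \<phi>b] by auto
  qed
  moreover have "\<forall>a\<in>insert b B. (\<phi>(b := \<phi>b)) a \<in> M \<and> norm ((\<phi>(b := \<phi>b)) a - a) \<le> g' * \<epsilon>"
  proof
    fix a assume "a \<in> insert b B"
    then show "(\<phi>(b := \<phi>b)) a \<in> M \<and> norm ((\<phi>(b := \<phi>b)) a - a) \<le> g' * \<epsilon>"
      using \<phi>(2,3)[of a] inM close g\<epsilon> by (cases "a = b") auto
  qed
  ultimately show ?case unfolding g'_def by blast
qed (auto simp: orthonormal_family_def)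

lemma orthonormal_extend:
  assumes "orthonormal_family id C" "y \<noteq> 0" "\<And>c. c \<in> C \<Longrightarrow> cinner c y = 0"
  defines "u \<equiv> complex_of_real (1 / norm y) *\<^sub>C y"
  shows "orthonormal_family id (insert u C)" "u \<notin> C"
proof -
  have u: "norm u = 1" using assms(2) by (simp add: u_def norm_divide)
  then have uu: "cinner u u = 1" by (simp add: cinner_self)
  have cu: "cinner c u = 0" if "c \<in> C" for c using assms(3)[OF that] by (simp add: u_def)
  then show "u \<notin> C" using uu by force
  then show "orthonormal_family id (insert u C)"
    using orthonormal_familyD[OF assms(1)] uu cu cinner_sym_zero[of u]
    unfolding orthonormal_family_def by auto
qed

subsection \<open>Bari bases\<close>

text \<open>\<open>E\<close> may be oblique, \<open>F\<close> is orthogonal. \<open>close\<close>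
  controls the single blocks far out; \<open>close_sum\<close> makes the partial sums of the two
  families have equal rank from some index on.\<close>

locale close_projections = E: projection_sequence E + F: projection_sequence F
  for E F :: "nat \<Rightarrow> ('a::chilbert_space \<Rightarrow>\<^sub>L 'a)" +
  fixes B :: "nat \<Rightarrow> 'a set" and n :: nat
  assumes F_orth: "\<And>k. orth_projection (F k)"
    and close: "summable (\<lambda>k. (norm (E k - F k))\<^sup>2)"
    and close_sum: "(\<lambda>j. (\<Sum>k\<le>j. E k) - (\<Sum>k\<le>j. F k)) \<longlonglongrightarrow> 0"
    and dims: "\<And>k. cdim_le (range (F k)) n"
    and B: "\<And>k. orthonormal_basis_of (B k) (range (E k))"
    and F_nonzero: "\<And>k. \<exists>x. F k x \<noteq> 0"
begin

abbreviation "SE \<equiv> E.partial_sum"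
abbreviation "SF \<equiv> F.partial_sum"
lemmas SE_def = E.partial_sum_def and SF_def = F.partial_sum_def

lemma SE_range: "x \<in> range (E k) \<Longrightarrow> k \<le> j \<Longrightarrow> SE j x = x"
proof -
  assume x: "x \<in> range (E k)" and k: "k \<le> j"
  have x': "E k x = x" using x by (simp only: E.range_E_iff)
  have "E i x = (if i = k then x else 0)" for i
    using x' E.E_orth[of i k x] by (cases "i = k") auto
  then show "SE j x = x" using k by (simp add: SE_def blinfun.sum_left)
qed

lemma csubspace_range: "clinear_op T \<Longrightarrow> csubspace (range (blinfun_apply T))" for T :: "'a \<Rightarrow>\<^sub>L 'a"
proof (rule complex_vector.subspaceI)
  assume T: "clinear_op T"
  have "T 0 = 0" by (rule blinfun.zero_right)
  then show "0 \<in> range T" by (metis rangeI)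
  show "x + y \<in> range T" if xy: "x \<in> range T" "y \<in> range T" for x y
  proof -
    from xy obtain a b where "x = T a" "y = T b" by blast
    then have "x + y = T (a + b)" by (simp add: blinfun.add_right)
    then show ?thesis by simp
  qed
  show "c *\<^sub>C x \<in> range T" if x: "x \<in> range T" for c x
  proof -
    from x obtain a where "x = T a" by blast
    then have "c *\<^sub>C x = T (c *\<^sub>C a)" by (simp add: clinear_opD[OF T])
    then show ?thesis by simp
  qed
qed

text \<open>Each of two idempotents at distance less than \<open>1\<close> is injective on the range
  of the other. Used in both directions, this equates dimensions.\<close>

lemma injective_of_close:
  fixes S T :: "'a \<Rightarrow>\<^sub>L 'a"
  assumes "norm (S - T) < 1" "S x = x" "T x = 0"
  shows "x = 0"
proof -
  have "norm x \<le> norm (S - T) * norm x" using norm_blinfun[of "S - T" x] assms by (simp add: blinfun.diff_left)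
  then have "(1 - norm (S - T)) * norm x \<le> 0" by (simp add: algebra_simps)
  then show ?thesis using assms(1) by (simp add: mult_le_0_iff)
qed

lemma B_sub: "b \<in> B k \<Longrightarrow> E k b = b"
  using B[of k] E.range_E_iff[of b k] unfolding orthonormal_basis_of_def by blast

lemma B_orthonormal: "orthonormal_family id (B k)"
  using B[of k] unfolding orthonormal_basis_of_def orthonormal_family_def by simp

lemma B_closure: "closure (cspan (B k)) = range (E k)"
  using B[of k] unfolding orthonormal_basis_of_def by simp

lemma B_disjoint:
  assumes "b \<in> B k" "b \<in> B k'"
  shows "k = k'"
proof (rule ccontr)
  assume "k \<noteq> k'"
  then have "b = 0" using E.E_orth[of k k' b] B_sub assms by simp
  then show False using orthonormal_family_norm[OF B_orthonormal assms(1)] by simp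
qed

definition block_of where "block_of b = (THE k. b \<in> B k)"

lemma block_of: "b \<in> B k \<Longrightarrow> block_of b = k"
  unfolding block_of_def using B_disjoint by blast

text \<open>The oblique projection comes before the inner product, so that this functional vanishes
  on all blocks other than that of \<open>b\<close>.\<close>

definition coef where "coef b x = cinner b (E (block_of b) x)"

lemma coef_biorthogonal:
  assumes "b \<in> (\<Union>k. B k)" "b' \<in> (\<Union>k. B k)"
  shows "coef b b' = (if b = b' then 1 else 0)"
proof -
  obtain k k' where k: "b \<in> B k" "b' \<in> B k'" using assms by blast
  show ?thesis
  proof (cases "k = k'")
    case True
    then show ?thesis
      using orthonormal_familyD[OF B_orthonormal k(1), of b'] k B_sub[OF k(2)] by (simp add: coef_def block_of)
  next
    case False
    then have "E k b' = 0" using E.E_orth[of k k' b'] B_sub[OF k(2)] by simp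
    moreover have "b \<noteq> b'" using False B_disjoint k by blast
    ultimately show ?thesis using k by (simp add: coef_def block_of)
  qed
qed

lemma independent_B: "S \<subseteq> (\<Union>k. B k) \<Longrightarrow> complex_vector.independent S"
  using coef_biorthogonal
  by (intro biorthogonal_independent[where T = "\<lambda>b. E (block_of b)"])
    (auto simp: coef_def subset_iff intro: E.E_clinear)

lemma close_tendsto: "(\<lambda>k. norm (E k - F k)) \<longlonglongrightarrow> 0"
proof -
  have "(\<lambda>k. sqrt ((norm (E k - F k))\<^sup>2)) \<longlonglongrightarrow> sqrt 0"
    by (intro tendsto_real_sqrt summable_LIMSEQ_zero close)
  then show ?thesis by simp
qed

lemma good_index:
  obtains J where "\<And>k. k \<ge> J \<Longrightarrow> gram_schmidt_const n * norm (E k - F k) < 1"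
    "\<And>k. k \<ge> J \<Longrightarrow> norm (SE k - SF k) < 1"
proof -
  have "(\<lambda>k. gram_schmidt_const n * norm (E k - F k)) \<longlonglongrightarrow> gram_schmidt_const n * 0"
    by (intro tendsto_intros close_tendsto)
  then have "eventually (\<lambda>k. gram_schmidt_const n * norm (E k - F k) < 1) sequentially"
    by (intro order_tendstoD) auto
  moreover have "eventually (\<lambda>k. norm (SE k - SF k) < 1) sequentially"
    using order_tendstoD(2)[OF tendsto_norm[OF close_sum], of 1] by (simp add: SE_def SF_def)
  ultimately have "eventually (\<lambda>k. gram_schmidt_const n * norm (E k - F k) < 1 \<and> norm (SE k - SF k) < 1) sequentially"
    by (rule eventually_conj)
  then show thesis using that unfolding eventually_sequentially by blast
qed

text \<open>From \<open>J\<close> on every block admits the Gram-Schmidt perturbation. Below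
  \<open>J\<close> the blocks \<open>E k\<close> and \<open>F k\<close> may have different
  dimensions, but the sums up to \<open>J\<close> have the same rank.\<close>

definition good :: "nat \<Rightarrow> bool"
  where "good J \<longleftrightarrow> (\<forall>k\<ge>J. gram_schmidt_const n * norm (E k - F k) < 1) \<and> norm (SE J - SF J) < 1"

definition J where "J = (SOME J. good J)"

lemma good_J: "good J"
proof -
  obtain J' where "\<And>k. k \<ge> J' \<Longrightarrow> gram_schmidt_const n * norm (E k - F k) < 1"
    "\<And>k. k \<ge> J' \<Longrightarrow> norm (SE k - SF k) < 1" using good_index by metis
  then have "good J'" unfolding good_def by blast
  then show ?thesis unfolding J_def by (rule someI)
qed

lemma J: "k \<ge> J \<Longrightarrow> gram_schmidt_const n * norm (E k - F k) < 1" "norm (SE J - SF J) < 1"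
  using good_J unfolding good_def by blast+

lemma close_lt_1: "k \<ge> J \<Longrightarrow> norm (E k - F k) < 1"
proof -
  assume "k \<ge> J"
  then show ?thesis
    using J(1)[of k] mult_right_mono[OF gram_schmidt_const_ge_1, of "norm (E k - F k)" n] by simp
qed

lemma finite_B_high:
  assumes "k \<ge> J"
  shows "finite (B k)" "card (B k) \<le> n"
proof -
  obtain D where D: "finite D" "card D \<le> n" "range (F k) \<subseteq> cspan D" using cdim_le_spanning[OF dims] .
  have "finite (B k) \<and> card (B k) \<le> card D"
  proof (rule card_le_injective_image[where V = "range (E k)" and T = "F k"])
    show "B k \<subseteq> range (E k)" using B_sub by (metis rangeI subsetI)
    show "x = 0" if "x \<in> range (E k)" "F k x = 0" for x
      using injective_of_close[OF close_lt_1[OF assms]] that by (simp add: E.range_E_iff)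
    show "F k ` range (E k) \<subseteq> cspan D" using D(3) by auto
    show "complex_vector.independent (B k)" by (rule independent_B) blast
    show "csubspace (range (E k))" by (rule E.csubspace_range_E)
  qed (use D F.E_clinear in auto)
  then show "finite (B k)" "card (B k) \<le> n" using D(2) by auto
qed

text \<open>Block \<open>J\<close> counts as low: the partners of block \<open>k\<close> are
  obtained by Gram-Schmidt only for \<open>k > J\<close>.\<close>

definition low where "low = (\<Union>k\<le>J. B k)"

lemma range_SF_spanned:
  obtains D where "finite D" "range (SF J) \<subseteq> cspan D"
proof -
  have "\<forall>k. \<exists>D. finite D \<and> range (F k) \<subseteq> cspan D"
    using cdim_le_spanning[OF dims] by metis
  then obtain D where D: "\<And>k. finite (D k)" "\<And>k. range (F k) \<subseteq> cspan (D k)" by metis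
  show thesis
  proof (rule that[of "\<Union>k\<le>J. D k"])
    show "range (SF J) \<subseteq> cspan (\<Union>k\<le>J. D k)"
    proof safe
      fix x
      have "F k x \<in> cspan (\<Union>k\<le>J. D k)" if "k \<le> J" for k
      proof -
        have "cspan (D k) \<subseteq> cspan (\<Union>k\<le>J. D k)" using that by (intro complex_vector.span_mono) auto
        then show ?thesis using D(2)[of k] by blast
      qed
      then show "SF J x \<in> cspan (\<Union>k\<le>J. D k)"
        unfolding SF_def blinfun.sum_left by (intro complex_vector.span_sum) auto
    qed
  qed (use D in auto)
qed

lemma low_sub: "low \<subseteq> range (SE J)"
proof
  fix b assume "b \<in> low"
  then obtain k where "k \<le> J" "b \<in> B k" unfolding low_def by blast
  then have "SE J b = b" using SE_range B_sub by (metis rangeI)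
  then show "b \<in> range (SE J)" by (metis rangeI)
qed

lemma SF_injective: "x \<in> range (SE J) \<Longrightarrow> SF J x = 0 \<Longrightarrow> x = 0"
  using injective_of_close[OF J(2)] E.partial_sum_idem by auto

lemma SE_injective: "x \<in> range (SF J) \<Longrightarrow> SE J x = 0 \<Longrightarrow> x = 0"
  using injective_of_close[of "SF J" "SE J"] J(2) F.partial_sum_idem by (auto simp: norm_minus_commute)

lemma card_low_le:
  assumes "finite D" "range (SF J) \<subseteq> cspan D"
  shows "finite low" "card low \<le> card D"
proof -
  have "finite low \<and> card low \<le> card D"
  proof (rule card_le_injective_image[where V = "range (SE J)" and T = "SF J"])
    show "SF J ` range (SE J) \<subseteq> cspan D" using assms(2) by auto
    show "complex_vector.independent low" by (rule independent_B) (auto simp: low_def)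
    show "csubspace (range (SE J))" by (rule csubspace_range[OF E.partial_sum_clinear])
  qed (use assms(1) low_sub F.partial_sum_clinear SF_injective in auto)
  then show "finite low" "card low \<le> card D" by auto
qed

lemma finite_low: "finite low"
  using range_SF_spanned card_low_le by metis

lemma finite_B: "finite (B k)"
proof (cases "k \<le> J")
  case True
  then show ?thesis using finite_low finite_subset[of "B k" low] by (auto simp: low_def)
qed (use finite_B_high in simp)

lemma B_span: "cspan (B k) = range (E k)"
  using closure_cspan_finite[OF B_orthonormal finite_B] B_closure by simp

lemma range_SE_sub: "range (SE J) \<subseteq> cspan low"
proof safe
  fix x
  have "E k x \<in> cspan low" if "k \<le> J" for k
  proof -
    have "cspan (B k) \<subseteq> cspan low" using that by (intro complex_vector.span_mono) (auto simp: low_def)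
    then show ?thesis using B_span[of k] by blast
  qed
  then show "SE J x \<in> cspan low"
    unfolding SE_def blinfun.sum_left by (intro complex_vector.span_sum) auto
qed

text \<open>Totality instead of spanning, because this is the form of completeness that
  \<open>orthonormal_basisI\<close> asks for.\<close>

definition total_in :: "('i \<Rightarrow> 'a) \<Rightarrow> 'i set \<Rightarrow> 'a set \<Rightarrow> bool"
  where "total_in \<phi> S V \<longleftrightarrow> (\<forall>y\<in>V. (\<forall>i\<in>S. cinner (\<phi> i) y = 0) \<longrightarrow> y = 0)"

text \<open>\<open>C\<close> is an orthonormal subset of \<open>range (SF J)\<close> of largest
  cardinality, which exists because injectivity of \<open>SE J\<close> there bounds the
  cardinalities by \<open>card low\<close>. Maximality makes \<open>C\<close> span the range, and
  injectivity of \<open>SF J\<close> on \<open>range (SE J)\<close> then gives the reverse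
  inequality.\<close>

lemma low_basis:
  "\<exists>C. finite C \<and> card C = card low \<and> orthonormal_family id C \<and> C \<subseteq> range (SF J) \<and>
    total_in id C (range (SF J))"
proof -
  define \<C> where "\<C> C \<longleftrightarrow> orthonormal_family id C \<and> C \<subseteq> range (SF J)" for C
  have bound: "finite C \<and> card C \<le> card low" if "\<C> C" for C
  proof (rule card_le_injective_image[where V = "range (SF J)" and T = "SE J"])
    show "SE J ` range (SF J) \<subseteq> cspan low" using range_SE_sub by auto
    show "complex_vector.independent C"
      by (rule orthonormal_independent) (use that in \<open>simp add: \<C>_def\<close>)
    show "csubspace (range (SF J))" by (rule csubspace_range[OF F.partial_sum_clinear])
    show "C \<subseteq> range (SF J)" using that by (simp add: \<C>_def)
  qed (use finite_low E.partial_sum_clinear SE_injective in auto)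
  have C0: "\<C> {}" by (simp add: \<C>_def orthonormal_family_def)
  have C1: "\<forall>C. \<C> C \<longrightarrow> card C < Suc (card low)" using bound by (simp add: less_Suc_eq_le)
  obtain C where "\<C> C \<and> (\<forall>C'. \<C> C' \<longrightarrow> card C' \<le> card C)"
    using ex_has_greatest_nat[of \<C> "{}" card, OF C0 C1] by (elim exE)
  then have C: "\<C> C" "\<And>C'. \<C> C' \<Longrightarrow> card C' \<le> card C" by simp_all
  have fin: "finite C" using bound[OF C(1)] by simp
  have complete: "y = 0" if y: "y \<in> range (SF J)" "\<And>c. c \<in> C \<Longrightarrow> cinner c y = 0" for y
  proof (rule ccontr)
    assume "y \<noteq> 0"
    define u where "u = complex_of_real (1 / norm y) *\<^sub>C y"
    have on: "orthonormal_family id C" using C(1) by (simp add: \<C>_def)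
    note ext = orthonormal_extend[OF on \<open>y \<noteq> 0\<close> y(2), folded u_def]
    have "u \<in> range (SF J)" unfolding u_def
      using y(1) by (rule complex_vector.subspace_scale[OF csubspace_range[OF F.partial_sum_clinear]])
    then have "\<C> (insert u C)" using ext(1) C(1) by (simp add: \<C>_def)
    from C(2)[OF this] show False using ext(2) fin by simp
  qed
  have "range (SF J) \<subseteq> cspan C"
  proof
    fix x assume x: "x \<in> range (SF J)"
    define p where "p = (\<Sum>c\<in>C. cinner c x *\<^sub>C c)"
    have pC: "p \<in> cspan C" unfolding p_def
      by (intro complex_vector.span_sum complex_vector.span_scale complex_vector.span_base)
    have "cspan C \<subseteq> range (SF J)"
      using C(1) by (intro complex_vector.span_minimal csubspace_range[OF F.partial_sum_clinear]) (simp add: \<C>_def)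
    then have "x - p \<in> range (SF J)"
      using x pC by (intro complex_vector.subspace_diff csubspace_range[OF F.partial_sum_clinear]) auto
    moreover have "cinner c (x - p) = 0" if "c \<in> C" for c
    proof -
      have "orthonormal_family id C" using C(1) by (simp add: \<C>_def)
      from cinner_orthonormal_sum[OF this fin that, of "\<lambda>c. cinner c x"]
      show ?thesis by (simp add: p_def cinner.diff_right)
    qed
    ultimately have "x - p = 0" by (rule complete)
    then show "x \<in> cspan C" using pC by simp
  qed
  then have "card low \<le> card C" by (rule card_low_le(2)[OF fin])
  then have "card C = card low" using bound[OF C(1)] by simp
  moreover have "orthonormal_family id C" "C \<subseteq> range (SF J)" using C(1) by (simp_all add: \<C>_def)
  moreover have "total_in id C (range (SF J))" unfolding total_in_def using complete by simp
  ultimately show ?thesis using fin by blast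
qed

definition partner :: "nat \<Rightarrow> ('a \<Rightarrow> 'a) \<Rightarrow> bool"
  where "partner k \<phi> \<longleftrightarrow> orthonormal_family \<phi> (B k) \<and> (\<forall>b\<in>B k. F k (\<phi> b) = \<phi> b) \<and>
    (\<forall>b\<in>B k. norm (\<phi> b - b) \<le> gram_schmidt_const n * norm (E k - F k)) \<and>
    total_in \<phi> (B k) (range (F k))"

text \<open>The vectors come from orthonormalizing \<open>F k b\<close>. Totality is a count: a
  nonzero vector of \<open>range (F k)\<close> orthogonal to all of them would give one more
  independent vector than \<open>B k\<close> has, but \<open>E k\<close> maps this range injectively
  into the span of \<open>B k\<close>.\<close>

lemma high_basis:
  assumes k: "k \<ge> J"
  shows "\<exists>\<phi>. partner k \<phi>"
proof -
  define \<epsilon> where "\<epsilon> = norm (E k - F k)"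
  have gs: "gram_schmidt_const (card (B k)) * \<epsilon> \<le> gram_schmidt_const n * \<epsilon>"
    by (intro mult_right_mono gram_schmidt_const_mono finite_B_high[OF k]) (simp add: \<epsilon>_def)
  have "\<exists>\<phi>. orthonormal_family \<phi> (B k) \<and>
    (\<forall>b\<in>B k. \<phi> b \<in> range (F k) \<and> norm (\<phi> b - b) \<le> gram_schmidt_const (card (B k)) * \<epsilon>)"
  proof (rule gram_schmidt_perturbation[where v = "F k"])
    show "norm (F k b - b) \<le> \<epsilon>" if "b \<in> B k" for b
    proof -
      have "norm ((E k - F k) b) \<le> \<epsilon> * norm b" unfolding \<epsilon>_def by (rule norm_blinfun)
      then show ?thesis
        using orthonormal_family_norm[OF B_orthonormal that] B_sub[OF that]
        by (simp add: blinfun.diff_left norm_minus_commute)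
    qed
    show "gram_schmidt_const (card (B k)) * \<epsilon> < 1" using gs J(1)[OF k] unfolding \<epsilon>_def by linarith
  qed (use finite_B B_orthonormal F.csubspace_range_E in \<open>auto simp: \<epsilon>_def\<close>)
  then obtain \<phi> where \<phi>: "orthonormal_family \<phi> (B k)" "\<And>b. b \<in> B k \<Longrightarrow> \<phi> b \<in> range (F k)"
    "\<And>b. b \<in> B k \<Longrightarrow> norm (\<phi> b - b) \<le> gram_schmidt_const (card (B k)) * \<epsilon>" by blast
  have complete: "y = 0" if y: "F k y = y" "\<And>b. b \<in> B k \<Longrightarrow> cinner (\<phi> b) y = 0" for y
  proof (rule ccontr)
    assume "y \<noteq> 0"
    define u where "u = complex_of_real (1 / norm y) *\<^sub>C y"
    note im = orthonormal_family_image[OF \<phi>(1)]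
    note ext = orthonormal_extend[OF im(2) \<open>y \<noteq> 0\<close>, folded u_def]
    have y0: "cinner c y = 0" if "c \<in> \<phi> ` B k" for c using y(2) that by auto
    have "u \<in> range (F k)" unfolding u_def
      using y(1) by (intro complex_vector.subspace_scale F.csubspace_range_E) (simp add: F.range_E_iff)
    then have sub: "insert u (\<phi> ` B k) \<subseteq> range (F k)" using \<phi>(2) by auto
    have "card (insert u (\<phi> ` B k)) \<le> card (B k)"
    proof (rule card_le_injective_image[OF orthonormal_independent[OF ext(1)[OF y0]] sub, THEN conjunct2])
      show "x = 0" if "x \<in> range (F k)" "E k x = 0" for x
        using injective_of_close[of "F k" "E k"] close_lt_1[OF k] that
        by (simp add: F.range_E_iff norm_minus_commute)
      show "E k ` range (F k) \<subseteq> cspan (B k)" unfolding B_span by auto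
    qed (use F.csubspace_range_E E.E_clinear finite_B in auto)
    then show False using ext(2)[OF y0] finite_B im(1) by (simp add: card_image)
  qed
  have "partner k \<phi>"
    unfolding partner_def
  proof (intro conjI ballI \<phi>(1))
    show "F k (\<phi> b) = \<phi> b" if "b \<in> B k" for b using \<phi>(2)[OF that] F.range_E_iff by simp
    show "norm (\<phi> b - b) \<le> gram_schmidt_const n * norm (E k - F k)" if "b \<in> B k" for b
      using order_trans[OF \<phi>(3)[OF that] gs] unfolding \<epsilon>_def .
    show "total_in \<phi> (B k) (range (F k))"
      unfolding total_in_def
    proof (intro ballI impI)
      fix y assume "y \<in> range (F k)" "\<forall>b\<in>B k. cinner (\<phi> b) y = 0"
      then show "y = 0" by (intro complete) (simp_all only: F.range_E_iff)
    qed
  qed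
  then show ?thesis by blast
qed

text \<open>The low vectors are matched with \<open>C\<close> by an arbitrary bijection
  \<open>g\<close>, since finitely many of them cannot spoil a convergent sum of squares. Low and
  high partners are orthogonal because \<open>F k\<close> annihilates \<open>range (SF J)\<close>
  for \<open>k > J\<close>.\<close>

lemma orthonormal_partner:
  "\<exists>f. orthonormal_family f (\<Union>k. B k) \<and> total_in f (\<Union>k. B k) UNIV \<and>
    (\<forall>k>J. \<forall>b\<in>B k. norm (f b - b) \<le> gram_schmidt_const n * norm (E k - F k))"
proof -
  obtain C where C: "finite C" "card C = card low" "orthonormal_family id C" "C \<subseteq> range (SF J)"
    "total_in id C (range (SF J))" using low_basis by (elim exE conjE)
  obtain g where g: "bij_betw g low C" using finite_same_card_bij[OF finite_low C(1)] C(2) by auto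
  have "\<exists>\<Phi>. \<forall>k. k \<ge> J \<longrightarrow> partner k (\<Phi> k)" using high_basis by (intro choice) blast
  then obtain \<Phi> where G: "\<And>k. k \<ge> J \<Longrightarrow> partner k (\<Phi> k)" by blast
  have \<Phi>: "orthonormal_family (\<Phi> k) (B k)" "b \<in> B k \<Longrightarrow> F k (\<Phi> k b) = \<Phi> k b"
    "b \<in> B k \<Longrightarrow> norm (\<Phi> k b - b) \<le> gram_schmidt_const n * norm (E k - F k)"
    "total_in (\<Phi> k) (B k) (range (F k))" if "k \<ge> J" for k b
    using G[OF that] by (simp_all add: partner_def)
  define f where "f b = (if block_of b \<le> J then g b else \<Phi> (block_of b) b)" for b
  have f_low: "f b = g b" "b \<in> low" "g b \<in> C" if "b \<in> B k" "k \<le> J" for b k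
  proof -
    show "f b = g b" using that by (simp add: f_def block_of[OF that(1)])
    show l: "b \<in> low" using that unfolding low_def by blast
    show "g b \<in> C" by (rule bij_betwE[OF g, rule_format, OF l])
  qed
  have f_high: "f b = \<Phi> k b" if "b \<in> B k" "k > J" for b k
    using that by (simp add: f_def block_of)
  have SF_f: "SF J c = c" if c: "c \<in> C" for c
  proof -
    have "c \<in> range (SF J)" using C(4) c by (rule subsetD)
    then obtain x where "c = SF J x" by blast
    then show ?thesis by (simp add: F.partial_sum_idem)
  qed
  have symF: "cinner (F k x) y = cinner x (F k y)" for k x y by (rule orth_projection_cinner[OF F_orth])
  have symSF: "cinner (SF J x) y = cinner x (SF J y)" for x y
    unfolding SF_def blinfun.sum_left cinner.sum_left cinner.sum_right by (simp add: symF)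
  have low_high: "cinner c (\<Phi> k b) = 0" if "c \<in> C" "b \<in> B k" "k > J" for c k b
  proof -
    have "cinner c (\<Phi> k b) = cinner c (F k (\<Phi> k b))" using \<Phi>(2)[of k b] that by simp
    also have "\<dots> = cinner (F k (SF J c)) (\<Phi> k b)" using SF_f[OF that(1)] by (simp add: symF)
    also have "\<dots> = 0" using that(3) by (simp add: F.E_partial_sum)
    finally show ?thesis .
  qed
  have cases: "cinner (f b) (f b') = (if b = b' then 1 else 0)" if k: "b \<in> B k" "b' \<in> B k'" and le: "k \<le> k'" for b b' k k'
  proof -
    consider "k' \<le> J" | "k \<le> J" "k' > J" | "k > J" "k = k'" | "k > J" "k < k'" using le by linarith
    then show ?thesis
    proof cases
      case 1
      then have "k \<le> J" using le by simp
      note l = f_low[OF k(1) this] f_low[OF k(2) 1]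
      have "g b = g b' \<longleftrightarrow> b = b'" by (rule inj_on_eq_iff[OF bij_betw_imp_inj_on[OF g] l(2) l(5)])
      then show ?thesis using orthonormal_familyD[OF C(3), of "g b" "g b'"] l by simp
    next
      case 2
      then have "k \<noteq> k'" by simp
      then have "b \<noteq> b'" using B_disjoint k by blast
      then show ?thesis using low_high[of "g b" b' k'] f_low[OF k(1) 2(1)] f_high[OF k(2) 2(2)] k 2 by simp
    next
      case 3
      then show ?thesis using orthonormal_familyD[OF \<Phi>(1), of k b b'] f_high k by simp
    next
      case 4
      then have kk: "k \<noteq> k'" "k' > J" by auto
      then have "b \<noteq> b'" using B_disjoint k by blast
      have "cinner (\<Phi> k b) (\<Phi> k' b') = cinner (F k (\<Phi> k b)) (F k' (\<Phi> k' b'))"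
        using \<Phi>(2)[of k b] \<Phi>(2)[of k' b'] k 4 kk by simp
      also have "\<dots> = 0" unfolding symF F.E_orth[OF kk(1)] by simp
      finally show ?thesis using f_high[OF k(1) 4(1)] f_high[OF k(2) kk(2)] \<open>b \<noteq> b'\<close> by simp
    qed
  qed
  have on: "orthonormal_family f (\<Union>k. B k)"
    unfolding orthonormal_family_def
  proof (intro ballI)
    fix b b' assume "b \<in> (\<Union>k. B k)" "b' \<in> (\<Union>k. B k)"
    then obtain k k' where k: "b \<in> B k" "b' \<in> B k'" by blast
    show "cinner (f b) (f b') = (if b = b' then 1 else 0)"
    proof (cases "k \<le> k'")
      case False
      then have "cinner (f b') (f b) = (if b' = b then 1 else 0)" using cases[OF k(2,1)] by simp
      then show ?thesis using cinner_commute[of "f b" "f b'"] by auto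
    qed (use cases k in auto)
  qed
  have total: "y = 0" if y: "\<And>b. b \<in> (\<Union>k. B k) \<Longrightarrow> cinner (f b) y = 0" for y
  proof -
    \<comment> \<open>Orthogonality to \<open>C\<close> removes the whole of \<open>SF J y\<close>,
      and with it every \<open>F k y\<close> with \<open>k \<le> J\<close>.\<close>
    have low0: "SF J y = 0"
    proof (rule C(5)[unfolded total_in_def, rule_format])
      fix c assume c: "c \<in> C"
      then obtain b where b: "b \<in> low" "c = g b" using g unfolding bij_betw_def by blast
      then obtain k where k: "b \<in> B k" "k \<le> J" unfolding low_def by blast
      have "cinner c (SF J y) = cinner c y" using symSF[of c y] SF_f[OF c] by simp
      also have "\<dots> = 0" using y[of b] k f_low(1)[OF k] b(2) by auto
      finally show "cinner (id c) (SF J y) = 0" by simp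
    qed simp
    have "F k y = 0" for k
    proof (cases "k \<le> J")
      case True
      then show ?thesis using F.E_partial_sum[of k J y] low0 by (simp add: blinfun.zero_right)
    next
      case False
      show ?thesis
      proof (rule \<Phi>(4)[unfolded total_in_def, rule_format])
        show "J \<le> k" using False by simp
        show "cinner (\<Phi> k b) (F k y) = 0" if "b \<in> B k" for b
          using y[of b] f_high[OF that] False that \<Phi>(2)[of k b] symF[of k "\<Phi> k b" y] by auto
      qed simp
    qed
    then show "y = 0" by (rule F.E_eq_0I)
  qed
  show ?thesis
  proof (intro exI conjI allI impI ballI)
    show "orthonormal_family f (\<Union>k. B k)" by (rule on)
    show "total_in f (\<Union>k. B k) UNIV"
      unfolding total_in_def
    proof (intro ballI impI)
      fix y assume "\<forall>b\<in>(\<Union>k. B k). cinner (f b) y = 0"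
      then show "y = 0" by (intro total) (rule bspec)
    qed
    show "norm (f b - b) \<le> gram_schmidt_const n * norm (E k - F k)" if "J < k" "b \<in> B k" for k b
      using \<Phi>(3)[of k b] f_high[OF that(2,1)] that by simp
  qed
qed

text \<open>The terms are nonnegative and the first \<open>N\<close> vectors lie in finitely many
  blocks, so the block sums bound the partial sums for whatever enumeration. Thus all enumerations
  are treated alike, as \<open>bari_basis_set\<close> demands.\<close>

lemma summable_enumeration:
  fixes \<psi> :: "nat \<Rightarrow> 'a" and h :: "'a \<Rightarrow> real"
  assumes \<psi>: "inj \<psi>" "range \<psi> \<subseteq> (\<Union>k. B k)" and h: "\<And>b. 0 \<le> h b"
    and s: "summable (\<lambda>k. \<Sum>b\<in>B k. h b)"
  shows "summable (\<lambda>j. h (\<psi> j))"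
proof (rule summableI_nonneg_bounded)
  fix N
  obtain K where K: "\<And>j. j < N \<Longrightarrow> block_of (\<psi> j) \<le> K"
    using finite_nat_set_iff_bounded_le[of "(\<lambda>j. block_of (\<psi> j)) ` {..<N}"] by auto
  have sub: "\<psi> ` {..<N} \<subseteq> (\<Union>k\<le>K. B k)"
  proof safe
    fix j assume "j < N"
    obtain k where "\<psi> j \<in> B k" using \<psi>(2) by blast
    then show "\<psi> j \<in> (\<Union>k\<le>K. B k)" using K[OF \<open>j < N\<close>] block_of by auto
  qed
  have "(\<Sum>j<N. h (\<psi> j)) = (\<Sum>b\<in>\<psi> ` {..<N}. h b)"
    using inj_on_subset[OF \<psi>(1)] by (simp add: sum.reindex)
  also have "\<dots> \<le> (\<Sum>b\<in>(\<Union>k\<le>K. B k). h b)"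
    using sub finite_B h by (intro sum_mono2) auto
  also have "\<dots> = (\<Sum>k\<le>K. \<Sum>b\<in>B k. h b)"
    using finite_B B_disjoint by (intro sum.UNION_disjoint) auto
  also have "\<dots> \<le> (\<Sum>k. \<Sum>b\<in>B k. h b)"
    by (intro sum_le_suminf s) (auto intro: sum_nonneg h)
  finally show "(\<Sum>j<N. h (\<psi> j)) \<le> (\<Sum>k. \<Sum>b\<in>B k. h b)" .
qed (rule h)

text \<open>Bessel's inequality in each block leaves the sum of \<open>(norm (E k x))^2\<close>.
  Write \<open>E k x\<close> as \<open>(E k - F k) x + F k x\<close>: the first part is square
  summable by \<open>close\<close>, the second because the \<open>F k\<close> are orthogonal
  projections with contractive partial sums.\<close>

lemma summable_coef_blocks: "summable (\<lambda>k. \<Sum>b\<in>B k. (cmod (coef b x))\<^sup>2)"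
proof (rule summable_comparison_test'[where N = 0])
  have "summable (\<lambda>k. (norm (F k x))\<^sup>2)"
  proof (rule bounded_imp_summable)
    fix N
    have F2: "cinner (F k x) x = of_real ((norm (F k x))\<^sup>2)" for k
      by (metis cinner_self F.E_idem orth_projection_cinner[OF F_orth])
    have sym: "cinner (SF N y) z = cinner y (SF N z)" for y z
      unfolding SF_def blinfun.sum_left cinner.sum_left cinner.sum_right
      by (simp add: orth_projection_cinner[OF F_orth])
    have "norm (SF N x) \<le> norm x"
      by (rule norm_le_if_cinner_eq) (simp add: sym F.partial_sum_idem)
    then have "cmod (cinner (SF N x) x) \<le> norm x * norm x"
      by (intro order_trans[OF cmod_cinner_le] mult_right_mono) auto
    moreover have "cinner (SF N x) x = of_real (\<Sum>k\<le>N. (norm (F k x))\<^sup>2)"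
      by (simp add: SF_def blinfun.sum_left cinner.sum_left F2)
    ultimately have "\<bar>\<Sum>k\<le>N. (norm (F k x))\<^sup>2\<bar> \<le> norm x * norm x" by (simp only: norm_of_real)
    then show "(\<Sum>k\<le>N. (norm (F k x))\<^sup>2) \<le> norm x * norm x" by (rule order_trans[OF abs_ge_self])
  qed (rule zero_le_power2)
  then show "summable (\<lambda>k. 2 * ((norm (E k - F k))\<^sup>2 * (norm x)\<^sup>2) + 2 * (norm (F k x))\<^sup>2)"
    by (intro summable_add summable_mult summable_mult2 close)
  fix k
  have "(\<Sum>b\<in>B k. (cmod (coef b x))\<^sup>2) = (\<Sum>b\<in>B k. (cmod (cinner (id b) (E k x)))\<^sup>2)"
    by (intro sum.cong refl) (simp add: coef_def block_of)
  also have "\<dots> \<le> (norm (E k x))\<^sup>2" by (rule bessel_finite[OF B_orthonormal finite_B])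
  also have "\<dots> \<le> (norm (E k - F k) * norm x + norm (F k x))\<^sup>2"
  proof (intro power_mono norm_ge_zero)
    have "E k x = (E k - F k) x + F k x" by (simp add: blinfun.diff_left)
    then have "norm (E k x) \<le> norm ((E k - F k) x) + norm (F k x)" by (metis norm_triangle_ineq)
    then show "norm (E k x) \<le> norm (E k - F k) * norm x + norm (F k x)"
      using norm_blinfun[of "E k - F k" x] by linarith
  qed
  also have "\<dots> \<le> 2 * (norm (E k - F k) * norm x)\<^sup>2 + 2 * (norm (F k x))\<^sup>2" by (rule square_sum_le)
  finally show "norm (\<Sum>b\<in>B k. (cmod (coef b x))\<^sup>2) \<le> 2 * ((norm (E k - F k))\<^sup>2 * (norm x)\<^sup>2) + 2 * (norm (F k x))\<^sup>2"
    by (simp add: sum_nonneg power_mult_distrib)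
qed

lemma coef_sums:
  assumes "f sums x"
  shows "(\<lambda>j. coef b (f j)) sums coef b x"
  unfolding coef_def
  by (intro cinner_sums bounded_linear.sums[OF blinfun.bounded_linear_right] assms)

lemma coef_eq_0I:
  assumes "\<And>b. b \<in> (\<Union>k. B k) \<Longrightarrow> coef b x = 0"
  shows "x = 0"
proof (rule E.E_eq_0I)
  fix k
  have "E k x \<in> closure (cspan (B k))" unfolding B_closure by simp
  from orthonormal_expansion[OF B_orthonormal finite_B this]
  have "E k x = (\<Sum>b\<in>B k. cinner b (E k x) *\<^sub>C b)" by simp
  also have "\<dots> = 0"
  proof (rule sum.neutral, rule ballI)
    fix b assume b: "b \<in> B k"
    then have "coef b x = 0" by (intro assms) blast
    then show "cinner b (E k x) *\<^sub>C b = 0" by (simp add: coef_def block_of[OF b])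
  qed
  finally show "E k x = 0" .
qed

text \<open>With the square summable coefficients \<open>c j\<close>, the series of
  \<open>c j \<phi> j\<close> converges by orthonormality and that of
  \<open>c j (\<psi> j - \<phi> j)\<close> absolutely. Their sum is the expansion in
  \<open>\<psi>\<close>, whose limit is recognized as \<open>x\<close> because it has the same
  coordinates \<open>coef\<close>.\<close>

lemma bari_basis_enumeration:
  assumes \<psi>: "bij_betw \<psi> (UNIV :: nat set) (\<Union>k. B k)"
  shows "bari_basis \<psi>"
proof -
  obtain f where f: "orthonormal_family f (\<Union>k. B k)" "total_in f (\<Union>k. B k) UNIV"
    "\<forall>k>J. \<forall>b\<in>B k. norm (f b - b) \<le> gram_schmidt_const n * norm (E k - F k)"
    using orthonormal_partner by (elim exE conjE)
  have inj: "inj \<psi>" and ran: "range \<psi> = (\<Union>k. B k)" using \<psi> by (auto simp: bij_betw_def)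
  have \<psi>B: "\<psi> j \<in> (\<Union>k. B k)" for j using ran by blast
  define \<phi> where "\<phi> j = f (\<psi> j)" for j
  have \<phi>: "orthonormal_family \<phi> UNIV"
    unfolding orthonormal_family_def \<phi>_def
    using orthonormal_familyD[OF f(1) \<psi>B \<psi>B] inj by (simp add: inj_eq)
  have onb: "orthonormal_basis \<phi>"
  proof (rule orthonormal_basisI[OF \<phi>])
    fix x assume x: "\<And>j. cinner (\<phi> j) x = 0"
    show "x = 0"
    proof (rule f(2)[unfolded total_in_def, rule_format])
      fix b assume "b \<in> (\<Union>k. B k)"
      then obtain j where "b = \<psi> j" using ran by blast
      then show "cinner (f b) x = 0" using x[of j] by (simp add: \<phi>_def)
    qed simp
  qed
  have close_\<phi>: "summable (\<lambda>j. (norm (\<psi> j - \<phi> j))\<^sup>2)"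
    unfolding \<phi>_def
  proof (rule summable_enumeration[OF inj, where h = "\<lambda>b. (norm (b - f b))\<^sup>2"])
    define g where "g = gram_schmidt_const n"
    \<comment> \<open>The start is \<open>Suc J\<close> because the partner \<open>f b\<close> is
      known to be close to \<open>b\<close> only strictly above \<open>J\<close>.\<close>
    have "norm (\<Sum>b\<in>B k. (norm (b - f b))\<^sup>2) \<le> real n * (g\<^sup>2 * (norm (E k - F k))\<^sup>2)" if k: "k \<ge> Suc J" for k
    proof -
      have "(norm (b - f b))\<^sup>2 \<le> g\<^sup>2 * (norm (E k - F k))\<^sup>2" if "b \<in> B k" for b
      proof -
        have "(norm (b - f b))\<^sup>2 \<le> (g * norm (E k - F k))\<^sup>2"
          using f(3) that k by (intro power_mono) (auto simp: g_def norm_minus_commute)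
        then show ?thesis by (simp add: power_mult_distrib)
      qed
      then have "(\<Sum>b\<in>B k. (norm (b - f b))\<^sup>2) \<le> real (card (B k)) * (g\<^sup>2 * (norm (E k - F k))\<^sup>2)"
        by (rule sum_bounded_above)
      also have "\<dots> \<le> real n * (g\<^sup>2 * (norm (E k - F k))\<^sup>2)"
        using finite_B_high(2)[of k] k by (intro mult_right_mono) auto
      finally show ?thesis by (simp add: sum_nonneg)
    qed
    then show "summable (\<lambda>k. \<Sum>b\<in>B k. (norm (b - f b))\<^sup>2)"
      by (intro summable_comparison_test'[OF summable_mult[OF summable_mult[OF close]]])
  qed (use ran in auto)
  have unique: "c i = coef (\<psi> i) x" if "(\<lambda>j. c j *\<^sub>C \<psi> j) sums x" for c x i
  proof -
    have "coef (\<psi> i) (c j *\<^sub>C \<psi> j) = (if j = i then c j else 0)" for j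
    proof -
      have "coef (\<psi> i) (c j *\<^sub>C \<psi> j) = c j * coef (\<psi> i) (\<psi> j)"
        by (simp add: coef_def clinear_opD[OF E.E_clinear])
      then show ?thesis using coef_biorthogonal[OF \<psi>B[of i] \<psi>B[of j]] inj by (auto simp: inj_eq)
    qed
    then have "(\<lambda>j. if j = i then c j else 0) sums coef (\<psi> i) x" using coef_sums[OF that, of "\<psi> i"] by simp
    then show ?thesis using sums_single[of i c] by (simp add: sums_unique2)
  qed
  have "vector_basis \<psi>"
    unfolding vector_basis_def
  proof (intro allI ex1I)
    fix x
    define c where "c j = coef (\<psi> j) x" for j
    have c2: "summable (\<lambda>j. (cmod (c j))\<^sup>2)"
      unfolding c_def
      by (rule summable_enumeration[OF inj, where h = "\<lambda>b. (cmod (coef b x))\<^sup>2"])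
        (use ran summable_coef_blocks in auto)
    have "summable (\<lambda>j. c j *\<^sub>C (\<psi> j - \<phi> j))"
    proof (rule summable_comparison_test'[where N = 0])
      show "summable (\<lambda>j. (cmod (c j))\<^sup>2 + (norm (\<psi> j - \<phi> j))\<^sup>2)" by (intro summable_add c2 close_\<phi>)
      show "norm (c j *\<^sub>C (\<psi> j - \<phi> j)) \<le> (cmod (c j))\<^sup>2 + (norm (\<psi> j - \<phi> j))\<^sup>2" for j
      proof -
        have "0 \<le> cmod (c j) * norm (\<psi> j - \<phi> j)" by simp
        then show ?thesis
          using sum_squares_bound[of "cmod (c j)" "norm (\<psi> j - \<phi> j)"] unfolding norm_scaleC by linarith
      qed
    qed
    then have "summable (\<lambda>j. c j *\<^sub>C \<phi> j + c j *\<^sub>C (\<psi> j - \<phi> j))"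
      by (intro summable_add summable_orthonormal[OF \<phi> c2])
    then have "summable (\<lambda>j. c j *\<^sub>C \<psi> j)" by (simp add: scaleC.diff_right)
    then obtain y where y: "(\<lambda>j. c j *\<^sub>C \<psi> j) sums y" unfolding summable_def by blast
    have "x - y = 0"
    proof (rule coef_eq_0I)
      fix b assume "b \<in> (\<Union>k. B k)"
      then obtain j where b: "b = \<psi> j" using ran by blast
      have "coef b x = coef b y" using unique[OF y, of j] by (simp add: b c_def)
      then show "coef b (x - y) = 0" by (simp add: coef_def blinfun.diff_right cinner.diff_right)
    qed
    then have yx: "y = x" by simp
    show "(\<lambda>j. coef (\<psi> j) x *\<^sub>C \<psi> j) sums x" using y unfolding yx c_def .
    show "c' = (\<lambda>j. coef (\<psi> j) x)" if "(\<lambda>j. c' j *\<^sub>C \<psi> j) sums x" for c'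
      by (rule ext) (rule unique[OF that])
  qed
  then show ?thesis unfolding bari_basis_def using onb close_\<phi> by blast
qed

text \<open>If \<open>B k\<close> were empty, \<open>E k\<close> would vanish, but the nonzero
  projection \<open>F k\<close> is at distance less than \<open>1\<close>. This is what makes the
  union of the bases infinite.\<close>

lemma B_nonempty:
  assumes "k \<ge> J"
  shows "B k \<noteq> {}"
proof
  assume "B k = {}"
  then have "range (E k) = {0}" using B_span[of k] complex_vector.span_empty by metis
  then have E0: "E k x = 0" for x using rangeI[of "E k" x] by simp
  obtain x where x: "F k x \<noteq> 0" using F_nonzero by blast
  have "F k x = 0"
    using injective_of_close[of "F k" "E k" "F k x"] close_lt_1[OF assms] E0 F.E_idem
    by (simp add: norm_minus_commute)
  then show False using x by simp
qed

lemma bari_basis_union: "bari_basis_set (\<Union>k. B k)"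
  unfolding bari_basis_set_def
proof (intro conjI allI impI bari_basis_enumeration)
  have "countable (\<Union>k. B k)" by (rule countable_UN) (simp_all add: countable_finite finite_B)
  moreover have "infinite (\<Union>k. B k)"
  proof
    assume "finite (\<Union>k. B k)"
    then have "finite (block_of ` (\<Union>k. B k))" by (rule finite_imageI)
    moreover have "{J..} \<subseteq> block_of ` (\<Union>k. B k)"
    proof
      fix k assume "k \<in> {J..}"
      then obtain b where "b \<in> B k" using B_nonempty[of k] by auto
      then show "k \<in> block_of ` (\<Union>k. B k)" using block_of[of b k] by blast
    qed
    ultimately have "finite {J..}" by (rule rev_finite_subset)
    then show False using infinite_Ici by blast
  qed
  ultimately show "\<exists>\<psi>::nat \<Rightarrow> 'a. bij_betw \<psi> UNIV (\<Union>k. B k)" using bij_betw_from_nat_into by blast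
qed

end

section \<open>Application to the Riesz projections of \<open>H\<close> and \<open>A\<close>\<close>

context summable_gaps
begin

lemma bari_basis_Qblock:
  assumes "\<And>k. cdim_le (range (Pblock k)) n" "\<And>k. orthonormal_basis_of (B k) (range (Qblock k))"
  shows "bari_basis_set (\<Union>k. B k)"
proof -
  interpret close_projections Qblock Pblock B n
  proof
    show "orth_projection (Pblock k)" for k by (rule Pblock_orth_projection)
    show "summable (\<lambda>k. (norm (Qblock k - Pblock k))\<^sup>2)" by (rule summable_Qblock_Pblock)
    have "(\<Sum>k\<le>j. Qblock k) - (\<Sum>k\<le>j. Pblock k) = Qbig (last_of j) - Pbig (last_of j)" for j
      by (rule blinfun_eqI)
        (simp only: blinfun.diff_left blinfun.sum_left Qbig_eq_sum unperturbed.Qbig_eq_sum)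
    then show "(\<lambda>j. (\<Sum>k\<le>j. Qblock k) - (\<Sum>k\<le>j. Pblock k)) \<longlonglongrightarrow> 0"
      using Qbig_Pbig_tendsto by simp
    show "\<exists>x. Pblock k x \<noteq> 0" for k
    proof -
      obtain x where "x \<noteq> 0" "(x, complex_of_real (lam (last_of k)) *\<^sub>C x) \<in> A"
        using lam_eigenvalue[OF first_last(3), of k] unfolding eigenvalue_def by blast
      then show ?thesis using eigenvector_in_Pblock[of x "last_of k" k] first_last(2)[of k] by (intro exI[of _ x]) simp
    qed
  qed (use assms in auto)
  show ?thesis by (rule bari_basis_union)
qed

text \<open>For \<open>k > 0\<close> both \<open>block_index i0 k\<close> and
  \<open>last_of k\<close> equal \<open>i0 + k - 1\<close>. Centre and radius then reduce to
  \<open>lam\<close> of this index and \<open>r\<close>, since first and last eigenvalue of the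
  block coincide.\<close>

lemma circle_projection_block:
  "circle_projection H lam i0 r (block_index i0 k) = Qblock k"
  "circle_projection A lam i0 r (block_index i0 k) = Pblock k"
proof -
  have "complex_of_real (circle_center lam i0 (block_index i0 k)) = bctr k"
    "circle_radius lam i0 r (block_index i0 k) = brad k r"
    using i0 by (auto simp: circle_center_def circle_radius_def block_index_def ctr_def rad_def
        first_of_def last_of_def)
  then show "circle_projection H lam i0 r (block_index i0 k) = Qblock k"
    "circle_projection A lam i0 r (block_index i0 k) = Pblock k"
    unfolding circle_projection_def riesz_op_eq by simp_all
qed

end

theorem theorem10:
  fixes S :: "('a::chilbert_space, 'b::chilbert_space) coupling"
    and lam :: "nat \<Rightarrow> real"
    and r :: real and i0 :: nat
    and l :: "nat \<Rightarrow> int"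
    and \<Gamma> :: "nat \<Rightarrow> real \<Rightarrow> complex"
    and X :: "'b \<Rightarrow>\<^sub>L 'b"
    and a\<^sub>0 b\<^sub>0 :: real
    and ray :: "complex set"
    and P Q :: "nat \<Rightarrow> ('b \<Rightarrow>\<^sub>L 'b)"
    and N :: "nat \<Rightarrow> 'b set"
  assumes setting: "operator_setting S" "spectral_assumptions S" "analyticity_assumptions S"
    and A1: "compact_resolvent (opA1 S)" "semibounded_below (opA1 S)"
      "infinite ((\<Union>k\<in>{1..nint S}. Delta S k) \<inter> real_spectrum (opA1 S))"
    and last_interval: "hi S (nint S) = \<infinity>"
    and eigenvalues: "strict_mono_on {1..} lam"
      "lam ` {1..} = {x. eigenvalue (opA1 S) (complex_of_real x)}"
    and gaps: "summable (\<lambda>i. 1 / (lam (Suc (Suc i)) - lam (Suc i))\<^sup>2)"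
    and l: "sign_choice S l"
    and r: "2 \<le> i0" "\<And>i. i \<ge> i0 \<Longrightarrow> lam i - lam (i - 1) > 2 * r" "2 * r > 4 * r0 S l"
    and contour: "admissible S l \<Gamma>"
    and ray: "ray = {Complex x b\<^sub>0 | x. a\<^sub>0 \<le> x}" "Complex a\<^sub>0 b\<^sub>0 \<in> signed_domain S l (nint S)"
      "ray \<subseteq> \<Gamma> (nint S) ` Delta S (nint S)"
    and rest: "contour_set S \<Gamma> - ray \<subseteq> {\<mu>. Re \<mu> < a\<^sub>0}"
    and decay: "\<exists>C>0. \<exists>\<theta>>1. \<forall>\<mu>\<in>ray. norm (dK S (nint S) \<mu>) \<le> C * (1 + \<bar>Re \<mu>\<bar>) powr (- \<theta>)"
    and X: "is_solution S l X"
    and Q: "\<And>i. Q i = circle_projection (graph_plus (opA1 S) X) lam i0 r i"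
    and P: "\<And>i. P i = circle_projection (opA1 S) lam i0 r i"
    and N: "\<And>j. N j = range (blinfun_apply (Q (block_index i0 j)))"
  shows "subspace_basis N \<and> quadratically_close_to_orthogonal N \<and>
    ((\<exists>n. \<forall>j. cdim_le (range (blinfun_apply (P (block_index i0 j)))) n) \<longrightarrow>
      (\<forall>B. (\<forall>j. orthonormal_basis_of (B j) (N j)) \<longrightarrow> bari_basis_set (\<Union>j. B j)))"
proof -
  \<comment> \<open>\<open>X\<close> obeys the bound \<open>r_min\<close> of every admissible
    contour, and the given contour makes the set under the infimum nonempty. With
    \<open>2 * r > 4 * r0 S l\<close> this yields \<open>norm X < r / 2\<close> and, as
    \<open>norm X\<close> is nonnegative, \<open>r > 0\<close>.\<close>
  have "norm X \<le> r0 S l"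
    unfolding r0_def using contour X by (intro cInf_greatest) (auto simp: is_solution_def)
  then have norm_X: "norm X < r" using r(3) norm_ge_zero[of X] by linarith
  interpret summable_gaps "opA1 S" lam X r i0
  proof
    show "self_adjoint (opA1 S)" using setting(1) by (simp add: operator_setting_def)
    show "clinear_op X" using X by (simp add: is_solution_def)
    show "t \<in> lam ` {1..}" if "eigenvalue (opA1 S) (complex_of_real t)" for t
      using eigenvalues(2) that by simp
    show "eigenvalue (opA1 S) (complex_of_real (lam i))" if "1 \<le> i" for i
    proof -
      have "lam i \<in> lam ` {1..}" using that by simp
      then show ?thesis unfolding eigenvalues(2) by simp
    qed
  qed (use A1(1) eigenvalues(1) r norm_X gaps in auto)
  have N_eq: "N = (\<lambda>k. range (Qblock k))" unfolding N Q circle_projection_block(1) ..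
  have P_eq: "P (block_index i0 j) = Pblock j" for j unfolding P circle_projection_block(2) ..
  show ?thesis
    unfolding N_eq P_eq using Q.subspace_basis_range quadratically_close_Qblock bari_basis_Qblock by blast
qed

end
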